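(* Consider a family of rings $\mathcal R\subset\mathbb C[[z]]$ of unibranch plane curve singularities, each with chosen generators $x,y$, such that the valuation semigroup $\Gamma=\Gamma_{\mathcal R}$ is the same for all members of the family (hence so is $\delta$), and such that the ideal $\tilde C_{\mathcal R}\subset\mathbb C[[x,y]]$, the full preimage of $z^{2\delta}\mathbb C[[z]]\subset\mathcal R$ under $\mathbb C[[x,y]]\to\mathcal R$, is constant in the family up to automorphisms of the ring $\mathbb C[[x,y]]$ (for any two members the corresponding ideals are carried to one another by an automorphism of $\mathbb C[[x,y]]$). Then the schemes $\widetilde{Jac^\bullet}$ and $\widetilde{Jac}^{(d)}$ are constant in the family up to isomorphism of schemes. Here $\widetilde{Jac}^{(d)}$ covers $Jac^{(d)}$, for $0\le d\le\delta$, with fibers isomorphic to $\mathbb C^{\delta-d}$.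
   Context: A unibranch plane curve singularity is given by a subring $\mathcal R\subset\mathbb C[[z]]$ topologically generated over $\mathbb C$ by two elements $x,y\in z\mathbb C[[z]]$ and having $\mathbb C((z))$ as its field of fractions; so $\mathcal R=\mathbb C[[x,y]]/(P(x,y))$. $\nu_z$ is the $z$-adic valuation, $\Gamma_{\mathcal R}=\{\nu_z(f)\mid 0\neq f\in\mathcal R\}$, $\delta=\dim_{\mathbb C}\mathbb C[[z]]/\mathcal R=|\mathbb Z_+\setminus\Gamma_{\mathcal R}|$; one has $z^{2\delta}\mathbb C[[z]]\subset\mathcal R$. An $\mathcal R$-submodule $M\subset\mathbb C[[z]]$ is called standard if it contains an element of $1+z\mathbb C[[z]]$. Every standard $M$ contains $z^{2\delta}\mathbb C[[z]]$, so for each $d$ the set $Jac^{(d)}=\{M \text{ standard}\mid\dim_{\mathbb C}\mathbb C[[z]]/M=d\}$ is a quasi-projective scheme (a locally closed subscheme of a Grassmannian of $\mathbb C[[z]]/z^{2\delta}\mathbb C[[z]]$), and $Jac^\bullet$ is the disjoint union of the $Jac^{(d)}$. Let $U^1=1+z\mathbb C[[z]]$ (a multiplicative group), $U^1_{\mathcal R}=U^1\cap\mathcal R$. Define $$\widetilde{Jac^\bullet}=\{(M,\phi)\mid M\ \text{standard},\ \phi\in(U^1\cap M)/U^1_{\mathcal R}\},\qquad \widetilde{Jac}^{(d)}=\{(M,\phi)\in\widetilde{Jac^\bullet}\mid M\in Jac^{(d)}\},$$ with their natural scheme structures; the map to $Jac^{(d)}$ is $(M,\phi)\mapsto M$. 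*)

theory Defs
  imports "HOL-Algebra.Algebra" "HOL-Computational_Algebra.Computational_Algebra"
begin

definition C_subalgebra :: "complex fps set \<Rightarrow> bool" where
  "C_subalgebra S \<longleftrightarrow> range fps_const \<subseteq> S \<and>
     (\<forall>f\<in>S. \<forall>g\<in>S. f + g \<in> S) \<and> (\<forall>f\<in>S. \<forall>g\<in>S. f * g \<in> S)"

text \<open>The topology on \<^typ>\<open>complex fps\<close> is the library's z-adic one, so the hull below is the
  C-subalgebra topologically generated by x and y.  The field C((z)) is \<^typ>\<open>complex fls\<close>.\<close>

definition plane_branch :: "complex fps set \<Rightarrow> complex fps \<Rightarrow> complex fps \<Rightarrow> bool" where
  "plane_branch R x y \<longleftrightarrow>
     fps_nth x 0 = 0 \<and> fps_nth y 0 = 0 \<and>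
     R = (\<lambda>S. C_subalgebra S \<and> closed S) hull {x, y} \<and>
     (\<forall>f :: complex fls. \<exists>a\<in>R. \<exists>b\<in>R. b \<noteq> 0 \<and> f = fps_to_fls a / fps_to_fls b)"

definition val_semigroup :: "complex fps set \<Rightarrow> nat set" where
  "val_semigroup R = subdegree ` (R - {0})"

text \<open>\<^term>\<open>has_codim M d\<close>: the quotient C[[z]]/M has a basis consisting of d classes.\<close>

definition has_codim :: "complex fps set \<Rightarrow> nat \<Rightarrow> bool" where
  "has_codim M d \<longleftrightarrow> (\<exists>e :: nat \<Rightarrow> complex fps. \<forall>f.
     \<exists>!c. c \<in> {..<d} \<rightarrow>\<^sub>E UNIV \<and> f - (\<Sum>i<d. fps_const (c i) * e i) \<in> M)"

definition delta :: "complex fps set \<Rightarrow> nat" where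
  "delta R = (THE d. has_codim R d)"

text \<open>C[[x,y]] is \<^typ>\<open>complex fps fps\<close>: the coefficient of \<open>x^i y^j\<close> in F is
  \<open>fps_nth (fps_nth F i) j\<close>.  When x and y have no constant term, \<open>x^i y^j\<close> has order at least
  \<open>i + j\<close>, so the truncated sums below give F(x,y) exactly.\<close>

definition eval2 :: "complex fps \<Rightarrow> complex fps \<Rightarrow> complex fps fps \<Rightarrow> complex fps" where
  "eval2 x y F = Abs_fps (\<lambda>n. \<Sum>i\<le>n. \<Sum>j\<le>n. fps_nth (fps_nth F i) j * fps_nth (x ^ i * y ^ j) n)"

definition C_tilde :: "complex fps set \<Rightarrow> complex fps \<Rightarrow> complex fps \<Rightarrow> complex fps fps set" where
  "C_tilde R x y = {F. fps_X ^ (2 * delta R) dvd eval2 x y F}"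

text \<open>Automorphisms of C[[x,y]] are automorphisms over the base field C.\<close>

definition C_automorphism :: "(complex fps fps \<Rightarrow> complex fps fps) \<Rightarrow> bool" where
  "C_automorphism \<psi> \<longleftrightarrow> bij \<psi> \<and>
     (\<forall>F G. \<psi> (F + G) = \<psi> F + \<psi> G) \<and> (\<forall>F G. \<psi> (F * G) = \<psi> F * \<psi> G) \<and>
     (\<forall>c. \<psi> (fps_const (fps_const c)) = fps_const (fps_const c))"

definition standard :: "complex fps set \<Rightarrow> complex fps set \<Rightarrow> bool" where
  "standard R M \<longleftrightarrow> 0 \<in> M \<and> (\<forall>f\<in>M. \<forall>g\<in>M. f + g \<in> M) \<and> (\<forall>r\<in>R. \<forall>f\<in>M. r * f \<in> M) \<and>
     (\<exists>f\<in>M. fps_nth f 0 = 1)"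

definition jac :: "complex fps set \<Rightarrow> nat \<Rightarrow> complex fps set set" where
  "jac R d = {M. standard R M \<and> has_codim M d}"

text \<open>A C-scheme is given by its functor of points on commutative C-algebras.  The algebras have
  their carriers in an arbitrary type \<open>'u\<close>.  As soon as \<open>'u\<close> has at least the cardinality of the
  continuum, it carries a copy of every finitely generated C-algebra; on schemes of finite type
  over C the functor of points on those algebras is fully faithful (Yoneda), so natural
  isomorphisms of functors of points are isomorphisms of C-schemes.\<close>

definition complex_ring :: "complex ring" where
  "complex_ring = \<lparr>carrier = UNIV, monoid.mult = (*), one = 1, ring.zero = 0, add = (+)\<rparr>"

type_synonym 'u calg = "(complex, 'u) module"

definition calg :: "'u calg \<Rightarrow> bool" where
  "calg A \<longleftrightarrow> algebra complex_ring A"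

definition calg_hom :: "'u calg \<Rightarrow> 'u calg \<Rightarrow> ('u \<Rightarrow> 'u) set" where
  "calg_hom A B = {h \<in> ring_hom A B. \<forall>c. \<forall>a\<in>carrier A. h (c \<odot>\<^bsub>A\<^esub> a) = c \<odot>\<^bsub>B\<^esub> h a}"

record ('u, 'p) functor_of_points =
  points :: "'u calg \<Rightarrow> 'p set"
  transport :: "'u calg \<Rightarrow> 'u calg \<Rightarrow> ('u \<Rightarrow> 'u) \<Rightarrow> 'p \<Rightarrow> 'p"

definition natural ::
  "('u, 'p) functor_of_points \<Rightarrow> ('u, 'q) functor_of_points \<Rightarrow> ('u calg \<Rightarrow> 'p \<Rightarrow> 'q) \<Rightarrow> bool" where
  "natural F G \<eta> \<longleftrightarrow>
     (\<forall>A. calg A \<longrightarrow> \<eta> A \<in> points F A \<rightarrow> points G A) \<and>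
     (\<forall>A B h p. calg A \<longrightarrow> calg B \<longrightarrow> h \<in> calg_hom A B \<longrightarrow> p \<in> points F A \<longrightarrow>
        \<eta> B (transport F A B h p) = transport G A B h (\<eta> A p))"

definition isomorphic_schemes ::
  "('u, 'p) functor_of_points \<Rightarrow> ('u, 'q) functor_of_points \<Rightarrow> bool" where
  "isomorphic_schemes F G \<longleftrightarrow>
     (\<exists>\<eta>. natural F G \<eta> \<and> (\<forall>A. calg A \<longrightarrow> bij_betw (\<eta> A) (points F A) (points G A)))"

text \<open>Surjectivity on A-points for all A gives surjectivity of the morphism of schemes.\<close>

definition covers ::
  "('u, 'p) functor_of_points \<Rightarrow> ('u, 'q) functor_of_points \<Rightarrow> ('u calg \<Rightarrow> 'p \<Rightarrow> 'q) \<Rightarrow> bool" where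
  "covers F G \<pi> \<longleftrightarrow> natural F G \<pi> \<and> (\<forall>A. calg A \<longrightarrow> \<pi> A ` points F A = points G A)"

definition affine_space :: "nat \<Rightarrow> ('u, nat \<Rightarrow> 'u) functor_of_points" where
  "affine_space n =
     \<lparr>points = (\<lambda>A. {..<n} \<rightarrow>\<^sub>E carrier A),
      transport = (\<lambda>A B h a. restrict (h \<circ> a) {..<n})\<rparr>"

definition pser :: "'u calg \<Rightarrow> ('u, nat \<Rightarrow> 'u) module" where
  "pser A =
     \<lparr>carrier = UNIV \<rightarrow> carrier A,
      monoid.mult = (\<lambda>f g n. \<Oplus>\<^bsub>A\<^esub>i\<in>{..n}. f i \<otimes>\<^bsub>A\<^esub> g (n - i)),
      one = (\<lambda>n. if n = 0 then \<one>\<^bsub>A\<^esub> else \<zero>\<^bsub>A\<^esub>),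
      ring.zero = (\<lambda>n. \<zero>\<^bsub>A\<^esub>),
      add = (\<lambda>f g n. f n \<oplus>\<^bsub>A\<^esub> g n),
      module.smult = (\<lambda>a f n. a \<otimes>\<^bsub>A\<^esub> f n)\<rparr>"

definition zpow :: "nat \<Rightarrow> 'u calg \<Rightarrow> (nat \<Rightarrow> 'u) set" where
  "zpow N A = {f \<in> carrier (pser A). \<forall>n<N. f n = \<zero>\<^bsub>A\<^esub>}"

text \<open>For a subspace M of C[[z]] containing \<open>z^N C[[z]]\<close>, \<^term>\<open>extend_scalars N A M\<close> is the image of the
  completed tensor product of M and A in A[[z]].  Similarly \<^term>\<open>base_change N B h M\<close> is the base
  change to B[[z]], along h from A to B, of an A-submodule M of A[[z]] containing \<open>z^N A[[z]]\<close>.\<close>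

definition extend_scalars :: "nat \<Rightarrow> 'u calg \<Rightarrow> complex fps set \<Rightarrow> (nat \<Rightarrow> 'u) set" where
  "extend_scalars N A M =
     (\<lambda>H. submodule H A (pser A)) hull ((\<lambda>f n. fps_nth f n \<odot>\<^bsub>A\<^esub> \<one>\<^bsub>A\<^esub>) ` M \<union> zpow N A)"

definition base_change ::
  "nat \<Rightarrow> 'u calg \<Rightarrow> ('u \<Rightarrow> 'u) \<Rightarrow> (nat \<Rightarrow> 'u) set \<Rightarrow> (nat \<Rightarrow> 'u) set" where
  "base_change N B h M = (\<lambda>H. submodule H B (pser B)) hull ((\<lambda>f. h \<circ> f) ` M \<union> zpow N B)"

abbreviation ring_points :: "complex fps set \<Rightarrow> 'u calg \<Rightarrow> (nat \<Rightarrow> 'u) set" where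
  "ring_points R A \<equiv> extend_scalars (2 * delta R) A R"

definition U1 :: "'u calg \<Rightarrow> (nat \<Rightarrow> 'u) set" where
  "U1 A = {f \<in> carrier (pser A). f 0 = \<one>\<^bsub>A\<^esub>}"

definition U1_ring :: "complex fps set \<Rightarrow> 'u calg \<Rightarrow> (nat \<Rightarrow> 'u) set" where
  "U1_ring R A = U1 A \<inter> ring_points R A"

text \<open>Standard submodules of A[[z]] over the base change of R.  They contain \<open>z^(2\<delta>) A[[z]]\<close>, because
  they contain a unit of A[[z]].\<close>

definition standard_points :: "complex fps set \<Rightarrow> 'u calg \<Rightarrow> (nat \<Rightarrow> 'u) set set" where
  "standard_points R A =
     {M. submodule M A (pser A) \<and> (\<forall>r\<in>ring_points R A. \<forall>f\<in>M. r \<otimes>\<^bsub>pser A\<^esub> f \<in> M) \<and>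
         U1 A \<inter> M \<noteq> {}}"

text \<open>For M containing some \<open>z^N A[[z]]\<close>, the quotient A[[z]]/M is finitely generated, and it is
  projective if and only if M is a direct summand.\<close>

definition projective_quotient :: "'u calg \<Rightarrow> (nat \<Rightarrow> 'u) set \<Rightarrow> bool" where
  "projective_quotient A M \<longleftrightarrow>
     (\<exists>L. submodule L A (pser A) \<and> M \<inter> L = {\<zero>\<^bsub>pser A\<^esub>} \<and> M <+>\<^bsub>pser A\<^esub> L = carrier (pser A))"

definition free_quotient :: "'u calg \<Rightarrow> (nat \<Rightarrow> 'u) set \<Rightarrow> nat \<Rightarrow> bool" where
  "free_quotient A M d \<longleftrightarrow>
     (\<exists>e \<in> {..<d} \<rightarrow> carrier (pser A). \<forall>f \<in> carrier (pser A).
        \<exists>!c. c \<in> {..<d} \<rightarrow>\<^sub>E carrier A \<and>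
             f \<ominus>\<^bsub>pser A\<^esub> (\<Oplus>\<^bsub>pser A\<^esub>i\<in>{..<d}. c i \<odot>\<^bsub>pser A\<^esub> e i) \<in> M)"

text \<open>The rank of a finitely generated projective module is its dimension at field-valued points.
  Up to isomorphism all residue fields of A occur among the fields K below, since they have at
  most as many elements as A.\<close>

definition quotient_rank :: "complex fps set \<Rightarrow> 'u calg \<Rightarrow> (nat \<Rightarrow> 'u) set \<Rightarrow> nat \<Rightarrow> bool" where
  "quotient_rank R A M d \<longleftrightarrow>
     (\<forall>K h. calg K \<longrightarrow> field K \<longrightarrow> h \<in> calg_hom A K \<longrightarrow>
        free_quotient K (base_change (2 * delta R) K h M) d)"

text \<open>\<open>Jac_d R d\<close> is a subfunctor of the Grassmannian functor of locally free quotients of rank d of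
  \<open>C[[z]]/z^(2\<delta>)\<close>, cut out by stability under R (closed) and standardness (open).\<close>

definition Jac_d :: "complex fps set \<Rightarrow> nat \<Rightarrow> ('u, (nat \<Rightarrow> 'u) set) functor_of_points" where
  "Jac_d R d =
     \<lparr>points = (\<lambda>A. {M \<in> standard_points R A. projective_quotient A M \<and> quotient_rank R A M d}),
      transport = (\<lambda>A B h. base_change (2 * delta R) B h)\<rparr>"

text \<open>A point of a disjoint union of the \<open>Jac_d R d\<close> is a module whose quotient has a locally constant
  rank, which is automatic for finitely generated projective quotients.\<close>

definition Jac :: "complex fps set \<Rightarrow> ('u, (nat \<Rightarrow> 'u) set) functor_of_points" where
  "Jac R =
     \<lparr>points = (\<lambda>A. {M \<in> standard_points R A. projective_quotient A M}),
      transport = (\<lambda>A B h. base_change (2 * delta R) B h)\<rparr>"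

text \<open>Pairs of M and a class in \<open>(U1 \<inter> M)/U1_ring R\<close>, represented as a coset in A[[z]].
  The presheaf quotient is already a sheaf, since torsors under a unipotent group scheme over an
  affine scheme in characteristic 0 are trivial.\<close>

definition cover ::
  "complex fps set \<Rightarrow> ('u, (nat \<Rightarrow> 'u) set) functor_of_points \<Rightarrow>
   ('u, (nat \<Rightarrow> 'u) set \<times> (nat \<Rightarrow> 'u) set) functor_of_points" where
  "cover R J =
     \<lparr>points = (\<lambda>A. {(M, \<phi> <#\<^bsub>pser A\<^esub> U1_ring R A) | M \<phi>. M \<in> points J A \<and> \<phi> \<in> U1 A \<inter> M}),
      transport = (\<lambda>A B h (M, \<Phi>).
        (transport J A B h M, ((\<lambda>f. h \<circ> f) ` \<Phi>) <#>\<^bsub>pser B\<^esub> U1_ring R B))\<rparr>"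

definition Jac_tilde ::
  "complex fps set \<Rightarrow> ('u, (nat \<Rightarrow> 'u) set \<times> (nat \<Rightarrow> 'u) set) functor_of_points" where
  "Jac_tilde R = cover R (Jac R)"

definition Jac_tilde_d ::
  "complex fps set \<Rightarrow> nat \<Rightarrow> ('u, (nat \<Rightarrow> 'u) set \<times> (nat \<Rightarrow> 'u) set) functor_of_points" where
  "Jac_tilde_d R d = cover R (Jac_d R d)"

text \<open>The scheme-theoretic fibre over the closed point M, an element of \<^term>\<open>jac R d\<close>.\<close>

definition Jac_tilde_fibre ::
  "complex fps set \<Rightarrow> nat \<Rightarrow> complex fps set \<Rightarrow>
   ('u, (nat \<Rightarrow> 'u) set \<times> (nat \<Rightarrow> 'u) set) functor_of_points" where
  "Jac_tilde_fibre R d M =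
     (Jac_tilde_d R d)
       \<lparr>points := (\<lambda>A. {p \<in> points (Jac_tilde_d R d) A. fst p = extend_scalars (2 * delta R) A M})\<rparr>"

end

theory Submission
  imports Defs
begin

text \<open>Dividing a pair \<open>(M, \<phi>)\<close> by \<open>\<phi>\<close> turns M into an R-module N with R \<open>\<subseteq>\<close> N \<open>\<subseteq>\<close> C[[z]], so the
  covering space is the product of \<open>U^1/U^1_R\<close> and the space of such N.  In each class of \<open>U^1/U^1_R\<close>
  there is a unique series 1 + ... whose other coefficients vanish at the elements of the semigroup
  \<open>\<Gamma>\<close>, hence this factor depends on \<open>\<Gamma>\<close> only.  The modules N are the submodules of C[[z]]/R.  Since
  \<open>\<Gamma>\<close> is symmetric, a linear functional that vanishes on R but not at \<open>z^(2\<delta>-1)\<close> identifies C[[z]]/R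
  with the dual of \<open>R/z^(2\<delta>) C[[z]]\<close>, which is the quotient of C[[x,y]] by \<open>C_tilde\<close>.  Isomorphic
  quotients therefore give semilinearly isomorphic C[[z]]/R, and all of this commutes with base change.

  The symmetry of \<open>\<Gamma>\<close> amounts to 2\<open>\<delta>\<close> being at most the conductor.  Let n be the order of x and
  \<open>v_k\<close> the maximal order of a monic polynomial of degree k in y over C[[x]].  The \<open>v_k\<close> with k < n are
  distinct modulo n, so \<open>\<Gamma>\<close> is the union of the \<open>v_k + n\<nat>\<close>, and both \<open>\<delta>\<close> and the conductor can be read
  off from them; the inequality follows from \<open>v_i + v_(n-1-i) \<le> v_(n-1)\<close>, because products of monic
  polynomials are monic.\<close>

section \<open>Subspaces of C[[z]] and their orders\<close>

text \<open>The automorphism of C[[x,y]] relates only R/z^(2\<delta>) C[[z]] and its counterpart for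
  the other ring. It does not act on C[[z]], so it carries no module N to another one. Duality moves
  the information to C[[z]]/R, where the modules live, but it forgets the multiplication of C[[z]]:
  only semilinearity over R survives. This is why M must first be divided by \<phi>: the transfer
  lives on C[[z]]/R and sees only modules that contain R. As \<phi> is given only up to units of R,
  and the two rings have different units, the division uses the distinguished representative of the
  class, which is the same series for both rings. The transfer is recorded by the images of the
  finitely many z^k with k < 2\<delta>. These are series over C, so the same data define a linear
  map over every C-algebra A, compatibly with change of A. Over A a leading coefficient need not be
  invertible; arguments by orders are therefore replaced by functionals and eliminations that are
  already defined over C.\<close>

definition zideal :: "nat \<Rightarrow> complex fps set" where
  "zideal c = {f. \<forall>k<c. fps_nth f k = 0}"

lemma zideal_0 [simp]: "f \<in> zideal 0"
  by (simp add: zideal_def)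

lemma zero_in_zideal [simp]: "0 \<in> zideal c"
  by (simp add: zideal_def)

lemma zideal_add: "f \<in> zideal c \<Longrightarrow> g \<in> zideal c \<Longrightarrow> f + g \<in> zideal c"
  by (simp add: zideal_def)

lemma zideal_diff_commute: "f - g \<in> zideal c \<Longrightarrow> g - f \<in> zideal c"
  by (simp add: zideal_def)

lemma zideal_diff_trans: "f - g \<in> zideal c \<Longrightarrow> g - h \<in> zideal c \<Longrightarrow> f - h \<in> zideal c"
  by (simp add: zideal_def)

lemma zideal_sum: "(\<And>i. i \<in> A \<Longrightarrow> f i \<in> zideal c) \<Longrightarrow> sum f A \<in> zideal c"
  by (simp add: zideal_def fps_sum_nth)

lemma zideal_mono: "a \<le> b \<Longrightarrow> f \<in> zideal b \<Longrightarrow> f \<in> zideal a"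
  by (simp add: zideal_def)

lemma zideal_Suc_iff: "f \<in> zideal (Suc n) \<longleftrightarrow> f \<in> zideal n \<and> fps_nth f n = 0"
  by (auto simp: zideal_def less_Suc_eq)

text \<open>The elimination step of the inductions on orders: g serves as the pivot at n.\<close>

lemma zideal_cancel_leading:
  assumes "f \<in> zideal n" "g \<in> zideal n" "fps_nth g n = 1"
  shows "f - fps_const (fps_nth f n) * g \<in> zideal (Suc n)"
  unfolding zideal_Suc_iff using assms by (simp add: zideal_def)

lemma zideal_iff_subdegree: "f \<in> zideal n \<longleftrightarrow> f = 0 \<or> n \<le> subdegree f"
proof
  assume "f \<in> zideal n"
  then show "f = 0 \<or> n \<le> subdegree f"
    using subdegree_geI[of f n] by (auto simp: zideal_def)
next
  assume "f = 0 \<or> n \<le> subdegree f"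
  then show "f \<in> zideal n"
    by (auto simp: zideal_def intro: nth_less_subdegree_zero)
qed

lemma zideal_mult_add: "f \<in> zideal a \<Longrightarrow> g \<in> zideal b \<Longrightarrow> f * g \<in> zideal (a + b)"
  by (cases "f = 0 \<or> g = 0") (auto simp: zideal_iff_subdegree)

lemma zideal_mult_right: "f \<in> zideal a \<Longrightarrow> f * g \<in> zideal a"
  using zideal_mult_add[of f a g 0] by simp

lemma zideal_mult_left: "f \<in> zideal a \<Longrightarrow> g * f \<in> zideal a"
  using zideal_mult_right[of f a g] by (simp add: mult.commute)

lemma zideal_power: "fps_nth f 0 = 0 \<Longrightarrow> f ^ n \<in> zideal n"
proof (induction n)
  case (Suc n)
  have "f \<in> zideal 1"
    using Suc.prems by (simp add: zideal_def)
  from zideal_mult_add[OF this Suc.IH[OF Suc.prems]] show ?case by simp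
qed simp

lemma zideal_iff_dvd: "f \<in> zideal n \<longleftrightarrow> fps_X ^ n dvd f"
  by (cases "f = 0") (auto simp: zideal_iff_subdegree fps_dvd_iff)

lemma zideal_all_eq_0: "(\<And>n. f \<in> zideal n) \<Longrightarrow> f = 0"
  by (metis lessI linorder_not_less zideal_iff_subdegree)

lemma fps_mult_nth_leading:
  fixes f g :: "complex fps"
  assumes "f \<in> zideal a" "g \<in> zideal b"
  shows "fps_nth (f * g) (a + b) = fps_nth f a * fps_nth g b"
proof -
  have "fps_nth (f * g) (a + b) = (\<Sum>i=0..a+b. fps_nth f i * fps_nth g (a + b - i))"
    by (simp add: fps_mult_nth)
  also have "\<dots> = (\<Sum>i\<in>{a}. fps_nth f i * fps_nth g (a + b - i))"
  proof (rule sum.mono_neutral_right)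
    show "\<forall>i\<in>{0..a + b} - {a}. fps_nth f i * fps_nth g (a + b - i) = 0"
    proof
      fix i assume i: "i \<in> {0..a + b} - {a}"
      then consider "i < a" | "a + b - i < b" by fastforce
      then show "fps_nth f i * fps_nth g (a + b - i) = 0"
        using assms by cases (auto simp: zideal_def)
    qed
  qed auto
  finally show ?thesis by simp
qed

lemma fps_const_sum: "fps_const (sum f A) = (\<Sum>i\<in>A. fps_const (f i :: complex))"
  by (induction A rule: infinite_finite_induct) (simp_all flip: fps_const_add)

section \<open>Linear subspaces: orders, gaps and codimension\<close>

definition fps_subspace :: "complex fps set \<Rightarrow> bool" where
  "fps_subspace M \<longleftrightarrow> 0 \<in> M \<and> (\<forall>f\<in>M. \<forall>g\<in>M. f + g \<in> M) \<and> (\<forall>a. \<forall>f\<in>M. fps_const a * f \<in> M)"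

lemma fps_subspaceD:
  assumes "fps_subspace M"
  shows "0 \<in> M" "f \<in> M \<Longrightarrow> g \<in> M \<Longrightarrow> f + g \<in> M" "f \<in> M \<Longrightarrow> fps_const a * f \<in> M"
  using assms by (auto simp: fps_subspace_def)

lemma fps_subspace_uminus: "fps_subspace M \<Longrightarrow> f \<in> M \<Longrightarrow> - f \<in> M"
  using fps_subspaceD(3)[of M f "-1"] by (simp flip: fps_const_neg)

lemma fps_subspace_diff: "fps_subspace M \<Longrightarrow> f \<in> M \<Longrightarrow> g \<in> M \<Longrightarrow> f - g \<in> M"
  using fps_subspaceD(2)[of M f "- g"] fps_subspace_uminus[of M g] by simp

lemma fps_subspace_sum:
  "fps_subspace M \<Longrightarrow> (\<And>i. i \<in> A \<Longrightarrow> f i \<in> M) \<Longrightarrow> sum f A \<in> M"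
  by (induction A rule: infinite_finite_induct) (auto simp: fps_subspaceD)

text \<open>\<open>val_semigroup\<close> is applied to arbitrary subspaces, such as the modules M,
  and not only to rings. Rescaling to leading coefficient 1 supplies the pivots of the
  eliminations.\<close>

lemma val_semigroup_iff:
  assumes M: "fps_subspace M"
  shows "n \<in> val_semigroup M \<longleftrightarrow> (\<exists>g\<in>M. g \<in> zideal n \<and> fps_nth g n = 1)"
proof
  assume "n \<in> val_semigroup M"
  then obtain f where f: "f \<in> M" "f \<noteq> 0" "n = subdegree f"
    by (auto simp: val_semigroup_def)
  let ?g = "fps_const (inverse (fps_nth f n)) * f"
  have "?g \<in> M" "?g \<in> zideal n" "fps_nth ?g n = 1"
    using f fps_subspaceD(3)[OF M] by (auto simp: zideal_def)
  then show "\<exists>g\<in>M. g \<in> zideal n \<and> fps_nth g n = 1" by blast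
next
  assume "\<exists>g\<in>M. g \<in> zideal n \<and> fps_nth g n = 1"
  then obtain g where g: "g \<in> M" "g \<in> zideal n" "fps_nth g n = 1" by blast
  then have "subdegree g = n"
    by (intro subdegreeI) (auto simp: zideal_def)
  with g show "n \<in> val_semigroup M"
    by (auto simp: val_semigroup_def image_iff intro!: bexI[of _ g])
qed

lemma nth_gap_eq_0:
  assumes "f \<in> M" "f \<in> zideal n" "n \<notin> val_semigroup M"
  shows "fps_nth f n = 0"
proof (rule ccontr)
  assume "fps_nth f n \<noteq> 0"
  with assms have "subdegree f = n" "f \<noteq> 0"
    by (auto intro!: subdegreeI simp: zideal_def)
  with assms show False by (auto simp: val_semigroup_def)
qed

lemma conductor_le_in_val_semigroup:
  assumes "zideal c \<subseteq> M" "c \<le> n"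
  shows "n \<in> val_semigroup M"
proof -
  have "fps_X ^ n \<in> M"
    using assms by (auto simp: zideal_iff_subdegree)
  then show ?thesis
    by (auto simp: val_semigroup_def image_iff intro!: bexI[of _ "fps_X ^ n"])
qed

lemma finite_gaps: "zideal c \<subseteq> M \<Longrightarrow> finite (- val_semigroup M)"
  by (rule finite_subset[of _ "{..<c}"])
    (use conductor_le_in_val_semigroup[of c M] in \<open>auto simp: not_le[symmetric]\<close>)

text \<open>Descending induction on j, treating the elements of M of order at least j. At an order j
  of M the coefficient \<open>l j\<close> is adjusted so that one element of order j is killed;
  elements of higher order do not see the change. At a gap j there is nothing to adjust, because
  every element of M of order at least j has order above j. Keeping l zero at the other gaps is what
  later lets the coefficient at t be computed from coefficients at orders of M alone.\<close>

lemma annihilating_functional: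
  assumes M: "fps_subspace M" and t: "t \<notin> val_semigroup M"
  obtains l :: "nat \<Rightarrow> complex" where "l t = 1"
    "\<And>k. k \<notin> val_semigroup M \<Longrightarrow> k \<noteq> t \<Longrightarrow> l k = 0"
    "\<And>f. f \<in> M \<Longrightarrow> (\<Sum>k\<le>t. l k * fps_nth f k) = 0"
proof -
  have "\<exists>l::nat \<Rightarrow> complex. l t = 1 \<and> (\<forall>k. k \<notin> val_semigroup M \<longrightarrow> k \<noteq> t \<longrightarrow> l k = 0) \<and>
      (\<forall>f\<in>M \<inter> zideal j. (\<Sum>k\<le>t. l k * fps_nth f k) = 0)" if "j \<le> t" for j
    using that
  proof (induction j rule: inc_induct)
    case base
    let ?l = "\<lambda>k. if k = t then 1 else 0 :: complex"
    have "(\<Sum>k\<le>t. ?l k * fps_nth f k) = 0" if "f \<in> M \<inter> zideal t" for f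
    proof -
      have "(\<Sum>k\<le>t. ?l k * fps_nth f k) = fps_nth f t"
        by (simp add: if_distrib[of "\<lambda>u. u * _"] cong: if_cong)
      then show ?thesis using nth_gap_eq_0[of f M t] that t by simp
    qed
    then show ?case by (intro exI[of _ ?l]) auto
  next
    case (step j)
    then obtain l where l: "l t = 1" "\<And>k. k \<notin> val_semigroup M \<Longrightarrow> k \<noteq> t \<Longrightarrow> l k = 0"
      "\<And>f. f \<in> M \<Longrightarrow> f \<in> zideal (Suc j) \<Longrightarrow> (\<Sum>k\<le>t. l k * fps_nth f k) = 0" by auto
    show ?case
    proof (cases "j \<in> val_semigroup M")
      case False
      then have "f \<in> zideal (Suc j)" if "f \<in> M" "f \<in> zideal j" for f
        using nth_gap_eq_0[of f M j] that by (simp add: zideal_Suc_iff)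
      with l show ?thesis by (intro exI[of _ l]) auto
    next
      case True
      then obtain g where g: "g \<in> M" "g \<in> zideal j" "fps_nth g j = 1"
        using val_semigroup_iff[OF M] by blast
      \<comment> \<open>The value at j is the one that makes the new functional vanish on g, whose
        coefficient at j is 1.\<close>
      define l' where "l' = l(j := - (\<Sum>k\<in>{..t} - {j}. l k * fps_nth g k))"
      have split: "(\<Sum>k\<le>t. l' k * fps_nth f k) = l' j * fps_nth f j + (\<Sum>k\<in>{..t} - {j}. l k * fps_nth f k)" for f
      proof -
        have "(\<Sum>k\<le>t. l' k * fps_nth f k) = l' j * fps_nth f j + (\<Sum>k\<in>{..t} - {j}. l' k * fps_nth f k)"
          using step.hyps by (subst sum.remove[of _ j]) auto
        also have "(\<Sum>k\<in>{..t} - {j}. l' k * fps_nth f k) = (\<Sum>k\<in>{..t} - {j}. l k * fps_nth f k)"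
          by (rule sum.cong) (auto simp: l'_def)
        finally show ?thesis .
      qed
      have lg: "(\<Sum>k\<le>t. l' k * fps_nth g k) = 0"
        unfolding split using g by (simp add: l'_def)
      have "(\<Sum>k\<le>t. l' k * fps_nth f k) = 0" if f: "f \<in> M" "f \<in> zideal j" for f
      proof -
        let ?h = "f - fps_const (fps_nth f j) * g"
        have h: "?h \<in> M" "?h \<in> zideal (Suc j)"
          using f g fps_subspace_diff[OF M] fps_subspaceD(3)[OF M] zideal_cancel_leading
          by blast+
        have "(\<Sum>k\<le>t. l' k * fps_nth ?h k) = (\<Sum>k\<le>t. l k * fps_nth ?h k)"
          by (rule sum.cong) (use h(2) in \<open>auto simp: l'_def zideal_Suc_iff\<close>)
        with l(3)[OF h] have "(\<Sum>k\<le>t. l' k * fps_nth ?h k) = 0" by simp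
        moreover have "(\<Sum>k\<le>t. l' k * fps_nth f k) =
            (\<Sum>k\<le>t. l' k * fps_nth ?h k) + fps_nth f j * (\<Sum>k\<le>t. l' k * fps_nth g k)"
          by (simp add: sum_distrib_left flip: sum.distrib) (simp add: algebra_simps)
        ultimately show ?thesis using lg by simp
      qed
      moreover have "l' t = 1" "\<And>k. k \<notin> val_semigroup M \<Longrightarrow> k \<noteq> t \<Longrightarrow> l' k = 0"
        using l True t step.hyps by (auto simp: l'_def)
      ultimately show ?thesis by (intro exI[of _ l']) auto
    qed
  qed
  from this[of 0] obtain l where "l t = 1 \<and> (\<forall>k. k \<notin> val_semigroup M \<longrightarrow> k \<noteq> t \<longrightarrow> l k = 0) \<and>
      (\<forall>f\<in>M \<inter> zideal 0. (\<Sum>k\<le>t. l k * fps_nth f k) = 0)" by blast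
  then show thesis by (intro that[of l]) auto
qed

text \<open>Division with remainder by M: at an order of M the current coefficient is cleared with
  an element of M, at a gap it is moved into the remainder p.\<close>

lemma ex_gap_supported_remainder:
  assumes M: "fps_subspace M"
  shows "\<exists>p. (\<forall>k. fps_nth p k \<noteq> 0 \<longrightarrow> k \<notin> val_semigroup M \<and> k < n) \<and>
    (\<exists>m\<in>M. f - p - m \<in> zideal n)"
proof (induction n)
  case 0
  show ?case using fps_subspaceD(1)[OF M] by (intro exI[of _ 0]) auto
next
  case (Suc n)
  then obtain p m where p: "\<And>k. fps_nth p k \<noteq> 0 \<Longrightarrow> k \<notin> val_semigroup M \<and> k < n"
    and m: "m \<in> M" "f - p - m \<in> zideal n" by blast
  let ?a = "fps_nth (f - p - m) n"
  show ?case
  proof (cases "n \<in> val_semigroup M")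
    case True
    then obtain g where g: "g \<in> M" "g \<in> zideal n" "fps_nth g n = 1"
      using val_semigroup_iff[OF M] by blast
    have "f - p - (m + fps_const ?a * g) \<in> zideal (Suc n)"
      using zideal_cancel_leading[OF m(2) g(2,3)] by (simp add: algebra_simps)
    moreover have "m + fps_const ?a * g \<in> M"
      using m g by (intro fps_subspaceD[OF M])
    ultimately show ?thesis using p by (intro exI[of _ p]) fastforce
  next
    case False
    let ?p = "p + fps_const ?a * fps_X ^ n"
    have "f - ?p - m \<in> zideal (Suc n)"
      unfolding zideal_Suc_iff using m(2) by (simp add: zideal_def fps_X_power_nth)
    moreover have "k \<notin> val_semigroup M \<and> k < Suc n" if "fps_nth ?p k \<noteq> 0" for k
      using that p[of k] False by (cases "k = n") (auto simp: fps_X_power_nth)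
    ultimately show ?thesis using m(1) by blast
  qed
qed

text \<open>Otherwise the order of p would be both a gap of M and the order of an element of
  M.\<close>

lemma gap_supported_eq_0:
  assumes "\<And>k. fps_nth p k \<noteq> 0 \<Longrightarrow> k \<notin> val_semigroup M" "p \<in> M"
  shows "p = 0"
  using assms(1)[of "subdegree p"] assms(2) by (auto simp: val_semigroup_def)

text \<open>The monomials z^k at the gaps k give the basis. Coefficients exist by division with
  remainder, carried up to z^c C[[z]], which M contains; they are unique because a nonzero
  combination of these monomials is not in M.\<close>

lemma has_codim_card_gaps:
  assumes M: "fps_subspace M" and c: "zideal c \<subseteq> M"
  shows "has_codim M (card (- val_semigroup M))"
proof -
  let ?G = "- val_semigroup M" and ?d = "card (- val_semigroup M)"
  obtain t where t: "bij_betw t {..<?d} ?G"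
    using ex_bij_betw_nat_finite[OF finite_gaps[OF c]] by (auto simp: atLeast0LessThan)
  have tG: "t i \<notin> val_semigroup M" if "i < ?d" for i
    using bij_betwE[OF t] that by auto
  have t_eq: "t i = t j \<longleftrightarrow> i = j" if "i < ?d" "j < ?d" for i j
    using bij_betw_imp_inj_on[OF t] that by (auto simp: inj_on_def)
  define comb where "comb a = (\<Sum>i<?d. fps_const (a i) * fps_X ^ t i)" for a :: "nat \<Rightarrow> complex"
  have comb_nth: "fps_nth (comb a) k = (\<Sum>i<?d. if k = t i then a i else 0)" for a k
    by (simp add: comb_def fps_sum_nth fps_X_power_nth if_distrib cong: if_cong)
  have comb_t: "fps_nth (comb a) (t j) = a j" if "j < ?d" for a j
  proof -
    have "fps_nth (comb a) (t j) = (\<Sum>i<?d. if i = j then a i else 0)"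
      unfolding comb_nth by (rule sum.cong) (use that t_eq in auto)
    with that show ?thesis by simp
  qed
  have comb_gap: "k \<notin> val_semigroup M" if "fps_nth (comb a) k \<noteq> 0" for a k
  proof -
    from that have "(\<Sum>i<?d. if k = t i then a i else 0) \<noteq> 0" by (simp only: comb_nth not_False_eq_True)
    then obtain i where "i \<in> {..<?d}" "(if k = t i then a i else 0) \<noteq> 0"
      by (rule sum.not_neutral_contains_not_neutral)
    with tG[of i] show ?thesis by (simp split: if_splits)
  qed
  have "\<exists>!a. a \<in> {..<?d} \<rightarrow>\<^sub>E UNIV \<and> f - (\<Sum>i<?d. fps_const (a i) * fps_X ^ t i) \<in> M" for f
  proof (rule ex_ex1I)
    from ex_gap_supported_remainder[OF M, of c f] obtain p m where
      p: "\<And>k. fps_nth p k \<noteq> 0 \<Longrightarrow> k \<notin> val_semigroup M" and m: "m \<in> M" "f - p - m \<in> zideal c"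
      by blast
    from m fps_subspaceD(2)[OF M, of "f - p - m" m] c have fp: "f - p \<in> M" by auto
    let ?a = "restrict (\<lambda>i. fps_nth p (t i)) {..<?d}"
    have "comb ?a = p"
    proof (rule fps_ext)
      fix k
      show "fps_nth (comb ?a) k = fps_nth p k"
      proof (cases "k \<in> val_semigroup M")
        case True
        with p[of k] comb_gap[of ?a k] show ?thesis by fastforce
      next
        case False
        then obtain i where "i < ?d" "k = t i"
          using t by (auto simp: bij_betw_def image_iff set_eq_iff)
        then show ?thesis using comb_t[of i ?a] by simp
      qed
    qed
    with fp show "\<exists>a. a \<in> {..<?d} \<rightarrow>\<^sub>E UNIV \<and> f - (\<Sum>i<?d. fps_const (a i) * fps_X ^ t i) \<in> M"
      by (intro exI[of _ ?a]) (auto simp: comb_def)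
  next
    fix a b
    assume a: "a \<in> {..<?d} \<rightarrow>\<^sub>E UNIV \<and> f - (\<Sum>i<?d. fps_const (a i) * fps_X ^ t i) \<in> M"
      and b: "b \<in> {..<?d} \<rightarrow>\<^sub>E UNIV \<and> f - (\<Sum>i<?d. fps_const (b i) * fps_X ^ t i) \<in> M"
    then have "(f - comb b) - (f - comb a) \<in> M"
      using fps_subspace_diff[OF M] unfolding comb_def by blast
    then have "comb a - comb b \<in> M" by (simp add: algebra_simps)
    moreover have "k \<notin> val_semigroup M" if "fps_nth (comb a - comb b) k \<noteq> 0" for k
      using that comb_gap[of a k] comb_gap[of b k] by (cases "fps_nth (comb a) k = 0") auto
    ultimately have "comb a - comb b = 0" by (rule gap_supported_eq_0[rotated])
    then have "a i = b i" if "i < ?d" for i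
      using comb_t[OF that, of a] comb_t[OF that, of b] by simp
    with a b show "a = b" by (auto intro: PiE_ext)
  qed
  then show ?thesis unfolding has_codim_def by (intro exI allI)
qed

text \<open>The two change-of-basis matrices are mutually inverse, and in characteristic 0 the size of
  an identity matrix is its trace.\<close>

lemma has_codim_unique:
  assumes M: "fps_subspace M" and "has_codim M d" "has_codim M d'"
  shows "d = d'"
proof -
  from assms(2)[unfolded has_codim_def] obtain e where
    e: "\<forall>f. \<exists>!c. c \<in> {..<d} \<rightarrow>\<^sub>E UNIV \<and> f - (\<Sum>i<d. fps_const (c i) * e i) \<in> M" ..
  note e = spec[OF e]
  from assms(3)[unfolded has_codim_def] obtain e' where
    e': "\<forall>f. \<exists>!c. c \<in> {..<d'} \<rightarrow>\<^sub>E UNIV \<and> f - (\<Sum>i<d'. fps_const (c i) * e' i) \<in> M" ..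
  note e' = spec[OF e']
  have "\<forall>k. \<exists>c. e' k - (\<Sum>n<d. fps_const (c n) * e n) \<in> M"
    using e by blast
  from choice[OF this] obtain a where
    "\<forall>k. e' k - (\<Sum>n<d. fps_const (a k n) * e n) \<in> M" by (rule exE)
  note a = spec[OF this]
  have "\<forall>n. \<exists>c. e n - (\<Sum>m<d'. fps_const (c m) * e' m) \<in> M"
    using e' by blast
  from choice[OF this] obtain b where
    "\<forall>n. e n - (\<Sum>m<d'. fps_const (b n m) * e' m) \<in> M" by (rule exE)
  note b = spec[OF this]
  have inverse: "(\<Sum>n<p. a k n * b n k) = 1"
    if a: "\<And>k. u' k - (\<Sum>n<p. fps_const (a k n) * u n) \<in> M"
      and b: "\<And>n. u n - (\<Sum>m<q. fps_const (b n m) * u' m) \<in> M"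
      and u': "\<And>f. \<exists>!c. c \<in> {..<q} \<rightarrow>\<^sub>E UNIV \<and> f - (\<Sum>i<q. fps_const (c i) * u' i) \<in> M"
      and k: "k < q"
    for a b :: "nat \<Rightarrow> nat \<Rightarrow> complex" and u u' p q k
  proof -
    let ?c = "restrict (\<lambda>m. \<Sum>n<p. a k n * b n m) {..<q}"
      and ?c' = "restrict (\<lambda>m. if m = k then 1 else 0 :: complex) {..<q}"
    have "(\<Sum>n<p. fps_const (a k n) * (u n - (\<Sum>m<q. fps_const (b n m) * u' m))) \<in> M"
      using b by (intro fps_subspace_sum[OF M] fps_subspaceD(3)[OF M])
    from fps_subspaceD(2)[OF M a[of k] this]
    have "u' k - (\<Sum>n<p. \<Sum>m<q. fps_const (a k n * b n m) * u' m) \<in> M"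
      by (simp add: sum_subtractf sum_distrib_left right_diff_distrib mult.assoc
        flip: fps_const_mult)
    also have "(\<Sum>n<p. \<Sum>m<q. fps_const (a k n * b n m) * u' m) = (\<Sum>m<q. fps_const (?c m) * u' m)"
      by (subst sum.swap) (auto simp: sum_distrib_right fps_const_sum intro!: sum.cong)
    finally have c: "u' k - (\<Sum>m<q. fps_const (?c m) * u' m) \<in> M" .
    have "(\<Sum>m<q. fps_const (?c' m) * u' m) = (\<Sum>m<q. if m = k then u' m else 0)"
      by (intro sum.cong) auto
    also have "\<dots> = u' k" using k by simp
    finally have c': "u' k - (\<Sum>m<q. fps_const (?c' m) * u' m) \<in> M"
      using fps_subspaceD(1)[OF M] by simp
    have "?c \<in> {..<q} \<rightarrow>\<^sub>E UNIV" "?c' \<in> {..<q} \<rightarrow>\<^sub>E UNIV" by simp_all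
    with c c' have "?c = ?c'" using u'[of "u' k"] by blast
    then have "?c k = ?c' k" by (rule fun_cong)
    with k show ?thesis by simp
  qed
  have "of_nat d' = (\<Sum>k<d'. \<Sum>n<d. a k n * b n k)"
    using inverse[OF a b e'] by simp
  also have "\<dots> = (\<Sum>n<d. \<Sum>k<d'. b n k * a k n)"
    by (subst sum.swap) (simp add: mult.commute)
  also have "\<dots> = of_nat d"
    using inverse[OF b a e] by simp
  finally show ?thesis by (simp only: of_nat_eq_iff)
qed

lemma has_codim_iff:
  assumes "fps_subspace M" "zideal c \<subseteq> M"
  shows "has_codim M d \<longleftrightarrow> d = card (- val_semigroup M)"
  using has_codim_unique[OF assms(1) _ has_codim_card_gaps[OF assms]] has_codim_card_gaps[OF assms]
  by blast

lemma delta_eq_card_gaps: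
  assumes "fps_subspace R" "zideal c \<subseteq> R"
  shows "delta R = card (- val_semigroup R)"
  unfolding delta_def has_codim_iff[OF assms] by simp

section \<open>The semigroup of a plane branch\<close>

lemma closed_fps_iff:
  "closed (S :: complex fps set) \<longleftrightarrow> (\<forall>f. (\<forall>N. \<exists>g\<in>S. f - g \<in> zideal N) \<longrightarrow> f \<in> S)"
proof -
  have "fps_cutoff n G = fps_cutoff n F \<longleftrightarrow> F - G \<in> zideal n" for F G :: "complex fps" and n
    by (auto simp: zideal_def fps_eq_iff)
  then show ?thesis
    unfolding closed_def open_fps_iff by blast
qed

lemma C_subalgebra_subspace:
  assumes "C_subalgebra R"
  shows "fps_subspace R"
proof -
  have "fps_const a \<in> R" for a
    using assms by (auto simp: C_subalgebra_def)
  moreover from this[of 0] have "0 \<in> R" by simp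
  ultimately show ?thesis
    using assms by (auto simp: C_subalgebra_def fps_subspace_def)
qed

lemma C_subalgebra_mult: "C_subalgebra R \<Longrightarrow> f \<in> R \<Longrightarrow> g \<in> R \<Longrightarrow> f * g \<in> R"
  by (simp add: C_subalgebra_def)

lemma C_subalgebra_const: "C_subalgebra R \<Longrightarrow> fps_const a \<in> R"
  by (auto simp: C_subalgebra_def)

lemma C_subalgebra_one: "C_subalgebra R \<Longrightarrow> 1 \<in> R"
  using C_subalgebra_const[of R 1] by simp

lemma C_subalgebra_power: "C_subalgebra R \<Longrightarrow> f \<in> R \<Longrightarrow> f ^ n \<in> R"
  by (induction n) (auto simp: C_subalgebra_one C_subalgebra_mult)

lemma plane_branch_subalgebra:
  assumes "plane_branch R x y"
  shows "C_subalgebra R" "closed R" "x \<in> R" "y \<in> R"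
proof -
  let ?P = "\<lambda>S. C_subalgebra S \<and> closed S"
  have R: "R = ?P hull {x, y}"
    using assms by (simp add: plane_branch_def)
  have "?P (?P hull {x, y})"
  proof (rule hull_in)
    fix T :: "complex fps set set"
    assume "Ball T ?P"
    then show "?P (\<Inter>T)"
      by (auto simp: C_subalgebra_def subset_eq)
  qed
  with R show "C_subalgebra R" "closed R" by simp_all
  show "x \<in> R" "y \<in> R"
    unfolding R by (rule hull_inc; simp)+
qed

lemma plane_branch_minimal:
  assumes "plane_branch R x y" "C_subalgebra S" "closed S" "x \<in> S" "y \<in> S"
  shows "R \<subseteq> S"
proof -
  have "R = (\<lambda>S. C_subalgebra S \<and> closed S) hull {x, y}"
    using assms by (simp add: plane_branch_def)
  also have "\<dots> \<subseteq> S"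
    by (rule hull_minimal) (use assms in auto)
  finally show ?thesis .
qed

lemma plane_branch_limit:
  assumes "plane_branch R x y" "\<And>N. \<exists>g\<in>R. f - g \<in> zideal N"
  shows "f \<in> R"
  using plane_branch_subalgebra(2)[OF assms(1)] assms(2) by (auto simp: closed_fps_iff)

text \<open>The analysis of the semigroup divides exponents by the order of x and so requires x to
  be nonzero; exchanging the generators covers the case x = 0.\<close>

lemma plane_branch_swap: "plane_branch R x y \<Longrightarrow> plane_branch R y x"
  by (auto simp: plane_branch_def insert_commute)

lemma val_semigroup_add:
  assumes "C_subalgebra R" "a \<in> val_semigroup R" "b \<in> val_semigroup R"
  shows "a + b \<in> val_semigroup R"
proof -
  from assms obtain f g where "f \<in> R" "f \<noteq> 0" "a = subdegree f" "g \<in> R" "g \<noteq> 0" "b = subdegree g"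
    by (auto simp: val_semigroup_def)
  then have "f * g \<in> R - {0}" "a + b = subdegree (f * g)"
    using C_subalgebra_mult[OF assms(1)] by auto
  then show ?thesis unfolding val_semigroup_def by (metis image_eqI)
qed

lemma val_semigroup_0: "C_subalgebra R \<Longrightarrow> 0 \<in> val_semigroup R"
  by (auto simp: val_semigroup_def image_iff intro!: bexI[of _ 1] dest: C_subalgebra_one)

lemma val_semigroup_mult: "C_subalgebra R \<Longrightarrow> a \<in> val_semigroup R \<Longrightarrow> k * a \<in> val_semigroup R"
  by (induction k) (auto simp: val_semigroup_0 val_semigroup_add)

text \<open>The series z itself is a quotient a/b of elements of R, so a = z b has order one more
  than b.\<close>

lemma plane_branch_consecutive:
  assumes "plane_branch R x y"
  obtains a where "a \<in> val_semigroup R" "Suc a \<in> val_semigroup R"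
proof -
  have "\<exists>a\<in>R. \<exists>b\<in>R. b \<noteq> 0 \<and> fps_to_fls fps_X = fps_to_fls a / fps_to_fls b"
    using assms by (auto simp: plane_branch_def)
  then obtain a b where ab: "a \<in> R" "b \<in> R" "b \<noteq> 0" "fps_to_fls fps_X = fps_to_fls a / fps_to_fls b"
    by blast
  then have "fps_to_fls (fps_X * b) = fps_to_fls a"
    using ab(3) by (simp add: fls_times_fps_to_fls field_simps)
  then have "a = fps_X * b" by (simp only: fps_to_fls_eq_iff)
  with ab have "a \<noteq> 0" "subdegree a = Suc (subdegree b)" by auto
  with ab show thesis by (intro that[of "subdegree b"]) (force simp: val_semigroup_def)+
qed

text \<open>Two consecutive elements a and a + 1 generate everything from a^2 on: if n = q a + r
  with r < a \<le> q, then n = (q - r) a + r (a + 1).\<close>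

lemma plane_branch_val_semigroup_cofinite:
  assumes "plane_branch R x y"
  obtains N where "\<And>n. N \<le> n \<Longrightarrow> n \<in> val_semigroup R"
proof -
  obtain a where a: "a \<in> val_semigroup R" "Suc a \<in> val_semigroup R"
    using plane_branch_consecutive[OF assms] .
  note R = plane_branch_subalgebra(1)[OF assms]
  show thesis
  proof (cases "a = 0")
    case True
    then have "n \<in> val_semigroup R" for n
      using val_semigroup_mult[OF R a(2), of n] by simp
    then show thesis by (rule that)
  next
    case False
    have "n \<in> val_semigroup R" if n: "a * a \<le> n" for n
    proof -
      have "n mod a < a" using False by simp
      moreover have "a \<le> n div a" using n False by (simp add: less_eq_div_iff_mult_less_eq)
      ultimately have "n mod a \<le> n div a" by simp
      then have "(n div a - n mod a) * a + (n mod a) * Suc a = n div a * a + n mod a"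
        by (simp add: algebra_simps)
      also have "\<dots> = n" by simp
      finally show ?thesis
        using val_semigroup_add[OF R val_semigroup_mult[OF R a(1)] val_semigroup_mult[OF R a(2)]] by metis
    qed
    then show thesis by (rule that)
  qed
qed

text \<open>Elimination with elements of R of every order from c on approximates f to arbitrary
  order, and R is closed.\<close>

lemma plane_branch_zideal:
  assumes b: "plane_branch R x y" and c: "\<And>n. c \<le> n \<Longrightarrow> n \<in> val_semigroup R"
  shows "zideal c \<subseteq> R"
proof
  fix f assume f: "f \<in> zideal c"
  note sub = C_subalgebra_subspace[OF plane_branch_subalgebra(1)[OF b]]
  have *: "\<exists>g\<in>R. f - g \<in> zideal N" if "c \<le> N" for N
    using that
  proof (induction N rule: dec_induct)
    case base
    show ?case using f fps_subspaceD(1)[OF sub] by (intro bexI[of _ 0]) auto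
  next
    case (step N)
    then obtain g where g: "g \<in> R" "f - g \<in> zideal N" by blast
    from c[of N] step.hyps obtain h where h: "h \<in> R" "h \<in> zideal N" "fps_nth h N = 1"
      using val_semigroup_iff[OF sub] by auto
    let ?g = "g + fps_const (fps_nth (f - g) N) * h"
    have "?g \<in> R" using g h fps_subspaceD[OF sub] by blast
    moreover have "f - ?g \<in> zideal (Suc N)"
      using zideal_cancel_leading[OF g(2) h(2,3)] by (simp add: algebra_simps)
    ultimately show ?case by blast
  qed
  show "f \<in> R"
  proof (rule plane_branch_limit[OF b])
    fix N
    from *[of "max c N"] show "\<exists>g\<in>R. f - g \<in> zideal N"
      using zideal_mono[of N "max c N"] by auto
  qed
qed

section \<open>Polynomials in y over C[[x]] and their orders\<close>

primrec y_polys :: "complex fps \<Rightarrow> complex fps \<Rightarrow> nat \<Rightarrow> complex fps set" where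
  "y_polys x y 0 = {0}"
| "y_polys x y (Suc k) = {(a oo x) * y ^ k + g | a g. g \<in> y_polys x y k}"

text \<open>Both sets consist of values in C[[z]], not of formal polynomials, so one series may
  arise from several polynomials. The index is the degree here, but a strict bound on the degree in
  \<open>y_polys\<close>.\<close>

definition y_monics :: "complex fps \<Rightarrow> complex fps \<Rightarrow> nat \<Rightarrow> complex fps set" where
  "y_monics x y k = {y ^ k + g | g. g \<in> y_polys x y k}"

lemma y_polys_zero: "0 \<in> y_polys x y k"
proof (induction k)
  case (Suc k)
  have "0 = (0 oo x) * y ^ k + 0" by simp
  with Suc show ?case unfolding y_polys.simps by blast
qed simp

lemma y_polys_Suc_mono: "g \<in> y_polys x y k \<Longrightarrow> g \<in> y_polys x y (Suc k)"
proof -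
  assume "g \<in> y_polys x y k"
  moreover have "g = (0 oo x) * y ^ k + g" by simp
  ultimately show ?thesis unfolding y_polys.simps by blast
qed

lemma y_polys_mono: "j \<le> k \<Longrightarrow> g \<in> y_polys x y j \<Longrightarrow> g \<in> y_polys x y k"
  by (induction k rule: dec_induct) (blast intro: y_polys_Suc_mono)+

lemma y_polys_add:
  "f \<in> y_polys x y k \<Longrightarrow> g \<in> y_polys x y k \<Longrightarrow> f + g \<in> y_polys x y k"
proof (induction k arbitrary: f g)
  case (Suc k)
  then obtain a f' b g' where "f = (a oo x) * y ^ k + f'" "f' \<in> y_polys x y k"
    "g = (b oo x) * y ^ k + g'" "g' \<in> y_polys x y k" by auto
  moreover from this have "f + g = ((a + b) oo x) * y ^ k + (f' + g')"
    by (simp add: fps_compose_add_distrib algebra_simps)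
  ultimately show ?case using Suc.IH[of f' g'] unfolding y_polys.simps by blast
qed simp

lemma y_polys_scale:
  assumes "fps_nth x 0 = 0"
  shows "f \<in> y_polys x y k \<Longrightarrow> (a oo x) * f \<in> y_polys x y k"
proof (induction k arbitrary: f)
  case (Suc k)
  then obtain b f' where "f = (b oo x) * y ^ k + f'" "f' \<in> y_polys x y k" by auto
  moreover from this have "(a oo x) * f = ((a * b) oo x) * y ^ k + (a oo x) * f'"
    by (simp add: fps_compose_mult_distrib[OF assms] algebra_simps)
  ultimately show ?case using Suc.IH[of f'] unfolding y_polys.simps by blast
qed simp

lemma y_polys_mult_power: "g \<in> y_polys x y k \<Longrightarrow> y ^ j * g \<in> y_polys x y (j + k)"
proof (induction k arbitrary: g)
  case (Suc k)
  then obtain a g' where "g = (a oo x) * y ^ k + g'" "g' \<in> y_polys x y k" by auto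
  moreover from this have "y ^ j * g = (a oo x) * y ^ (j + k) + y ^ j * g'"
    by (simp add: power_add algebra_simps)
  ultimately show ?case using Suc.IH[of g'] by auto
qed (simp add: y_polys_zero)

lemma y_polys_mult:
  assumes x: "fps_nth x 0 = 0"
  shows "f \<in> y_polys x y j \<Longrightarrow> g \<in> y_polys x y k \<Longrightarrow> f * g \<in> y_polys x y (j + k)"
proof (induction j arbitrary: f)
  case (Suc j)
  then obtain a f' where f: "f = (a oo x) * y ^ j + f'" "f' \<in> y_polys x y j" by auto
  have "(a oo x) * (y ^ j * g) \<in> y_polys x y (j + k)"
    by (intro y_polys_scale[OF x] y_polys_mult_power Suc.prems)
  moreover have "f' * g \<in> y_polys x y (j + k)"
    using Suc f by blast
  ultimately have "(a oo x) * (y ^ j * g) + f' * g \<in> y_polys x y (j + k)"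
    by (rule y_polys_add)
  then have "f * g \<in> y_polys x y (j + k)"
    by (simp add: f algebra_simps)
  then show ?case using y_polys_Suc_mono by simp
qed (simp add: y_polys_zero)

lemma y_polys_power: "y ^ k \<in> y_polys x y (Suc k)"
proof -
  have "y ^ k = (1 oo x) * y ^ k + 0" by simp
  then show ?thesis using y_polys_zero unfolding y_polys.simps by blast
qed

lemma y_monics_subset: "f \<in> y_monics x y k \<Longrightarrow> f \<in> y_polys x y (Suc k)"
  unfolding y_monics_def using y_polys_add[OF y_polys_power y_polys_Suc_mono] by blast

lemma y_monics_add: "f \<in> y_monics x y k \<Longrightarrow> g \<in> y_polys x y k \<Longrightarrow> f + g \<in> y_monics x y k"
  unfolding y_monics_def using y_polys_add by (force simp: algebra_simps)

lemma y_monics_power: "y ^ k \<in> y_monics x y k"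
  unfolding y_monics_def using y_polys_zero by force

lemma y_monics_mult:
  assumes x: "fps_nth x 0 = 0" and f: "f \<in> y_monics x y j" and g: "g \<in> y_monics x y k"
  shows "f * g \<in> y_monics x y (j + k)"
proof -
  from f g obtain f' g' where f': "f = y ^ j + f'" "f' \<in> y_polys x y j"
    and g': "g = y ^ k + g'" "g' \<in> y_polys x y k"
    by (auto simp: y_monics_def)
  have "y ^ j * g' \<in> y_polys x y (j + k)" "y ^ k * f' \<in> y_polys x y (j + k)"
    "f' * g' \<in> y_polys x y (j + k)"
    using y_polys_mult_power[OF g'(2), of j] y_polys_mult_power[OF f'(2), of k] y_polys_mult[OF x f'(2) g'(2)]
    by (simp_all add: add.commute)
  then have "y ^ j * g' + y ^ k * f' + f' * g' \<in> y_polys x y (j + k)"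
    by (intro y_polys_add)
  then show ?thesis
    unfolding y_monics_def by (auto simp: f' g' power_add algebra_simps)
qed

text \<open>R is known only as the smallest closed subalgebra containing x and y. The series that
  can be approximated in this way form such a subalgebra, so they include R.\<close>

lemma plane_branch_approx_y_polys:
  assumes b: "plane_branch R x y" and f: "f \<in> R"
  shows "\<exists>k. \<exists>g\<in>y_polys x y k. f - g \<in> zideal N"
proof -
  let ?S = "{f. \<forall>N. \<exists>k. \<exists>g\<in>y_polys x y k. f - g \<in> zideal N}"
  have x: "fps_nth x 0 = 0" using b by (simp add: plane_branch_def)
  have base: "f \<in> ?S" if "f \<in> y_polys x y k" for f k
    using that by (auto intro!: exI[of _ k] bexI[of _ f])
  have "fps_const a \<in> ?S" for a
    by (rule base[of _ "Suc 0"]) (auto intro!: exI[of _ "fps_const a"])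
  moreover have "f + g \<in> ?S" "f * g \<in> ?S" if fg: "f \<in> ?S" "g \<in> ?S" for f g
  proof -
    have "\<exists>k. \<exists>h\<in>y_polys x y k. f + g - h \<in> zideal N" "\<exists>k. \<exists>h\<in>y_polys x y k. f * g - h \<in> zideal N" for N
    proof -
      obtain j f' k g' where f': "f' \<in> y_polys x y j" "f - f' \<in> zideal N"
        and g': "g' \<in> y_polys x y k" "g - g' \<in> zideal N" using fg by blast
      have "f' + g' \<in> y_polys x y (max j k)"
        by (intro y_polys_add y_polys_mono[OF _ f'(1)] y_polys_mono[OF _ g'(1)]) simp_all
      moreover have "f + g - (f' + g') \<in> zideal N"
        using zideal_add[OF f'(2) g'(2)] by (simp add: algebra_simps)
      ultimately show "\<exists>k. \<exists>h\<in>y_polys x y k. f + g - h \<in> zideal N" by blast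
      have "(f - f') * g + f' * (g - g') \<in> zideal N"
        using f' g' by (intro zideal_add zideal_mult_right zideal_mult_left)
      then have "f * g - f' * g' \<in> zideal N" by (simp add: algebra_simps)
      then show "\<exists>k. \<exists>h\<in>y_polys x y k. f * g - h \<in> zideal N"
        using y_polys_mult[OF x f'(1) g'(1)] by blast
    qed
    then show "f + g \<in> ?S" "f * g \<in> ?S" by blast+
  qed
  ultimately have "C_subalgebra ?S"
    by (auto simp: C_subalgebra_def)
  moreover have "closed ?S"
    unfolding closed_fps_iff
  proof (intro allI impI)
    fix f assume *: "\<forall>N. \<exists>g\<in>?S. f - g \<in> zideal N"
    have "\<exists>k. \<exists>h\<in>y_polys x y k. f - h \<in> zideal N" for N
    proof -
      from * obtain g where g: "g \<in> ?S" "f - g \<in> zideal N" by blast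
      then obtain k h where "h \<in> y_polys x y k" "g - h \<in> zideal N" by blast
      with zideal_diff_trans[OF g(2)] show ?thesis by blast
    qed
    then show "f \<in> ?S" by blast
  qed
  moreover have "x \<in> ?S"
    by (rule base[of _ "Suc 0"]) (auto intro!: exI[of _ "fps_X"] simp: x)
  moreover have "y \<in> ?S"
    using base[OF y_polys_power[of y 1 x]] by simp
  ultimately have "R \<subseteq> ?S"
    by (rule plane_branch_minimal[OF b])
  with f show ?thesis by blast
qed

text \<open>The least excluded order is one more than the order of the required f. The premise fails
  as soon as some monic polynomial of degree k vanishes at y, because 0 lies in every
  \<open>zideal N\<close>.\<close>

lemma ex_maximal_monic:
  assumes "\<exists>N. \<forall>g\<in>y_monics x y k. g \<notin> zideal N"
  obtains f where "f \<in> y_monics x y k" "f \<noteq> 0" "\<And>g. g \<in> y_monics x y k \<Longrightarrow> g \<notin> zideal (Suc (subdegree f))"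
proof -
  define N where "N = (LEAST N. \<forall>g\<in>y_monics x y k. g \<notin> zideal N)"
  have N: "\<forall>g\<in>y_monics x y k. g \<notin> zideal N"
    unfolding N_def using assms by (rule LeastI_ex)
  have "N \<noteq> 0"
    using N y_monics_power[of y k x] by (metis zideal_0)
  then obtain M where M: "N = Suc M" by (cases N) auto
  then have "\<not> (\<forall>g\<in>y_monics x y k. g \<notin> zideal M)"
    unfolding N_def by (intro not_less_Least) simp
  then obtain f where f: "f \<in> y_monics x y k" "f \<in> zideal M" by blast
  then have "f \<notin> zideal (Suc M)" using N M by auto
  with f(2) have "f \<noteq> 0" "subdegree f = M"
    by (auto simp: zideal_iff_subdegree)
  with f N M show thesis by (intro that[of f]) auto
qed

text \<open>The length m of the family is left open. A family of length n + 1 is refuted by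
  \<open>m_le_n\<close>, and this is how a degree with monics of unbounded order is found; m = n is
  only reached in \<open>m_eq_n\<close>.\<close>

locale maximal_monics =
  fixes x y :: "complex fps" and m :: nat and f :: "nat \<Rightarrow> complex fps"
  assumes x_0: "fps_nth x 0 = 0" and x_nonzero: "x \<noteq> 0"
    and f_monic: "k < m \<Longrightarrow> f k \<in> y_monics x y k"
    and f_nonzero: "k < m \<Longrightarrow> f k \<noteq> 0"
    and f_maximal: "k < m \<Longrightarrow> g \<in> y_monics x y k \<Longrightarrow> g \<notin> zideal (Suc (subdegree (f k)))"
begin

abbreviation "n \<equiv> subdegree x"
abbreviation "v k \<equiv> subdegree (f k)"

lemma n_pos: "0 < n"
  using x_0 x_nonzero by (metis gr0I nth_subdegree_nonzero)

lemma v_add_le: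
  assumes "j + k < m"
  shows "v j + v k \<le> v (j + k)"
proof (rule ccontr)
  assume "\<not> v j + v k \<le> v (j + k)"
  then have "f j * f k \<in> zideal (Suc (v (j + k)))"
    using assms f_nonzero by (auto simp: zideal_iff_subdegree)
  moreover have "f j * f k \<in> y_monics x y (j + k)"
    using assms by (intro y_monics_mult x_0 f_monic) auto
  ultimately show False using f_maximal[OF assms] by blast
qed

lemma v_mono: "j \<le> k \<Longrightarrow> k < m \<Longrightarrow> v j \<le> v k"
  using v_add_le[of j "k - j"] by simp

text \<open>If the residues agreed, then x^e times the monic of degree j would have the same order
  as the monic of degree k, for a suitable e. Subtracting a multiple of it keeps the latter monic of
  degree k and raises its order, against maximality.\<close>

lemma v_mod_neq:
  assumes "j < k" "k < m"
  shows "v j mod n \<noteq> v k mod n"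
proof
  assume mod: "v j mod n = v k mod n"
  from v_mono[of j k] assms mod_eq_nat1E[OF mod[symmetric]] obtain e where e: "v k = v j + e * n"
    by (metis less_imp_le mult.commute)
  let ?h = "x ^ e * f j"
  define c where "c = fps_nth (f k) (v k) / fps_nth ?h (v k)"
  have h: "subdegree ?h = v k" "?h \<noteq> 0"
    using e assms f_nonzero[of j] x_nonzero by simp_all
  have h_nth: "fps_nth ?h (v k) \<noteq> 0"
    using h by (metis nth_subdegree_nonzero)
  have "(fps_const (- c) * fps_X ^ e oo x) * f j \<in> y_polys x y (Suc j)"
    using assms by (intro y_polys_scale x_0 y_monics_subset f_monic) simp
  moreover have "fps_const (- c) * fps_X ^ e oo x = fps_const (- c) * x ^ e"
    using fps_compose_power[OF x_0, of fps_X e] x_0 by (simp add: fps_compose_mult_distrib)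
  ultimately have "fps_const (- c) * ?h \<in> y_polys x y k"
    using assms y_polys_mono[of "Suc j" k] by (simp add: mult.assoc)
  then have "f k + fps_const (- c) * ?h \<in> y_monics x y k"
    using assms by (intro y_monics_add f_monic)
  moreover have "f k + fps_const (- c) * ?h \<in> zideal (Suc (v k))"
    unfolding zideal_Suc_iff
  proof
    show "fps_nth (f k + fps_const (- c) * ?h) (v k) = 0"
      using h_nth by (simp add: c_def del: fps_const_neg)
    show "f k + fps_const (- c) * ?h \<in> zideal (v k)"
    proof (intro zideal_add zideal_mult_left[of ?h])
      show "f k \<in> zideal (v k)" by (simp only: zideal_iff_subdegree le_refl simp_thms)
      show "?h \<in> zideal (v k)" using h(1) by (simp only: zideal_iff_subdegree le_refl simp_thms)
    qed
  qed
  ultimately show False using f_maximal assms by blast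
qed

lemma v_mod_inj: "inj_on (\<lambda>k. v k mod n) {..<m}"
proof (rule inj_onI)
  fix j k assume "j \<in> {..<m}" "k \<in> {..<m}" "v j mod n = v k mod n"
  then show "j = k"
    using v_mod_neq[of j k] v_mod_neq[of k j] by (cases j k rule: linorder_cases) auto
qed

lemma m_le_n: "m \<le> n"
proof -
  have "card ((\<lambda>k. v k mod n) ` {..<m}) \<le> card {..<n}"
    by (rule card_mono) (use n_pos in auto)
  then show ?thesis by (simp add: card_image[OF v_mod_inj])
qed

text \<open>Expand g in the \<open>f i\<close> with coefficients in C[[x]]. The orders of the
  nonzero terms lie in distinct classes modulo n, so their leading terms cannot cancel and the order
  of g is that of one of the terms.\<close>

lemma subdegree_y_polys:
  assumes "k \<le> m" "g \<in> y_polys x y k" "g \<noteq> 0"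
  shows "\<exists>i<k. \<exists>t. subdegree g = v i + t * n"
  using assms
proof (induction k arbitrary: g)
  case (Suc k)
  then obtain a g' where g: "g = (a oo x) * y ^ k + g'" "g' \<in> y_polys x y k" by auto
  obtain u where u: "f k = y ^ k + u" "u \<in> y_polys x y k"
    using f_monic[of k] Suc.prems(1) by (auto simp: y_monics_def)
  \<comment> \<open>Replacing y^k by \<open>f k\<close> in the top term changes the part of lower
    degree by a multiple of u; h is the corrected lower part.\<close>
  define h where "h = g' + (- a oo x) * u"
  have h: "h \<in> y_polys x y k"
    unfolding h_def by (intro y_polys_add g y_polys_scale x_0 u)
  have gh: "g = (a oo x) * f k + h"
    by (simp add: g u h_def fps_compose_uminus algebra_simps)
  show ?case
  proof (cases "a = 0")
    case True
    with gh Suc.prems have "h \<noteq> 0" by simp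
    from Suc.IH[OF _ h this] Suc.prems obtain i t where "i < k" "subdegree h = v i + t * n" by auto
    with gh True show ?thesis by (intro exI[of _ i] conjI exI[of _ t]; simp)
  next
    case False
    have af: "subdegree ((a oo x) * f k) = v k + subdegree a * n" "(a oo x) * f k \<noteq> 0"
      using False f_nonzero[of k] Suc.prems x_nonzero x_0
      by (simp_all add: fps_compose_eq_0_iff subdegree_fps_compose[OF x_0])
    show ?thesis
    proof (cases "h = 0")
      case True
      with gh af show ?thesis by auto
    next
      case False
      from Suc.IH[OF _ h this] Suc.prems obtain i t where i: "i < k" "subdegree h = v i + t * n" by auto
      with af v_mod_neq[of i k] Suc.prems have "subdegree h \<noteq> subdegree ((a oo x) * f k)"
        by (metis Suc_le_eq mod_mult_self1)
      then consider "subdegree g = subdegree h" | "subdegree g = subdegree ((a oo x) * f k)"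
        unfolding gh using subdegree_add_eq1[OF af(2), of h] subdegree_add_eq2[OF False, of "(a oo x) * f k"]
        by linarith
      then show ?thesis
        by cases (use i af in \<open>metis less_SucI lessI\<close>)+
    qed
  qed
qed simp

end

text \<open>Here m is the first degree at which monics reach arbitrarily high order. Such monics act
  as approximate equations for y over C[[x]].\<close>

locale plane_branch_values = maximal_monics +
  fixes R :: "complex fps set"
  assumes branch: "plane_branch R x y"
    and unbounded: "\<And>N. \<exists>h\<in>y_monics x y m. h \<in> zideal N"
begin

lemmas R_subalgebra = plane_branch_subalgebra(1)[OF branch]

lemma x_in_R: "a oo x \<in> R"
proof (rule plane_branch_limit[OF branch])
  fix N
  let ?g = "\<Sum>i<N. fps_const (fps_nth a i) * x ^ i"
  have "?g \<in> R"
    by (intro fps_subspace_sum fps_subspaceD(3) C_subalgebra_subspace C_subalgebra_power R_subalgebra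
        plane_branch_subalgebra[OF branch])
  moreover have "(a oo x) - ?g \<in> zideal N"
    unfolding zideal_def mem_Collect_eq
  proof (intro allI impI)
    fix k assume "k < N"
    have "fps_nth (a oo x) k = (\<Sum>i=0..k. fps_nth a i * fps_nth (x ^ i) k)"
      by (simp add: fps_compose_nth)
    also have "\<dots> = (\<Sum>i<N. fps_nth a i * fps_nth (x ^ i) k)"
      by (rule sum.mono_neutral_left)
        (use \<open>k < N\<close> zideal_power[OF x_0] in \<open>auto simp: zideal_def\<close>)
    finally have "fps_nth (a oo x) k = fps_nth ?g k"
      by (simp only: fps_sum_nth fps_mult_left_const_nth)
    then show "fps_nth ((a oo x) - ?g) k = 0" by (simp only: fps_sub_nth diff_self)
  qed
  ultimately show "\<exists>g\<in>R. (a oo x) - g \<in> zideal N" by blast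
qed

lemma y_polys_subset: "y_polys x y k \<subseteq> R"
proof (induction k)
  case 0
  then show ?case using fps_subspaceD(1)[OF C_subalgebra_subspace[OF R_subalgebra]] by simp
next
  case (Suc k)
  show ?case
  proof
    fix f assume "f \<in> y_polys x y (Suc k)"
    then obtain a g where g: "f = (a oo x) * y ^ k + g" "g \<in> y_polys x y k" by auto
    show "f \<in> R"
      unfolding g(1)
      by (intro fps_subspaceD(2) C_subalgebra_subspace C_subalgebra_mult C_subalgebra_power
          R_subalgebra x_in_R plane_branch_subalgebra(4)[OF branch] subsetD[OF Suc g(2)])
  qed
qed

text \<open>A monic of degree m and order at least N expresses y^m modulo z^N by lower powers of y,
  so any degree from m on can be lowered. The equation used depends on N, hence the conclusion is
  only an approximation.\<close>

lemma y_polys_reduce: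
  assumes "g \<in> y_polys x y k"
  shows "\<exists>h\<in>y_polys x y m. g - h \<in> zideal N"
  using assms
proof (induction k arbitrary: g)
  case 0
  then show ?case by (intro bexI[of _ 0]) (auto simp: y_polys_zero)
next
  case (Suc k)
  show ?case
  proof (cases "Suc k \<le> m")
    case True
    then show ?thesis using y_polys_mono[OF True Suc.prems] by (intro bexI[of _ g]) auto
  next
    case False
    then have km: "k - m + m = k" by simp
    obtain a g' where g: "g = (a oo x) * y ^ k + g'" "g' \<in> y_polys x y k" using Suc.prems by auto
    obtain u where u: "y ^ m + u \<in> zideal N" "u \<in> y_polys x y m"
      using unbounded[of N] by (auto simp: y_monics_def)
    have "y ^ (k - m) * u \<in> y_polys x y k"
      using y_polys_mult_power[OF u(2), of "k - m"] km by simp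
    then have "g' + (- a oo x) * (y ^ (k - m) * u) \<in> y_polys x y k"
      by (intro y_polys_add g y_polys_scale x_0)
    from Suc.IH[OF this] obtain h where h: "h \<in> y_polys x y m"
      "g' + (- a oo x) * (y ^ (k - m) * u) - h \<in> zideal N" by blast
    have "g - (g' + (- a oo x) * (y ^ (k - m) * u)) = (a oo x) * (y ^ (k - m) * y ^ m + y ^ (k - m) * u)"
      unfolding power_add[symmetric] km g by (simp add: fps_compose_uminus algebra_simps)
    also have "\<dots> = (a oo x) * (y ^ (k - m) * (y ^ m + u))" by (simp add: algebra_simps)
    also have "\<dots> \<in> zideal N" by (intro zideal_mult_left u)
    finally show ?thesis using h zideal_diff_trans by blast
  qed
qed

lemma val_semigroup_eq: "val_semigroup R = {v i + t * n | i t. i < m}"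
proof (intro equalityI subsetI)
  fix s assume "s \<in> val_semigroup R"
  then obtain f where f: "f \<in> R" "f \<noteq> 0" "s = subdegree f" by (auto simp: val_semigroup_def)
  \<comment> \<open>Precision \<open>Suc s\<close> is chosen so that the coefficient at s, and with
    it the order s, survives the approximation.\<close>
  obtain k g where g: "g \<in> y_polys x y k" "f - g \<in> zideal (Suc s)"
    using plane_branch_approx_y_polys[OF branch f(1)] by blast
  obtain h where h: "h \<in> y_polys x y m" "g - h \<in> zideal (Suc s)"
    using y_polys_reduce[OF g(1)] by blast
  have "f - h \<in> zideal (Suc s)" using zideal_diff_trans[OF g(2) h(2)] .
  then have nth: "fps_nth f k = fps_nth h k" if "k \<le> s" for k using that by (simp add: zideal_def)
  have "subdegree h = s"
  proof (rule subdegreeI)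
    show "fps_nth h s \<noteq> 0" using nth[of s] f by auto
    show "fps_nth h i = 0" if "i < s" for i using nth[of i] that f(3) by auto
  qed
  moreover have "h \<noteq> 0" using nth[of s] f by auto
  ultimately show "s \<in> {v i + t * n | i t. i < m}"
    using subdegree_y_polys[OF le_refl h(1)] by auto
next
  fix s assume "s \<in> {v i + t * n | i t. i < m}"
  then obtain i t where i: "s = v i + t * n" "i < m" by auto
  have "v i \<in> val_semigroup R" "n \<in> val_semigroup R"
    using subsetD[OF y_polys_subset y_monics_subset[OF f_monic[OF i(2)]]] f_nonzero[OF i(2)]
      plane_branch_subalgebra(3)[OF branch] x_nonzero
    unfolding val_semigroup_def by blast+
  then show "s \<in> val_semigroup R"
    unfolding i by (intro val_semigroup_add val_semigroup_mult R_subalgebra)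
qed

text \<open>The semigroup contains all large numbers, and these occur in every residue
  class.\<close>

lemma v_mod_image: "(\<lambda>i. v i mod n) ` {..<m} = {..<n}"
proof (intro equalityI subsetI)
  fix r assume r: "r \<in> {..<n}"
  obtain N where N: "\<And>k. N \<le> k \<Longrightarrow> k \<in> val_semigroup R"
    using plane_branch_val_semigroup_cofinite[OF branch] by blast
  have "N \<le> r + N * n" using n_pos by (simp add: trans_le_add2)
  from N[OF this] obtain i t where "i < m" "r + N * n = v i + t * n"
    by (auto simp: val_semigroup_eq)
  then have "(r + N * n) mod n = (v i + t * n) mod n" by simp
  with r \<open>i < m\<close> show "r \<in> (\<lambda>i. v i mod n) ` {..<m}" by auto
qed (use n_pos in auto)

lemma m_eq_n: "m = n"
  using arg_cong[OF v_mod_image, of card] by (simp add: card_image[OF v_mod_inj])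

text \<open>The \<open>v i\<close> are the Apery set of the semigroup with respect to n, the least
  elements of the residue classes.\<close>

lemma mem_val_semigroup_iff:
  assumes "i < n" "s mod n = v i mod n"
  shows "s \<in> val_semigroup R \<longleftrightarrow> v i \<le> s"
proof
  assume "s \<in> val_semigroup R"
  then obtain j t where j: "j < m" "s = v j + t * n" by (auto simp: val_semigroup_eq)
  with assms have "v j mod n = v i mod n" by simp
  with inj_onD[OF v_mod_inj this] j assms m_eq_n have "j = i" by simp
  with j show "v i \<le> s" by simp
next
  assume "v i \<le> s"
  with mod_eq_nat1E[OF assms(2)] obtain t where "s = v i + t * n"
    by (metis mult.commute)
  with assms(1) m_eq_n show "s \<in> val_semigroup R" by (auto simp: val_semigroup_eq)
qed

lemma ex_residue: "\<exists>i<n. s mod n = v i mod n"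
proof -
  have "s mod n \<in> (\<lambda>i. v i mod n) ` {..<m}"
    unfolding v_mod_image using n_pos by simp
  with m_eq_n show ?thesis by auto
qed

text \<open>Selmer's formula: the gaps in the class of \<open>v i\<close> are the numbers of that
  class below \<open>v i\<close>, and there are \<open>v i div n\<close> of them.\<close>

lemma card_gaps: "card (- val_semigroup R) = (\<Sum>i<n. v i div n)"
proof -
  let ?A = "\<lambda>i. {s. s mod n = v i mod n \<and> s < v i}"
  have gaps: "- val_semigroup R = (\<Union>i<n. ?A i)"
  proof (intro equalityI subsetI)
    fix s assume s: "s \<in> - val_semigroup R"
    obtain i where "i < n" "s mod n = v i mod n" using ex_residue by blast
    with s mem_val_semigroup_iff[OF this] show "s \<in> (\<Union>i<n. ?A i)" by auto
  next
    fix s assume "s \<in> (\<Union>i<n. ?A i)"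
    then obtain i where "i < n" "s mod n = v i mod n" "s < v i" by auto
    with mem_val_semigroup_iff[OF this(1,2)] show "s \<in> - val_semigroup R" by simp
  qed
  have A: "?A i = (\<lambda>t. v i mod n + t * n) ` {..<v i div n}" for i
  proof (intro equalityI subsetI)
    fix s assume "s \<in> ?A i"
    then have s: "s mod n = v i mod n" "s < v i" by auto
    have "s = v i mod n + s div n * n" using s(1) by (metis mod_div_mult_eq)
    moreover have "s div n < v i div n"
    proof (rule ccontr)
      assume "\<not> s div n < v i div n"
      then have "v i div n * n \<le> s div n * n" by simp
      with s show False by (metis add_le_mono1 add.commute div_mult_mod_eq not_le)
    qed
    ultimately show "s \<in> (\<lambda>t. v i mod n + t * n) ` {..<v i div n}" by auto
  next
    fix s assume "s \<in> (\<lambda>t. v i mod n + t * n) ` {..<v i div n}"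
    then obtain t where t: "t < v i div n" "s = v i mod n + t * n" by auto
    then have "t * n < v i div n * n" using n_pos by simp
    then have "s < v i" unfolding t(2) by (metis add_less_cancel_left mod_div_mult_eq)
    with t show "s \<in> ?A i" by simp
  qed
  have "card (- val_semigroup R) = (\<Sum>i<n. card (?A i))"
    unfolding gaps
  proof (rule card_UN_disjoint)
    show "\<forall>i\<in>{..<n}. \<forall>j\<in>{..<n}. i \<noteq> j \<longrightarrow> ?A i \<inter> ?A j = {}"
    proof (intro ballI impI)
      fix i j assume ij: "i \<in> {..<n}" "j \<in> {..<n}" "i \<noteq> j"
      then have "v i mod n \<noteq> v j mod n"
        using inj_onD[OF v_mod_inj, of i j] m_eq_n by blast
      then show "?A i \<inter> ?A j = {}" by fastforce
    qed
    show "\<forall>i\<in>{..<n}. finite (?A i)" unfolding A by simp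
  qed simp
  also have "\<dots> = (\<Sum>i<n. v i div n)"
  proof (rule sum.cong[OF refl])
    fix i
    have "inj_on (\<lambda>t. v i mod n + t * n) {..<v i div n}" using n_pos by (simp add: inj_on_def)
    from card_image[OF this] show "card (?A i) = v i div n" unfolding A by simp
  qed
  finally show ?thesis .
qed

text \<open>In each class the largest gap, if there is one, is \<open>v i - n\<close>. Since v
  increases, the largest gap of all is \<open>v (n - 1) - n\<close>, and the conductor is one
  more.\<close>

definition c where "c = v (n - 1) - (n - 1)"

text \<open>v is monotone and takes distinct values, so it is strictly increasing. This makes the
  subtraction of natural numbers in \<open>c\<close> exact.\<close>

lemma v_bound: "n - 1 \<le> v (n - 1)"
proof -
  have "k \<le> v k" if "k < n" for k
    using that
  proof (induction k)
    case (Suc k)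
    then have "v k \<le> v (Suc k)" "v k \<noteq> v (Suc k)"
      using v_mono[of k "Suc k"] v_mod_neq[of k "Suc k"] m_eq_n by auto
    with Suc show ?case by simp
  qed simp
  then show ?thesis using n_pos by simp
qed

text \<open>Pairing i with n - 1 - i bounds twice the sum of the \<open>v i\<close> by
  \<open>n * v (n - 1)\<close>. The residues of the \<open>v i\<close> are a permutation of 0, ...,
  n - 1, so twice their sum is n (n - 1). Subtracting it leaves n times twice the number of gaps,
  and a factor n cancels.\<close>

lemma two_card_gaps_le: "2 * card (- val_semigroup R) \<le> c"
proof -
  have "2 * (\<Sum>i<n. v i) = (\<Sum>i<n. v i) + (\<Sum>i<n. v (n - Suc i))"
    by (subst sum.nat_diff_reindex) simp
  also have "\<dots> = (\<Sum>i<n. v i + v (n - Suc i))"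
    by (simp add: sum.distrib)
  also have "\<dots> \<le> (\<Sum>i<n. v (n - 1))"
  proof (rule sum_mono)
    fix i assume "i \<in> {..<n}"
    then have "i + (n - Suc i) = n - 1" by auto
    moreover have "n - 1 < m" using m_eq_n n_pos by simp
    ultimately show "v i + v (n - Suc i) \<le> v (n - 1)"
      using v_add_le[of i "n - Suc i"] by simp
  qed
  finally have *: "2 * (\<Sum>i<n. v i) \<le> n * v (n - 1)" by simp
  have "(\<Sum>i<n. v i mod n) = (\<Sum>r<n. r)"
    using sum.reindex_bij_betw[of "\<lambda>i. v i mod n" "{..<n}" "{..<n}" "\<lambda>r. r"]
      v_mod_inj v_mod_image m_eq_n by (simp add: bij_betw_def)
  then have res: "2 * (\<Sum>i<n. v i mod n) = n * (n - 1)"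
    using gauss_sum_nat[of "n - 1"] n_pos
    by (simp add: lessThan_Suc_atMost[symmetric] atLeast0AtMost)
  have "(\<Sum>i<n. v i) = n * (\<Sum>i<n. v i div n) + (\<Sum>i<n. v i mod n)"
    by (simp add: sum_distrib_left flip: sum.distrib)
  with * res have "n * (2 * card (- val_semigroup R)) + n * (n - 1) \<le> n * v (n - 1)"
    unfolding card_gaps by (simp add: algebra_simps)
  then have "n * (2 * card (- val_semigroup R) + (n - 1)) \<le> n * v (n - 1)"
    by (simp only: add_mult_distrib2)
  then have "2 * card (- val_semigroup R) + (n - 1) \<le> v (n - 1)"
    using n_pos by simp
  then show ?thesis by (simp add: c_def)
qed

text \<open>A gap s in the class of \<open>v i\<close> lies below \<open>v i\<close>, so
  \<open>v i - s\<close> is a positive multiple of n. For s at or above c this contradicts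
  \<open>v i\<close> \<le> \<open>v (n - 1)\<close> < s + n.\<close>

lemma conductor: "c \<le> s \<Longrightarrow> s \<in> val_semigroup R"
proof -
  assume s: "c \<le> s"
  obtain i where i: "i < n" "s mod n = v i mod n" using ex_residue by blast
  show ?thesis
  proof (rule ccontr)
    assume "s \<notin> val_semigroup R"
    with mem_val_semigroup_iff[OF i] have "s < v i" by simp
    moreover have "v i \<le> v (n - 1)" using i m_eq_n by (intro v_mono) auto
    ultimately have "s < v i" "v i < s + n" using s v_bound i by (auto simp: c_def)
    from mod_eq_nat1E[OF i(2)[symmetric]] \<open>s < v i\<close> obtain q where q: "v i = s + n * q" by auto
    with \<open>s < v i\<close> have "n * 1 \<le> n * q" by (intro mult_le_mono) (cases q; auto)+
    with q \<open>v i < s + n\<close> show False by simp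
  qed
qed

text \<open>\<open>c - 1\<close> equals \<open>v (n - 1) - n\<close>, so it belongs to the class of
  \<open>v (n - 1)\<close> and lies below it.\<close>

lemma pred_conductor_gap: "0 < c \<Longrightarrow> c - 1 \<notin> val_semigroup R"
proof -
  assume "0 < c"
  then have c: "c - 1 + n = v (n - 1)" using v_bound n_pos by (simp add: c_def)
  then have "(c - 1) mod n = v (n - 1) mod n" by (metis mod_add_self2)
  from mem_val_semigroup_iff[OF _ this] n_pos c show ?thesis by simp
qed

lemma conductor_bounds:
  "\<exists>c. 2 * card (- val_semigroup R) \<le> c \<and> (\<forall>s\<ge>c. s \<in> val_semigroup R) \<and>
    (0 < c \<longrightarrow> c - 1 \<notin> val_semigroup R)"
  by (intro exI[of _ c] conjI two_card_gaps_le allI impI conductor pred_conductor_gap)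

end

text \<open>If the orders were bounded in every degree up to the order n of x, maximal monics in the
  n + 1 degrees 0, ..., n would have distinct orders modulo n. So some degree has monics of
  unbounded order, and m is the least such degree.\<close>

lemma ex_plane_branch_values:
  assumes b: "plane_branch R x y" and x: "x \<noteq> 0"
  shows "\<exists>m f. plane_branch_values x y m f R"
proof -
  have x_0: "fps_nth x 0 = 0" using b by (simp add: plane_branch_def)
  let ?bounded = "\<lambda>k. \<exists>N. \<forall>g\<in>y_monics x y k. g \<notin> zideal N"
  have family: "\<exists>f. maximal_monics x y m f" if "\<forall>k<m. ?bounded k" for m
  proof -
    have "\<forall>k. \<exists>f. k < m \<longrightarrow> f \<in> y_monics x y k \<and> f \<noteq> 0 \<and> (\<forall>g\<in>y_monics x y k. g \<notin> zideal (Suc (subdegree f)))"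
      using that ex_maximal_monic by metis
    then obtain f where "\<forall>k. k < m \<longrightarrow> f k \<in> y_monics x y k \<and> f k \<noteq> 0 \<and> (\<forall>g\<in>y_monics x y k. g \<notin> zideal (Suc (subdegree (f k))))"
      by metis
    then show ?thesis using x x_0 by (intro exI[of _ f]) (auto simp: maximal_monics_def)
  qed
  have ex: "\<exists>k. \<not> ?bounded k"
  proof (rule ccontr)
    assume "\<not> ?thesis"
    then obtain f where "maximal_monics x y (Suc (subdegree x)) f" using family by blast
    from maximal_monics.m_le_n[OF this] show False by simp
  qed
  define m where "m = (LEAST k. \<not> ?bounded k)"
  have "\<not> ?bounded m" unfolding m_def using ex by (rule LeastI_ex)
  moreover have "\<forall>k<m. ?bounded k" unfolding m_def using not_less_Least by blast
  ultimately show ?thesis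
    using family[of m] b unfolding plane_branch_values_def plane_branch_values_axioms_def by blast
qed

text \<open>If both generators vanish, the constants are a closed subalgebra containing them, and R
  has no element of positive order.\<close>

lemma plane_branch_nonzero:
  assumes b: "plane_branch R x y"
  shows "x \<noteq> 0 \<or> y \<noteq> 0"
proof (rule ccontr)
  assume "\<not> ?thesis"
  then have xy: "x = 0" "y = 0" by auto
  let ?S = "range fps_const :: complex fps set"
  have "closed ?S"
    unfolding closed_fps_iff
  proof (intro allI impI)
    fix f :: "complex fps" assume *: "\<forall>N. \<exists>g\<in>?S. f - g \<in> zideal N"
    have "fps_nth f k = fps_nth (fps_const (fps_nth f 0)) k" for k
    proof -
      from * obtain a where "f - fps_const a \<in> zideal (Suc k)" by blast
      then show ?thesis by (cases k) (simp_all add: zideal_def)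
    qed
    then have "f = fps_const (fps_nth f 0)" by (rule fps_ext)
    then show "f \<in> ?S" by blast
  qed
  moreover have "C_subalgebra ?S" by (auto simp: C_subalgebra_def)
  moreover have "0 \<in> ?S" by (rule range_eqI[of _ _ 0]) simp
  ultimately have R: "R \<subseteq> ?S" using plane_branch_minimal[OF b] xy by blast
  obtain a where "Suc a \<in> val_semigroup R" using plane_branch_consecutive[OF b] .
  with R show False by (auto simp: val_semigroup_def)
qed

lemma plane_branch_conductor_bounds:
  assumes "plane_branch R x y"
  shows "\<exists>c. 2 * card (- val_semigroup R) \<le> c \<and> (\<forall>s\<ge>c. s \<in> val_semigroup R) \<and>
    (0 < c \<longrightarrow> c - 1 \<notin> val_semigroup R)"
proof -
  have bounds: ?thesis if branch: "plane_branch R x y" and "x \<noteq> 0" for x y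
  proof -
    have "\<exists>m f. plane_branch_values x y m f R" by (rule ex_plane_branch_values[OF that])
    then show ?thesis by (elim exE) (rule plane_branch_values.conductor_bounds)
  qed
  from plane_branch_nonzero[OF assms] show ?thesis
    using bounds[OF assms] bounds[OF plane_branch_swap[OF assms]] by (rule disjE)
qed

text \<open>The involution sending s to c - 1 - s maps the non-gaps below the conductor c to gaps, so the
  opposite inequality c \<open>\<le>\<close> 2\<open>\<delta>\<close> holds for every numerical semigroup.\<close>

theorem plane_branch_symmetric:
  assumes b: "plane_branch R x y"
  shows "zideal (2 * delta R) \<subseteq> R"
    and "k < 2 * delta R \<Longrightarrow> k \<in> val_semigroup R \<longleftrightarrow> 2 * delta R - 1 - k \<notin> val_semigroup R"
    and "delta R = card (- val_semigroup R)"
proof -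
  from plane_branch_conductor_bounds[OF b] obtain c where
    "2 * card (- val_semigroup R) \<le> c \<and> (\<forall>s\<ge>c. s \<in> val_semigroup R) \<and>
      (0 < c \<longrightarrow> c - 1 \<notin> val_semigroup R)" by (rule exE)
  then have c: "2 * card (- val_semigroup R) \<le> c" "\<And>s. c \<le> s \<Longrightarrow> s \<in> val_semigroup R"
    "0 < c \<Longrightarrow> c - 1 \<notin> val_semigroup R" by simp_all
  note R = plane_branch_subalgebra(1)[OF b]
  have z: "zideal c \<subseteq> R" using plane_branch_zideal[OF b c(2)] .
  show \<delta>: "delta R = card (- val_semigroup R)"
    by (rule delta_eq_card_gaps[OF C_subalgebra_subspace[OF R] z])
  let ?S = "val_semigroup R \<inter> {..<c}"
  have fin: "finite (- val_semigroup R)" by (rule finite_gaps[OF z])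
  have gaps: "- val_semigroup R \<subseteq> {..<c}" using c(2) by (auto simp: not_le[symmetric])
  have inj: "inj_on (\<lambda>k. c - 1 - k) ?S" by (auto simp: inj_on_def)
  have sub: "(\<lambda>k. c - 1 - k) ` ?S \<subseteq> - val_semigroup R"
  proof
    fix s assume "s \<in> (\<lambda>k. c - 1 - k) ` ?S"
    then obtain k where k: "k \<in> val_semigroup R" "k < c" "s = c - 1 - k" by auto
    then have "s + k = c - 1" by simp
    with c(3) k val_semigroup_add[OF R _ k(1), of s] show "s \<in> - val_semigroup R" by auto
  qed
  have "{..<c} = ?S \<union> - val_semigroup R" using gaps by auto
  then have "c = card (?S \<union> - val_semigroup R)" using card_lessThan[of c] by simp
  also have "\<dots> = card ?S + card (- val_semigroup R)"
    using fin by (intro card_Un_disjoint) auto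
  finally have card: "c = card ?S + card (- val_semigroup R)" .
  have "card ?S \<le> card (- val_semigroup R)"
    using card_mono[OF fin sub] unfolding card_image[OF inj] .
  with card c(1) have eq: "card ?S = card (- val_semigroup R)" "c = 2 * delta R"
    by (simp_all add: \<delta>)
  have img: "(\<lambda>k. c - 1 - k) ` ?S = - val_semigroup R"
    using card_subset_eq[OF fin sub] eq(1) unfolding card_image[OF inj] by blast
  show "zideal (2 * delta R) \<subseteq> R" using z eq by simp
  show "k \<in> val_semigroup R \<longleftrightarrow> 2 * delta R - 1 - k \<notin> val_semigroup R" if k: "k < 2 * delta R"
  proof
    assume "k \<in> val_semigroup R"
    with sub k eq(2) show "2 * delta R - 1 - k \<notin> val_semigroup R" by auto
  next
    assume "2 * delta R - 1 - k \<notin> val_semigroup R"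
    then have "c - 1 - k \<in> (\<lambda>k. c - 1 - k) ` ?S" using img eq(2) by simp
    then obtain j where j: "j \<in> val_semigroup R" "j < c" "c - 1 - k = c - 1 - j" by auto
    with k eq(2) have "k = j" by simp
    with j show "k \<in> val_semigroup R" by simp
  qed
qed

section \<open>Evaluation of power series in two variables\<close>

text \<open>Evaluation at x of a power series whose coefficients are already in C[[z]]. Evaluation
  in two variables factors through it: y is substituted in the coefficients first, then x.\<close>

definition eval1 :: "complex fps \<Rightarrow> complex fps fps \<Rightarrow> complex fps" where
  "eval1 x G = Abs_fps (\<lambda>n. \<Sum>i\<le>n. fps_nth (fps_nth G i * x ^ i) n)"

lemma eval1_truncate:
  assumes "fps_nth x 0 = 0"
  shows "eval1 x G - (\<Sum>i<N. fps_nth G i * x ^ i) \<in> zideal N"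
  unfolding zideal_def mem_Collect_eq
proof (intro allI impI)
  fix k assume "k < N"
  have "(\<Sum>i\<le>k. fps_nth (fps_nth G i * x ^ i) k) = (\<Sum>i<N. fps_nth (fps_nth G i * x ^ i) k)"
  proof (rule sum.mono_neutral_left)
    show "\<forall>i\<in>{..<N} - {..k}. fps_nth (fps_nth G i * x ^ i) k = 0"
    proof
      fix i assume "i \<in> {..<N} - {..k}"
      then have "k < i" by simp
      then show "fps_nth (fps_nth G i * x ^ i) k = 0"
        using zideal_mult_left[OF zideal_power[OF assms, of i]] unfolding zideal_def by blast
    qed
  qed (use \<open>k < N\<close> in auto)
  then show "fps_nth (eval1 x G - (\<Sum>i<N. fps_nth G i * x ^ i)) k = 0"
    by (simp only: eval1_def fps_sub_nth fps_sum_nth fps_nth_Abs_fps diff_self)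
qed

text \<open>Modulo z^N both sides become finite sums. The product of the truncations runs over a
  square of index pairs, the truncated product over the triangle i + j < N inside it, and the rest
  of the square is divisible by x^N, hence by z^N.\<close>

lemma eval1_mult:
  assumes x: "fps_nth x 0 = 0"
  shows "eval1 x (F * G) = eval1 x F * eval1 x G"
proof -
  have "eval1 x (F * G) - eval1 x F * eval1 x G \<in> zideal N" for N
  proof -
    let ?s = "\<lambda>H. \<Sum>i<N. fps_nth H i * x ^ i"
    let ?f = "\<lambda>(i, j). fps_nth F i * x ^ i * (fps_nth G j * x ^ j)"
    let ?A = "{(i, j). i + j < N}" and ?B = "{..<N} \<times> {..<N}"
    have "?s (F * G) = (\<Sum>k<N. \<Sum>i\<le>k. ?f (i, k - i))"
    proof (rule sum.cong[OF refl])
      fix k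
      have "fps_nth (F * G) k * x ^ k = (\<Sum>i\<le>k. fps_nth F i * fps_nth G (k - i) * x ^ k)"
        by (simp add: fps_mult_nth sum_distrib_right atLeast0AtMost)
      also have "\<dots> = (\<Sum>i\<le>k. ?f (i, k - i))"
      proof (rule sum.cong[OF refl])
        fix i assume "i \<in> {..k}"
        then have "x ^ k = x ^ i * x ^ (k - i)" by (simp flip: power_add)
        then show "fps_nth F i * fps_nth G (k - i) * x ^ k = ?f (i, k - i)" by (simp add: mult_ac)
      qed
      finally show "fps_nth (F * G) k * x ^ k = (\<Sum>i\<le>k. ?f (i, k - i))" .
    qed
    also have "\<dots> = sum ?f ?A"
      using sum.triangle_reindex[of "\<lambda>i j. ?f (i, j)" N] by simp
    finally have FG: "?s (F * G) = sum ?f ?A" .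
    have "?s F * ?s G = sum ?f ?B"
      unfolding sum_product by (subst sum.cartesian_product) simp
    also have "\<dots> = sum ?f (?B - ?A) + sum ?f ?A"
      by (rule sum.subset_diff) auto
    finally have "?s (F * G) - ?s F * ?s G = - sum ?f (?B - ?A)" using FG by simp
    also have "\<dots> = (- 1) * sum ?f (?B - ?A)" by simp
    also have "\<dots> \<in> zideal N"
    proof (intro zideal_mult_left zideal_sum)
      fix p assume "p \<in> ?B - ?A"
      then obtain i j where ij: "p = (i, j)" "N \<le> i + j" by auto
      have "x ^ i * x ^ j \<in> zideal N"
        using zideal_mono[OF ij(2) zideal_power[OF x, of "i + j"]] by (simp add: power_add)
      then have "(fps_nth F i * fps_nth G j) * (x ^ i * x ^ j) \<in> zideal N" by (rule zideal_mult_left)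
      then show "?f p \<in> zideal N" by (simp add: ij mult_ac)
    qed
    finally have 1: "?s (F * G) - ?s F * ?s G \<in> zideal N" .
    have "(eval1 x F - ?s F) * eval1 x G + ?s F * (eval1 x G - ?s G) \<in> zideal N"
      by (intro zideal_add zideal_mult_left zideal_mult_right eval1_truncate x)
    then have 2: "eval1 x F * eval1 x G - ?s F * ?s G \<in> zideal N" by (simp add: algebra_simps)
    show ?thesis
      by (rule zideal_diff_trans[OF eval1_truncate[OF x] zideal_diff_trans[OF 1 zideal_diff_commute[OF 2]]])
  qed
  then show ?thesis using zideal_all_eq_0[of "eval1 x (F * G) - eval1 x F * eval1 x G"] by simp
qed

lemma fps_compose_truncate:
  assumes "fps_nth y 0 = 0"
  shows "(F oo y) - (\<Sum>j<N. fps_const (fps_nth F j) * y ^ j) \<in> zideal N"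
proof -
  have "F oo y = eval1 y (Abs_fps (\<lambda>j. fps_const (fps_nth F j)))"
    by (rule fps_ext) (simp add: eval1_def fps_compose_nth atLeast0AtMost)
  with eval1_truncate[OF assms, of "Abs_fps (\<lambda>j. fps_const (fps_nth F j))" N] show ?thesis by simp
qed

text \<open>Cutting the inner sum off at n is harmless for the coefficient at n, because y^j has
  order at least j.\<close>

lemma eval2_eq_eval1:
  assumes y: "fps_nth y 0 = 0"
  shows "eval2 x y F = eval1 x (Abs_fps (\<lambda>i. fps_nth F i oo y))"
proof (rule fps_ext)
  fix n
  have "(\<Sum>j\<le>n. fps_nth (fps_nth F i) j * fps_nth (x ^ i * y ^ j) n) = fps_nth ((fps_nth F i oo y) * x ^ i) n" for i
  proof -
    let ?s = "\<Sum>j<Suc n. fps_const (fps_nth (fps_nth F i) j) * y ^ j"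
    have "((fps_nth F i oo y) - ?s) * x ^ i \<in> zideal (Suc n)"
      by (intro zideal_mult_right fps_compose_truncate y)
    then have "fps_nth ((fps_nth F i oo y) * x ^ i) n = fps_nth (?s * x ^ i) n"
      by (simp add: zideal_def left_diff_distrib)
    also have "?s * x ^ i = (\<Sum>j\<le>n. fps_const (fps_nth (fps_nth F i) j) * (x ^ i * y ^ j))"
      by (simp add: sum_distrib_right sum_distrib_left lessThan_Suc_atMost mult_ac)
    finally show ?thesis by (simp add: fps_sum_nth)
  qed
  then show "fps_nth (eval2 x y F) n = fps_nth (eval1 x (Abs_fps (\<lambda>i. fps_nth F i oo y))) n"
    by (simp add: eval2_def eval1_def)
qed

lemma eval2_add: "eval2 x y (F + G) = eval2 x y F + eval2 x y G"
  by (rule fps_ext) (simp add: eval2_def distrib_right sum.distrib)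

lemma eval2_mult:
  assumes "fps_nth x 0 = 0" "fps_nth y 0 = 0"
  shows "eval2 x y (F * G) = eval2 x y F * eval2 x y G"
proof -
  have "Abs_fps (\<lambda>i. fps_nth (F * G) i oo y) =
      Abs_fps (\<lambda>i. fps_nth F i oo y) * Abs_fps (\<lambda>i. fps_nth G i oo y)"
    by (rule fps_ext) (simp add: fps_mult_nth fps_compose_sum_distrib fps_compose_mult_distrib assms(2))
  then show ?thesis
    using assms by (simp add: eval2_eq_eval1 eval1_mult)
qed

lemma eval2_const: "eval2 x y (fps_const (fps_const a)) = fps_const a"
proof (rule fps_ext)
  fix n
  have "fps_nth (eval2 x y (fps_const (fps_const a))) n =
      (\<Sum>i\<le>n. if i = 0 then \<Sum>j\<le>n. if j = 0 then a * fps_nth (x ^ i * y ^ j) n else 0 else 0)"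
    unfolding eval2_def fps_nth_Abs_fps by (intro sum.cong refl) (auto simp: mult_delta_left)
  then show "fps_nth (eval2 x y (fps_const (fps_const a))) n = fps_nth (fps_const a) n" by (simp add: mult_delta_left)
qed

lemma eval2_x:
  assumes "fps_nth x 0 = 0" "fps_nth y 0 = 0"
  shows "eval2 x y fps_X = x"
proof (rule fps_ext)
  fix n
  have "fps_nth (eval2 x y fps_X) n =
      (\<Sum>i\<le>n. if i = 1 then \<Sum>j\<le>n. if j = 0 then fps_nth (x ^ i * y ^ j) n else 0 else 0)"
    unfolding eval2_def fps_nth_Abs_fps by (intro sum.cong refl) (auto simp: fps_X_def mult_delta_left)
  then show "fps_nth (eval2 x y fps_X) n = fps_nth x n" using assms by (cases n) (simp_all add: mult_delta_left)
qed

lemma eval2_y: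
  assumes "fps_nth x 0 = 0" "fps_nth y 0 = 0"
  shows "eval2 x y (fps_const fps_X) = y"
proof (rule fps_ext)
  fix n
  have "fps_nth (eval2 x y (fps_const fps_X)) n =
      (\<Sum>i\<le>n. if i = 0 then \<Sum>j\<le>n. if j = 1 then fps_nth (x ^ i * y ^ j) n else 0 else 0)"
    unfolding eval2_def fps_nth_Abs_fps by (intro sum.cong refl) (auto simp: fps_X_def mult_delta_left)
  then show "fps_nth (eval2 x y (fps_const fps_X)) n = fps_nth y n" using assms by (cases n) (simp_all add: mult_delta_left)
qed

lemma eval2_in_plane_branch:
  assumes b: "plane_branch R x y"
  shows "eval2 x y F \<in> R"
proof -
  have xy: "fps_nth x 0 = 0" "fps_nth y 0 = 0" using b by (auto simp: plane_branch_def)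
  note R = plane_branch_subalgebra[OF b]
  note sub = C_subalgebra_subspace[OF R(1)]
  have y: "f oo y \<in> R" for f
  proof (rule plane_branch_limit[OF b])
    fix N
    show "\<exists>g\<in>R. (f oo y) - g \<in> zideal N"
      by (rule bexI[of _ "\<Sum>j<N. fps_const (fps_nth f j) * y ^ j"], rule fps_compose_truncate[OF xy(2)])
        (intro fps_subspace_sum fps_subspaceD(3) sub C_subalgebra_power R)
  qed
  show ?thesis
    unfolding eval2_eq_eval1[OF xy(2)]
  proof (rule plane_branch_limit[OF b])
    fix N
    let ?G = "Abs_fps (\<lambda>i. fps_nth F i oo y)"
    show "\<exists>g\<in>R. eval1 x ?G - g \<in> zideal N"
      by (rule bexI[of _ "\<Sum>i<N. fps_nth ?G i * x ^ i"], rule eval1_truncate[OF xy(1)])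
        (simp only: fps_nth_Abs_fps, intro fps_subspace_sum sub C_subalgebra_mult C_subalgebra_power R y)
  qed
qed

text \<open>Minimality of R again. Approximation to a finite order is what the duality calls for,
  since it sees R only modulo a power of z.\<close>

lemma plane_branch_approx_eval2:
  assumes b: "plane_branch R x y" and "f \<in> R"
  shows "\<exists>F. f - eval2 x y F \<in> zideal N"
proof -
  let ?S = "{f. \<forall>N. \<exists>F. f - eval2 x y F \<in> zideal N}"
  have xy: "fps_nth x 0 = 0" "fps_nth y 0 = 0" using b by (auto simp: plane_branch_def)
  have base: "eval2 x y F \<in> ?S" for F
    by (auto intro!: exI[of _ F])
  have "fps_const a \<in> ?S" for a using base[of "fps_const (fps_const a)"] by (simp add: eval2_const)
  moreover have "f + g \<in> ?S" "f * g \<in> ?S" if fg: "f \<in> ?S" "g \<in> ?S" for f g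
  proof -
    have "\<exists>F. f + g - eval2 x y F \<in> zideal N" "\<exists>F. f * g - eval2 x y F \<in> zideal N" for N
    proof -
      obtain F G where F: "f - eval2 x y F \<in> zideal N" and G: "g - eval2 x y G \<in> zideal N" using fg by blast
      have "f + g - eval2 x y (F + G) \<in> zideal N"
        using zideal_add[OF F G] by (simp add: eval2_add algebra_simps)
      then show "\<exists>F. f + g - eval2 x y F \<in> zideal N" ..
      have "(f - eval2 x y F) * g + eval2 x y F * (g - eval2 x y G) \<in> zideal N"
        using F G by (intro zideal_add zideal_mult_right zideal_mult_left)
      then have "f * g - eval2 x y (F * G) \<in> zideal N" by (simp add: eval2_mult[OF xy] algebra_simps)
      then show "\<exists>F. f * g - eval2 x y F \<in> zideal N" ..
    qed
    then show "f + g \<in> ?S" "f * g \<in> ?S" by blast+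
  qed
  ultimately have "C_subalgebra ?S" by (auto simp: C_subalgebra_def)
  moreover have "closed ?S"
    unfolding closed_fps_iff
  proof (intro allI impI)
    fix f assume *: "\<forall>N. \<exists>g\<in>?S. f - g \<in> zideal N"
    have "\<exists>F. f - eval2 x y F \<in> zideal N" for N
    proof -
      from * obtain g where g: "g \<in> ?S" "f - g \<in> zideal N" by blast
      then obtain F where "g - eval2 x y F \<in> zideal N" by blast
      with zideal_diff_trans[OF g(2)] show ?thesis by blast
    qed
    then show "f \<in> ?S" by blast
  qed
  moreover have "x \<in> ?S" "y \<in> ?S"
    using base[of fps_X] base[of "fps_const fps_X"] by (simp_all add: eval2_x[OF xy] eval2_y[OF xy])
  ultimately have "R \<subseteq> ?S" by (rule plane_branch_minimal[OF b])
  with assms(2) show ?thesis by blast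
qed

section \<open>Duality on a plane branch\<close>

text \<open>Perfectness of the pairing (f, r) -> \<Lambda>(f r) between C[[z]]/R and R/z^c C[[z]],
  expressed without quotient spaces: \<open>annihilator\<close> is nondegeneracy in f, and
  \<open>represent\<close> says that every functional on R that kills z^c C[[z]] comes from some
  f.\<close>

locale duality =
  fixes c :: nat and R :: "complex fps set" and \<Lambda> :: "complex fps \<Rightarrow> complex"
  assumes add: "\<Lambda> (f + g) = \<Lambda> f + \<Lambda> g"
    and scale: "\<Lambda> (fps_const a * f) = a * \<Lambda> f"
    and zero: "f \<in> zideal c \<Longrightarrow> \<Lambda> f = 0"
    and annihilates: "f \<in> R \<Longrightarrow> \<Lambda> f = 0"
    and annihilator: "(\<And>r. r \<in> R \<Longrightarrow> \<Lambda> (f * r) = 0) \<Longrightarrow> f \<in> R"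
    and represent: "(\<And>r s. r \<in> R \<Longrightarrow> s \<in> R \<Longrightarrow> \<alpha> (r + s) = \<alpha> r + \<alpha> s) \<Longrightarrow>
      (\<And>a r. r \<in> R \<Longrightarrow> \<alpha> (fps_const a * r) = a * \<alpha> r) \<Longrightarrow>
      (\<And>r. r \<in> zideal c \<Longrightarrow> \<alpha> r = 0) \<Longrightarrow> \<exists>f. \<forall>r\<in>R. \<alpha> r = \<Lambda> (f * r)"

text \<open>For a symmetric semigroup c - 1 is a gap, so some functional vanishes on R but not at
  \<open>z^(c-1)\<close>; multiplication followed by this functional identifies C[[z]]/R with the dual of
  \<open>R/z^c C[[z]]\<close>.\<close>

lemma symmetric_duality:
  assumes R: "C_subalgebra R" and c: "zideal c \<subseteq> R"
    and sym: "\<And>k. k < c \<Longrightarrow> k \<in> val_semigroup R \<longleftrightarrow> c - 1 - k \<notin> val_semigroup R"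
  shows "\<exists>\<Lambda>. duality c R \<Lambda>"
proof (cases "c = 0")
  case True
  with c have "R = UNIV" by auto
  then show ?thesis using True by (intro exI[of _ "\<lambda>_. 0"]) (unfold_locales, auto)
next
  case False
  note sub = C_subalgebra_subspace[OF R]
  have "c - 1 \<notin> val_semigroup R"
    using sym[of 0] False val_semigroup_0[OF R] by simp
  from annihilating_functional[OF sub this] obtain l where l: "l (c - 1) = 1"
    "\<And>f. f \<in> R \<Longrightarrow> (\<Sum>k\<le>c - 1. l k * fps_nth f k) = 0" by blast
  define \<Lambda> where "\<Lambda> f = (\<Sum>k\<le>c - 1. l k * fps_nth f k)" for f
  have add: "\<Lambda> (f + g) = \<Lambda> f + \<Lambda> g" for f g
    by (simp add: \<Lambda>_def distrib_left sum.distrib)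
  have scale: "\<Lambda> (fps_const a * f) = a * \<Lambda> f" for a f
    by (simp add: \<Lambda>_def sum_distrib_left mult_ac)
  have diff: "\<Lambda> (f - g) = \<Lambda> f - \<Lambda> g" for f g
    using add[of "f - g" g] by simp
  have \<Lambda>_leading: "\<Lambda> f = fps_nth f (c - 1)" if "f \<in> zideal (c - 1)" for f
  proof -
    have "\<Lambda> f = (\<Sum>k\<in>{c - 1}. l k * fps_nth f k)"
      unfolding \<Lambda>_def by (rule sum.mono_neutral_right) (use that in \<open>auto simp: zideal_def\<close>)
    with l show ?thesis by simp
  qed
  have zero: "\<Lambda> f = 0" if "f \<in> zideal c" for f
    using \<Lambda>_leading[of f] zideal_mono[of "c - 1" c f] that False by (simp add: zideal_def)
  have pair: "\<Lambda> (f * g) = fps_nth f a * fps_nth g b"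
    if "f \<in> zideal a" "g \<in> zideal b" "a + b = c - 1" for f g a b
    using \<Lambda>_leading[of "f * g"] zideal_mult_add[OF that(1,2)] fps_mult_nth_leading[OF that(1,2)] that(3) by simp
  have "duality c R \<Lambda>"
  proof
    show "\<Lambda> f = 0" if "f \<in> R" for f using l(2)[OF that] by (simp add: \<Lambda>_def)
    show "f \<in> R" if f: "\<And>r. r \<in> R \<Longrightarrow> \<Lambda> (f * r) = 0" for f
    proof -
      have "\<exists>r\<in>R. f - r \<in> zideal k" if "k \<le> c" for k
        using that
      proof (induction k)
        case 0
        show ?case using fps_subspaceD(1)[OF sub] by auto
      next
        case (Suc k)
        then obtain r where r: "r \<in> R" "f - r \<in> zideal k" by auto
        show ?case
        proof (cases "k \<in> val_semigroup R")
          case True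
          then obtain g where g: "g \<in> R" "g \<in> zideal k" "fps_nth g k = 1"
            using val_semigroup_iff[OF sub] by blast
          have "f - (r + fps_const (fps_nth (f - r) k) * g) \<in> zideal (Suc k)"
            using zideal_cancel_leading[OF r(2) g(2,3)] by (simp add: algebra_simps)
          moreover have "r + fps_const (fps_nth (f - r) k) * g \<in> R"
            using r g fps_subspaceD[OF sub] by blast
          ultimately show ?thesis by blast
        next
          case False
          \<comment> \<open>At a gap k symmetry provides g in R of the complementary order c - 1 -
            k. Then \<Lambda>((f - r) g) is the coefficient of f - r at k, and it vanishes because
            both f and r are annihilated against g.\<close>
          with sym[of k] Suc.prems have "c - 1 - k \<in> val_semigroup R" by simp
          then obtain g where g: "g \<in> R" "g \<in> zideal (c - 1 - k)" "fps_nth g (c - 1 - k) = 1"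
            using val_semigroup_iff[OF sub] by blast
          have "\<Lambda> ((f - r) * g) = \<Lambda> (f * g) - \<Lambda> (r * g)" by (simp add: left_diff_distrib diff)
          also have "\<dots> = 0"
            using f[OF g(1)] l(2)[OF C_subalgebra_mult[OF R r(1) g(1)]] by (simp add: \<Lambda>_def)
          finally have "\<Lambda> ((f - r) * g) = 0" .
          moreover have "k + (c - 1 - k) = c - 1" using Suc.prems by simp
          ultimately have "fps_nth (f - r) k = 0"
            using pair[OF r(2) g(2)] g(3) by (simp only: mult_1_right)
          with r have "f - r \<in> zideal (Suc k)" by (simp only: zideal_Suc_iff simp_thms)
          with r show ?thesis by blast
        qed
      qed
      from this[of c] obtain r where r: "r \<in> R" "f - r \<in> zideal c" by auto
      then have "r + (f - r) \<in> R" using c by (intro fps_subspaceD(2)[OF sub]) auto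
      then show ?thesis by simp
    qed
    show "\<exists>f. \<forall>r\<in>R. \<alpha> r = \<Lambda> (f * r)"
      if \<alpha>: "\<And>r s. r \<in> R \<Longrightarrow> s \<in> R \<Longrightarrow> \<alpha> (r + s) = \<alpha> r + \<alpha> s"
        "\<And>a r. r \<in> R \<Longrightarrow> \<alpha> (fps_const a * r) = a * \<alpha> r"
        "\<And>r. r \<in> zideal c \<Longrightarrow> \<alpha> r = 0" for \<alpha>
    proof -
      have "\<exists>f. \<forall>r\<in>R \<inter> zideal k. \<alpha> r = \<Lambda> (f * r)" if "k \<le> c" for k
        using that
      proof (induction k rule: inc_induct)
        case base
        show ?case using \<alpha>(3) zero by (intro exI[of _ 0]) auto
      next
        case (step k)
        then obtain f where f: "\<And>r. r \<in> R \<Longrightarrow> r \<in> zideal (Suc k) \<Longrightarrow> \<alpha> r = \<Lambda> (f * r)" by auto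
        show ?case
        proof (cases "k \<in> val_semigroup R")
          case False
          then show ?thesis
            using f nth_gap_eq_0[of _ R k] by (intro exI[of _ f]) (auto simp: zideal_Suc_iff)
        next
          case True
          then obtain g where g: "g \<in> R" "g \<in> zideal k" "fps_nth g k = 1"
            using val_semigroup_iff[OF sub] by blast
          \<comment> \<open>On series of order at least k, multiplying by z^(c-1-k) and applying
            \<Lambda> reads off the coefficient at k. So adding \<open>?h\<close> corrects the value
            at g and leaves the values on higher orders alone.\<close>
          let ?h = "fps_const (\<alpha> g - \<Lambda> (f * g)) * fps_X ^ (c - 1 - k)"
          have h: "?h \<in> zideal (c - 1 - k)" "fps_nth ?h (c - 1 - k) = \<alpha> g - \<Lambda> (f * g)"
            by (simp_all add: zideal_def fps_X_power_nth)
          have hr: "\<Lambda> (?h * r) = (\<alpha> g - \<Lambda> (f * g)) * fps_nth r k" if "r \<in> zideal k" for r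
            using pair[OF h(1) that] h(2) step.hyps by simp
          have "\<alpha> r = \<Lambda> ((f + ?h) * r)" if r: "r \<in> R" "r \<in> zideal k" for r
          proof -
            let ?s = "r - fps_const (fps_nth r k) * g"
            have s: "?s \<in> R" "?s \<in> zideal (Suc k)"
              using zideal_cancel_leading[OF r(2) g(2,3)] fps_subspace_diff[OF sub r(1)]
                fps_subspaceD(3)[OF sub g(1)] by blast+
            have "\<alpha> r = \<alpha> (?s + fps_const (fps_nth r k) * g)" by simp
            also have "\<dots> = \<alpha> ?s + fps_nth r k * \<alpha> g"
              using \<alpha>(1)[OF s(1) fps_subspaceD(3)[OF sub g(1)]] \<alpha>(2)[OF g(1)] by metis
            also have "\<alpha> ?s = \<Lambda> (f * ?s)" by (rule f[OF s])
            also have "f * ?s = f * r - fps_const (fps_nth r k) * (f * g)" by (simp add: algebra_simps)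
            also have "\<Lambda> \<dots> = \<Lambda> (f * r) - fps_nth r k * \<Lambda> (f * g)" by (simp only: diff scale)
            finally have "\<alpha> r = \<Lambda> (f * r) + (\<alpha> g - \<Lambda> (f * g)) * fps_nth r k"
              by (simp add: algebra_simps)
            also have "\<dots> = \<Lambda> ((f + ?h) * r)" by (simp only: distrib_right add hr[OF r(2)])
            finally show ?thesis .
          qed
          then show ?thesis by blast
        qed
      qed
      from this[of 0] show ?thesis by auto
    qed
  qed (fact add scale zero)+
  then show ?thesis by (intro exI[of _ \<Lambda>])
qed


text \<open>The linear map sending z^k to \<open>t k\<close> for k < c and killing z^c C[[z]]. It is
  encoded by its finitely many values so that the same data can be used over every
  C-algebra.\<close>

definition lin :: "nat \<Rightarrow> (nat \<Rightarrow> complex fps) \<Rightarrow> complex fps \<Rightarrow> complex fps" where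
  "lin c t f = (\<Sum>k<c. fps_const (fps_nth f k) * t k)"

text \<open>A map \<open>z^k \<mapsto> t k\<close> inducing a map from C[[z]]/R to C[[z]]/R' that has s as a right inverse and is
  semilinear over R'.\<close>

definition semilinear_transfer ::
  "nat \<Rightarrow> complex fps set \<Rightarrow> complex fps set \<Rightarrow> (nat \<Rightarrow> complex fps) \<Rightarrow> (nat \<Rightarrow> complex fps) \<Rightarrow> bool" where
  "semilinear_transfer c R R' t s \<longleftrightarrow>
     (\<forall>f\<in>R. lin c t f \<in> R') \<and> (\<forall>f. lin c t (lin c s f) - f \<in> R') \<and>
     (\<forall>r'\<in>R'. \<exists>r\<in>R. \<forall>f. lin c t (r * f) - r' * lin c t f \<in> R')"

text \<open>\<open>rel\<close> is the graph of a linear map from R'/z^c C[[z]] to R/z^c C[[z]]. The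
  map given by t is its transpose under the two pairings: \<open>t k\<close> represents the
  functional that sends r' to \<Lambda>(z^k r), for any r related to r'.\<close>

lemma ex_dual_transfer:
  fixes \<Lambda> \<Lambda>' :: "complex fps \<Rightarrow> complex" and rel :: "complex fps \<Rightarrow> complex fps \<Rightarrow> bool"
  assumes \<Lambda>: "duality c R \<Lambda>" and \<Lambda>': "duality c R' \<Lambda>'"
    and R': "zideal c \<subseteq> R'"
    and total: "\<And>r'. r' \<in> R' \<Longrightarrow> \<exists>r. rel r r'"
    and rel_R': "\<And>r r'. rel r r' \<Longrightarrow> r' \<in> R'"
    and rel_add: "\<And>r r' s s'. rel r r' \<Longrightarrow> rel s s' \<Longrightarrow> rel (r + s) (r' + s')"
    and rel_scale: "\<And>a r r'. rel r r' \<Longrightarrow> rel (fps_const a * r) (fps_const a * r')"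
    and rel_zero: "\<And>r r'. rel r r' \<Longrightarrow> r' \<in> zideal c \<Longrightarrow> r \<in> zideal c"
  shows "\<exists>t. \<forall>f r r'. rel r r' \<longrightarrow> \<Lambda>' (lin c t f * r') = \<Lambda> (f * r)"
proof -
  note add = duality.add[OF \<Lambda>] duality.add[OF \<Lambda>']
    and scale = duality.scale[OF \<Lambda>] duality.scale[OF \<Lambda>']
    and zero = duality.zero[OF \<Lambda>]
  \<comment> \<open>An arbitrary choice; \<open>\<Lambda>_rel\<close> shows that the values of
    \<Lambda> do not depend on it.\<close>
  define lift where "lift r' = (SOME r. rel r r')" for r'
  have lift: "rel (lift r') r'" if "r' \<in> R'" for r'
    unfolding lift_def using total[OF that] by (rule someI_ex)
  have \<Lambda>_rel: "\<Lambda> (f * r) = \<Lambda> (f * s)" if "rel r r'" "rel s r'" for f r s r'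
  proof -
    have "rel (r + fps_const (- 1) * s) (r' + fps_const (- 1) * r')"
      using that by (intro rel_add rel_scale)
    then have "r + fps_const (- 1) * s \<in> zideal c"
      by (rule rel_zero) (simp flip: fps_const_neg)
    then have "\<Lambda> (f * (r + fps_const (- 1) * s)) = 0"
      by (intro zero zideal_mult_left)
    also have "f * (r + fps_const (- 1) * s) = f * r + fps_const (- 1) * (f * s)" by (simp add: algebra_simps)
    finally show ?thesis by (simp only: add scale) simp
  qed
  have "\<exists>g. \<forall>r'\<in>R'. \<Lambda> (f * lift r') = \<Lambda>' (g * r')" for f
  proof (rule duality.represent[OF \<Lambda>'])
    fix r' s' assume rs: "r' \<in> R'" "s' \<in> R'"
    have "rel (lift r' + lift s') (r' + s')" using rs by (intro rel_add lift)
    then have "\<Lambda> (f * lift (r' + s')) = \<Lambda> (f * (lift r' + lift s'))"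
      using \<Lambda>_rel lift rel_R' by blast
    then show "\<Lambda> (f * lift (r' + s')) = \<Lambda> (f * lift r') + \<Lambda> (f * lift s')"
      by (simp only: distrib_left add)
  next
    fix a r' assume r': "r' \<in> R'"
    have "rel (fps_const a * lift r') (fps_const a * r')" using r' by (intro rel_scale lift)
    then have "\<Lambda> (f * lift (fps_const a * r')) = \<Lambda> (f * (fps_const a * lift r'))"
      using \<Lambda>_rel lift rel_R' by blast
    also have "f * (fps_const a * lift r') = fps_const a * (f * lift r')" by (simp add: mult_ac)
    finally show "\<Lambda> (f * lift (fps_const a * r')) = a * \<Lambda> (f * lift r')" by (simp only: scale)
  next
    fix r' assume "r' \<in> zideal c"
    with R' lift have "lift r' \<in> zideal c" by (blast intro: rel_zero)
    then show "\<Lambda> (f * lift r') = 0" by (intro zero zideal_mult_left)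
  qed
  then have "\<forall>k. \<exists>g. \<forall>r'\<in>R'. \<Lambda> (fps_X ^ k * lift r') = \<Lambda>' (g * r')" by simp
  from choice[OF this] obtain t where
    t: "\<forall>k. \<forall>r'\<in>R'. \<Lambda> (fps_X ^ k * lift r') = \<Lambda>' (t k * r')" by (rule exE)
  have "\<Lambda>' (lin c t f * r') = \<Lambda> (f * r)" if rel: "rel r r'" for f r r'
  proof -
    have r': "r' \<in> R'" using rel by (rule rel_R')
    have zero_0: "\<Lambda>' 0 = 0" "\<Lambda> 0 = 0" using scale[of 0 0] by simp_all
    have sum: "\<Lambda>' (sum h A) = (\<Sum>k\<in>A. \<Lambda>' (h k))" "\<Lambda> (sum h A) = (\<Sum>k\<in>A. \<Lambda> (h k))"
      for h :: "nat \<Rightarrow> complex fps" and A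
      by (induction A rule: infinite_finite_induct) (simp_all add: add zero_0)
    let ?p = "\<Sum>k<c. fps_const (fps_nth f k) * fps_X ^ k"
    have "f - ?p \<in> zideal c"
      by (simp add: zideal_def fps_sum_nth fps_X_power_nth if_distrib cong: if_cong)
    then have "\<Lambda> ((f - ?p) * r) = 0" by (intro zero zideal_mult_right)
    moreover have "\<Lambda> (f * r) = \<Lambda> ((f - ?p) * r + ?p * r)" by (simp add: algebra_simps)
    ultimately have "\<Lambda> (f * r) = \<Lambda> (?p * r)" by (simp only: add) simp
    also have "\<dots> = (\<Sum>k<c. fps_nth f k * \<Lambda> (fps_X ^ k * r))"
      by (simp only: sum_distrib_right sum mult.assoc scale)
    also have "\<dots> = (\<Sum>k<c. fps_nth f k * \<Lambda>' (t k * r'))"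
      using t r' \<Lambda>_rel[OF rel lift[OF r']] by simp
    also have "\<dots> = \<Lambda>' (lin c t f * r')"
      by (simp only: lin_def sum_distrib_right sum mult.assoc scale)
    finally show ?thesis by simp
  qed
  then show ?thesis by blast
qed

text \<open>\<psi> descends to a ring isomorphism between the quotients of R and R' by z^c C[[z]].
  Transposing it in both directions yields t and s, and its multiplicativity becomes their
  semilinearity.\<close>

lemma plane_branch_ex_transfer:
  assumes b: "plane_branch R x y" "plane_branch R' x' y'"
    and c: "c = 2 * delta R" "c = 2 * delta R'"
    and \<psi>: "C_automorphism \<psi>" "\<psi> ` C_tilde R x y = C_tilde R' x' y'"
  shows "\<exists>t s. semilinear_transfer c R R' t s \<and> semilinear_transfer c R' R s t"
proof -
  note R = plane_branch_subalgebra(1)[OF b(1)] and R' = plane_branch_subalgebra(1)[OF b(2)]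
  have sub: "zideal c \<subseteq> R" "zideal c \<subseteq> R'"
    using plane_branch_symmetric(1)[OF b(1)] plane_branch_symmetric(1)[OF b(2)] c by simp_all
  have xy: "fps_nth x 0 = 0" "fps_nth y 0 = 0" "fps_nth x' 0 = 0" "fps_nth y' 0 = 0"
    using b by (auto simp: plane_branch_def)
  from symmetric_duality[OF R sub(1) plane_branch_symmetric(2)[OF b(1), folded c(1)]]
  obtain \<Lambda> where \<Lambda>: "duality c R \<Lambda>" by (rule exE)
  from symmetric_duality[OF R' sub(2) plane_branch_symmetric(2)[OF b(2), folded c(2)]]
  obtain \<Lambda>' where \<Lambda>': "duality c R' \<Lambda>'" by (rule exE)
  have \<psi>_hom: "\<psi> (F + G) = \<psi> F + \<psi> G" "\<psi> (F * G) = \<psi> F * \<psi> G"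
      "\<psi> (fps_const (fps_const a)) = fps_const (fps_const a)" and \<psi>_bij: "bij \<psi>" for F G a
    using \<psi>(1) by (simp_all add: C_automorphism_def)
  \<comment> \<open>The graph of the isomorphism of quotients, lifted to elements of R and R'. With
    a relation no representatives have to be chosen, and its converse serves for the opposite
    direction.\<close>
  define rel where "rel r r' \<longleftrightarrow> r \<in> R \<and> r' \<in> R' \<and>
    (\<exists>F. r - eval2 x y F \<in> zideal c \<and> r' - eval2 x' y' (\<psi> F) \<in> zideal c)" for r r'
  have rel_R: "r \<in> R" "r' \<in> R'" if "rel r r'" for r r' using that by (auto simp: rel_def)
  have rel_add: "rel (r + s) (r' + s')" if "rel r r'" "rel s s'" for r r' s s'
  proof -
    obtain F G where "r - eval2 x y F \<in> zideal c" "r' - eval2 x' y' (\<psi> F) \<in> zideal c"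
      "s - eval2 x y G \<in> zideal c" "s' - eval2 x' y' (\<psi> G) \<in> zideal c"
      using \<open>rel r r'\<close> \<open>rel s s'\<close> unfolding rel_def by blast
    then have "(r + s) - eval2 x y (F + G) \<in> zideal c" "(r' + s') - eval2 x' y' (\<psi> (F + G)) \<in> zideal c"
      by (simp_all add: eval2_add \<psi>_hom zideal_def)
    then show ?thesis
      unfolding rel_def using fps_subspaceD(2)[OF C_subalgebra_subspace[OF R] rel_R(1)[OF that(1)] rel_R(1)[OF that(2)]]
        fps_subspaceD(2)[OF C_subalgebra_subspace[OF R'] rel_R(2)[OF that(1)] rel_R(2)[OF that(2)]] by blast
  qed
  have rel_mult: "rel (r * s) (r' * s')" if "rel r r'" "rel s s'" for r r' s s'
  proof -
    obtain F G where FG: "r - eval2 x y F \<in> zideal c" "r' - eval2 x' y' (\<psi> F) \<in> zideal c"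
      "s - eval2 x y G \<in> zideal c" "s' - eval2 x' y' (\<psi> G) \<in> zideal c"
      using \<open>rel r r'\<close> \<open>rel s s'\<close> unfolding rel_def by blast
    have "(r - eval2 x y F) * s + eval2 x y F * (s - eval2 x y G) \<in> zideal c"
      "(r' - eval2 x' y' (\<psi> F)) * s' + eval2 x' y' (\<psi> F) * (s' - eval2 x' y' (\<psi> G)) \<in> zideal c"
      by (rule zideal_add[OF zideal_mult_right[OF FG(1)] zideal_mult_left[OF FG(3)]],
          rule zideal_add[OF zideal_mult_right[OF FG(2)] zideal_mult_left[OF FG(4)]])
    then have "r * s - eval2 x y (F * G) \<in> zideal c" "r' * s' - eval2 x' y' (\<psi> (F * G)) \<in> zideal c"
      by (simp_all add: eval2_mult xy \<psi>_hom algebra_simps)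
    then show ?thesis
      unfolding rel_def using C_subalgebra_mult[OF R rel_R(1)[OF that(1)] rel_R(1)[OF that(2)]]
        C_subalgebra_mult[OF R' rel_R(2)[OF that(1)] rel_R(2)[OF that(2)]] by blast
  qed
  have rel_const: "rel (fps_const a) (fps_const a)" for a
    unfolding rel_def using C_subalgebra_const[OF R] C_subalgebra_const[OF R']
    by (intro conjI exI[of _ "fps_const (fps_const a)"]) (simp_all add: \<psi>_hom eval2_const)
  have rel_scale: "rel (fps_const a * r) (fps_const a * r')" if "rel r r'" for a r r'
    by (rule rel_mult[OF rel_const that])
  have total1: "\<exists>r'. rel r r'" if r: "r \<in> R" for r
  proof -
    obtain F where "r - eval2 x y F \<in> zideal c" using plane_branch_approx_eval2[OF b(1) r] by blast
    then have "rel r (eval2 x' y' (\<psi> F))"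
      unfolding rel_def using r eval2_in_plane_branch[OF b(2)] by auto
    then show ?thesis ..
  qed
  have total2: "\<exists>r. rel r r'" if r': "r' \<in> R'" for r'
  proof -
    obtain G where G: "r' - eval2 x' y' G \<in> zideal c" using plane_branch_approx_eval2[OF b(2) r'] by blast
    obtain F where "G = \<psi> F" using bij_is_surj[OF \<psi>_bij] by (auto simp: surj_def)
    with G have "rel (eval2 x y F) r'"
      unfolding rel_def using r' eval2_in_plane_branch[OF b(1)] by (auto intro!: exI[of _ F])
    then show ?thesis ..
  qed
  have tilde: "F \<in> C_tilde R x y \<longleftrightarrow> eval2 x y F \<in> zideal c" "F \<in> C_tilde R' x' y' \<longleftrightarrow> eval2 x' y' F \<in> zideal c" for F
    using c by (simp_all add: C_tilde_def zideal_iff_dvd)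
  \<comment> \<open>Here it is used that \<psi> carries one ideal to the other: related elements lie
    in z^c C[[z]] simultaneously, so the relation is a bijection between the quotients.\<close>
  have iff: "eval2 x y F \<in> zideal c \<longleftrightarrow> eval2 x' y' (\<psi> F) \<in> zideal c" for F
    unfolding tilde[symmetric] \<psi>(2)[symmetric] using bij_is_inj[OF \<psi>_bij] by (simp add: inj_image_mem_iff)
  have move: "f \<in> zideal c \<longleftrightarrow> g \<in> zideal c" if "f - g \<in> zideal c" for f g :: "complex fps"
    using that by (auto simp: zideal_def)
  have rel_zero: "r \<in> zideal c \<longleftrightarrow> r' \<in> zideal c" if "rel r r'" for r r'
  proof -
    from that obtain F where "r - eval2 x y F \<in> zideal c" "r' - eval2 x' y' (\<psi> F) \<in> zideal c"
      unfolding rel_def by blast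
    from move[OF this(1)] move[OF this(2)] iff show ?thesis by simp
  qed
  have "\<exists>t. \<forall>f r r'. rel r r' \<longrightarrow> \<Lambda>' (lin c t f * r') = \<Lambda> (f * r)"
    by (rule ex_dual_transfer[OF \<Lambda> \<Lambda>' sub(2) total2 rel_R(2) rel_add rel_scale iffD2[OF rel_zero]])
  then obtain t where t: "\<And>f r r'. rel r r' \<Longrightarrow> \<Lambda>' (lin c t f * r') = \<Lambda> (f * r)" by blast
  have "\<exists>s. \<forall>f r' r. rel r r' \<longrightarrow> \<Lambda> (lin c s f * r) = \<Lambda>' (f * r')"
  proof (rule ex_dual_transfer[where rel = "\<lambda>r' r. rel r r'", OF \<Lambda>' \<Lambda> sub(1)])
    show "\<exists>r'. rel r r'" if "r \<in> R" for r by (rule total1[OF that])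
    show "r \<in> R" if "rel r r'" for r r' by (rule rel_R(1)[OF that])
    show "r' \<in> zideal c" if "rel r r'" "r \<in> zideal c" for r r'
      using rel_zero[OF that(1)] that(2) by simp
  qed (fact rel_add rel_scale)+
  then obtain s where s: "\<And>f r r'. rel r r' \<Longrightarrow> \<Lambda> (lin c s f * r) = \<Lambda>' (f * r')" by blast
  \<comment> \<open>Stated for arbitrary rings, functionals and relations in order to apply to the
    converse relation as well. Each membership in R' is tested with \<Lambda>': paired with an
    element of R', the two terms of a difference turn into the same value of \<Lambda>.\<close>
  have half: "semilinear_transfer c R R' t s"
    if R: "C_subalgebra R" and \<Lambda>: "duality c R \<Lambda>" and \<Lambda>': "duality c R' \<Lambda>'"
      and rel: "\<And>r r'. rel r r' \<Longrightarrow> r \<in> R" "\<And>r'. r' \<in> R' \<Longrightarrow> \<exists>r. rel r r'"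
        "\<And>r r' s s'. rel r r' \<Longrightarrow> rel s s' \<Longrightarrow> rel (r * s) (r' * s')"
      and t: "\<And>f r r'. rel r r' \<Longrightarrow> \<Lambda>' (lin c t f * r') = \<Lambda> (f * r)"
      and s: "\<And>f r r'. rel r r' \<Longrightarrow> \<Lambda> (lin c s f * r) = \<Lambda>' (f * r')"
    for R R' \<Lambda> \<Lambda>' rel t s
    unfolding semilinear_transfer_def
  proof (intro conjI ballI allI)
    have diff: "\<Lambda>' (f - g) = \<Lambda>' f - \<Lambda>' g" for f g using duality.add[OF \<Lambda>', of "f - g" g] by simp
    show "lin c t f \<in> R'" if f: "f \<in> R" for f
    proof (rule duality.annihilator[OF \<Lambda>'])
      fix r' assume "r' \<in> R'"
      then obtain r where r: "rel r r'" using rel(2) by blast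
      from duality.annihilates[OF \<Lambda> C_subalgebra_mult[OF R f rel(1)[OF r]]] t[OF r]
      show "\<Lambda>' (lin c t f * r') = 0" by simp
    qed
    show "lin c t (lin c s f) - f \<in> R'" for f
    proof (rule duality.annihilator[OF \<Lambda>'])
      fix r' assume "r' \<in> R'"
      then obtain r where r: "rel r r'" using rel(2) by blast
      show "\<Lambda>' ((lin c t (lin c s f) - f) * r') = 0"
        by (simp only: left_diff_distrib diff t[OF r] s[OF r] diff_self)
    qed
    fix r' assume "r' \<in> R'"
    then obtain r where r: "rel r r'" using rel(2) by blast
    have "lin c t (r * f) - r' * lin c t f \<in> R'" for f
    proof (rule duality.annihilator[OF \<Lambda>'])
      fix q' assume "q' \<in> R'"
      then obtain q where q: "rel q q'" using rel(2) by blast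
      have "(lin c t (r * f) - r' * lin c t f) * q' = lin c t (r * f) * q' - lin c t f * (r' * q')"
        by (simp add: algebra_simps)
      then have "\<Lambda>' ((lin c t (r * f) - r' * lin c t f) * q') = \<Lambda> (r * f * q) - \<Lambda> (f * (r * q))"
        by (simp only: diff t[OF q] t[OF rel(3)[OF r q]])
      also have "\<dots> = 0" by (simp add: mult_ac)
      finally show "\<Lambda>' ((lin c t (r * f) - r' * lin c t f) * q') = 0" .
    qed
    with rel(1)[OF r] show "\<exists>r\<in>R. \<forall>f. lin c t (r * f) - r' * lin c t f \<in> R'" by blast
  qed
  have "semilinear_transfer c R R' t s"
    by (rule half[where rel = rel, OF R \<Lambda> \<Lambda>']) (fact rel_R total2 rel_mult t s)+
  moreover have "semilinear_transfer c R' R s t"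
  proof (rule half[where rel = "\<lambda>r' r. rel r r'", OF R' \<Lambda>' \<Lambda>])
    show "\<exists>r'. rel r r'" if "r \<in> R" for r by (rule total1[OF that])
    show "r' \<in> R'" if "rel r r'" for r r' by (rule rel_R(2)[OF that])
  qed (fact rel_mult t s)+
  ultimately show ?thesis by blast
qed

section \<open>Power series over a C-algebra\<close>

locale complex_algebra =
  fixes A :: "'u calg" (structure)
  assumes calg: "calg A"
begin

lemma algebra_A: "algebra complex_ring A"
  using calg by (simp add: calg_def)

sublocale cring A
  using algebra_A by (rule algebra.M_cring)

abbreviation P :: "('u, nat \<Rightarrow> 'u) module" where
  "P \<equiv> pser A"

definition em :: "complex \<Rightarrow> 'u" where
  "em a = a \<odot> \<one>"

lemma em_closed [simp, intro]: "em a \<in> carrier A"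
  using module.smult_closed[OF algebra.module[OF algebra_A], of a \<one>]
  by (simp add: em_def complex_ring_def)

lemma em_add: "em (a + b) = em a \<oplus> em b"
  using module.smult_l_distr[OF algebra.module[OF algebra_A], of a b \<one>]
  by (simp add: em_def complex_ring_def)

lemma em_mult: "em (a * b) = em a \<otimes> em b"
proof -
  interpret C: algebra complex_ring A by (rule algebra_A)
  have "em a \<otimes> em b = a \<odot> (\<one> \<otimes> em b)"
    using C.smult_assoc2[of a \<one> "em b"] by (simp add: em_def[of a] complex_ring_def)
  also have "\<dots> = a \<odot> (b \<odot> \<one>)" by (simp add: em_def[of b, symmetric])
  also have "\<dots> = em (a * b)"
    using C.smult_assoc1[of a b \<one>] by (simp add: em_def complex_ring_def)
  finally show ?thesis ..
qed

lemma em_1 [simp]: "em 1 = \<one>"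
  using module.smult_one[OF algebra.module[OF algebra_A], of \<one>]
  by (simp add: em_def complex_ring_def)

lemma em_0 [simp]: "em 0 = \<zero>"
  using module.smult_l_null[OF algebra.module[OF algebra_A], of \<one>]
  by (simp add: em_def complex_ring_def)

lemma em_sum: "finite S \<Longrightarrow> em (sum f S) = (\<Oplus>i\<in>S. em (f i))"
  by (induction S rule: finite_induct) (simp_all add: em_add)

lemma pser_carrier: "f \<in> carrier P \<longleftrightarrow> (\<forall>n. f n \<in> carrier A)"
  by (auto simp: pser_def)

lemma pser_closed [simp, intro]: "f \<in> carrier P \<Longrightarrow> f n \<in> carrier A"
  by (simp add: pser_carrier)

lemma pser_mult: "(f \<otimes>\<^bsub>P\<^esub> g) n = (\<Oplus>i\<in>{..n}. f i \<otimes> g (n - i))"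
  by (simp add: pser_def)

lemma pser_one: "\<one>\<^bsub>P\<^esub> n = (if n = 0 then \<one> else \<zero>)"
  by (simp add: pser_def)

lemma pser_zero: "\<zero>\<^bsub>P\<^esub> n = \<zero>"
  by (simp add: pser_def)

lemma pser_add: "(f \<oplus>\<^bsub>P\<^esub> g) n = f n \<oplus> g n"
  by (simp add: pser_def)

lemma pser_smult: "(a \<odot>\<^bsub>P\<^esub> f) n = a \<otimes> f n"
  by (simp add: pser_def)

lemmas pser_simps = pser_one pser_zero pser_add pser_smult

text \<open>The coefficient of a product at n involves only coefficients up to n. Truncation at n
  therefore reduces associativity, commutativity and the unit law of the multiplication to those of
  the polynomial ring \<open>UP A\<close>.\<close>

lemma pser_cring: "cring P"
proof -
  let ?t = "\<lambda>n f i. if i \<le> n then f i else \<zero>"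
  have t: "?t n f \<in> carrier (UP A)" if "f \<in> carrier P" for n f
    using that by (auto simp: UP_def up_def intro!: exI[of _ n])
  have UPmult: "(p \<otimes>\<^bsub>UP A\<^esub> q) n = (\<Oplus>j\<in>{..n}. p j \<otimes> q (n - j))"
    if "p \<in> carrier (UP A)" "q \<in> carrier (UP A)" for p q n
    using that by (simp add: UP_def)
  have UPclosed: "p j \<in> carrier A" if "p \<in> carrier (UP A)" for p j
    using that by (auto simp: UP_def)
  interpret U: UP_cring A "UP A" by (intro UP_cring.intro is_cring)
  have mult: "(?t n f \<otimes>\<^bsub>UP A\<^esub> ?t n g) i = (f \<otimes>\<^bsub>P\<^esub> g) i"
    if "f \<in> carrier P" "g \<in> carrier P" "i \<le> n" for n i f g
  proof -
    have "(?t n f \<otimes>\<^bsub>UP A\<^esub> ?t n g) i = (\<Oplus>j\<in>{..i}. ?t n f j \<otimes> ?t n g (i - j))"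
      by (rule UPmult[OF t[OF that(1)] t[OF that(2)]])
    also have "\<dots> = (f \<otimes>\<^bsub>P\<^esub> g) i"
      unfolding pser_mult
    proof (rule finsum_cong'[OF refl])
      show "(\<lambda>j. f j \<otimes> g (i - j)) \<in> {..i} \<rightarrow> carrier A"
        using that by (intro funcsetI m_closed pser_closed)
      show "?t n f j \<otimes> ?t n g (i - j) = f j \<otimes> g (i - j)" if "j \<in> {..i}" for j
      proof -
        have "j \<le> n" "i - j \<le> n" using that \<open>i \<le> n\<close> by auto
        then show ?thesis by simp
      qed
    qed
    finally show ?thesis .
  qed
  have m_closed: "f \<otimes>\<^bsub>P\<^esub> g \<in> carrier P" if "f \<in> carrier P" "g \<in> carrier P" for f g
    unfolding pser_carrier pser_mult using that by (auto intro!: finsum_closed)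
  have m_assoc: "(f \<otimes>\<^bsub>P\<^esub> g) \<otimes>\<^bsub>P\<^esub> k = f \<otimes>\<^bsub>P\<^esub> (g \<otimes>\<^bsub>P\<^esub> k)"
    if fgk: "f \<in> carrier P" "g \<in> carrier P" "k \<in> carrier P" for f g k
  proof
    fix n
    note t = t[OF fgk(1), of n] t[OF fgk(2), of n] t[OF fgk(3), of n]
    have "((f \<otimes>\<^bsub>P\<^esub> g) \<otimes>\<^bsub>P\<^esub> k) n = (\<Oplus>j\<in>{..n}. (?t n f \<otimes>\<^bsub>UP A\<^esub> ?t n g) j \<otimes> ?t n k (n - j))"
      unfolding pser_mult[of _ k]
      by (rule finsum_cong') (use fgk mult[OF fgk(1,2), of _ n] UPclosed[OF U.P.m_closed[OF t(1,2)]] in auto)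
    also have "\<dots> = ((?t n f \<otimes>\<^bsub>UP A\<^esub> ?t n g) \<otimes>\<^bsub>UP A\<^esub> ?t n k) n"
      using t by (subst UPmult) auto
    also have "\<dots> = (?t n f \<otimes>\<^bsub>UP A\<^esub> (?t n g \<otimes>\<^bsub>UP A\<^esub> ?t n k)) n"
      using U.P.m_assoc[OF t] by simp
    also have "\<dots> = (\<Oplus>j\<in>{..n}. ?t n f j \<otimes> (?t n g \<otimes>\<^bsub>UP A\<^esub> ?t n k) (n - j))"
      using t by (subst UPmult) auto
    also have "\<dots> = (f \<otimes>\<^bsub>P\<^esub> (g \<otimes>\<^bsub>P\<^esub> k)) n"
      unfolding pser_mult[of f]
      by (rule finsum_cong') (use fgk m_closed[OF fgk(2,3)] mult[OF fgk(2,3), of _ n] in auto)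
    finally show "((f \<otimes>\<^bsub>P\<^esub> g) \<otimes>\<^bsub>P\<^esub> k) n = (f \<otimes>\<^bsub>P\<^esub> (g \<otimes>\<^bsub>P\<^esub> k)) n" .
  qed
  have m_comm: "f \<otimes>\<^bsub>P\<^esub> g = g \<otimes>\<^bsub>P\<^esub> f" if "f \<in> carrier P" "g \<in> carrier P" for f g
  proof
    fix n
    show "(f \<otimes>\<^bsub>P\<^esub> g) n = (g \<otimes>\<^bsub>P\<^esub> f) n"
      using mult[OF that, of n n] mult[OF that(2,1), of n n] U.P.m_comm[OF t[OF that(1), of n] t[OF that(2), of n]]
      by simp
  qed
  have l_one: "\<one>\<^bsub>P\<^esub> \<otimes>\<^bsub>P\<^esub> f = f" if f: "f \<in> carrier P" for f
  proof
    fix n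
    have one: "\<one>\<^bsub>P\<^esub> \<in> carrier P" by (simp add: pser_carrier pser_one)
    have "?t n \<one>\<^bsub>P\<^esub> = \<one>\<^bsub>UP A\<^esub>" by (rule ext) (simp add: pser_one UP_def)
    then show "(\<one>\<^bsub>P\<^esub> \<otimes>\<^bsub>P\<^esub> f) n = f n"
      using mult[OF one f, of n n] U.P.l_one[OF t[OF f, of n]] by simp
  qed
  have l_distr: "(f \<oplus>\<^bsub>P\<^esub> g) \<otimes>\<^bsub>P\<^esub> k = f \<otimes>\<^bsub>P\<^esub> k \<oplus>\<^bsub>P\<^esub> g \<otimes>\<^bsub>P\<^esub> k"
    if "f \<in> carrier P" "g \<in> carrier P" "k \<in> carrier P" for f g k
  proof
    fix n
    have "((f \<oplus>\<^bsub>P\<^esub> g) \<otimes>\<^bsub>P\<^esub> k) n = (\<Oplus>i\<in>{..n}. f i \<otimes> k (n - i) \<oplus> g i \<otimes> k (n - i))"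
      unfolding pser_mult pser_add by (rule finsum_cong') (use that in \<open>auto simp: l_distr\<close>)
    also have "\<dots> = (\<Oplus>i\<in>{..n}. f i \<otimes> k (n - i)) \<oplus> (\<Oplus>i\<in>{..n}. g i \<otimes> k (n - i))"
      by (rule finsum_addf) (use that in auto)
    finally show "((f \<oplus>\<^bsub>P\<^esub> g) \<otimes>\<^bsub>P\<^esub> k) n = (f \<otimes>\<^bsub>P\<^esub> k \<oplus>\<^bsub>P\<^esub> g \<otimes>\<^bsub>P\<^esub> k) n"
      by (simp add: pser_mult pser_add)
  qed
  have group: "abelian_group P"
  proof (rule abelian_groupI)
    fix f assume f: "f \<in> carrier P"
    show "\<exists>g\<in>carrier P. g \<oplus>\<^bsub>P\<^esub> f = \<zero>\<^bsub>P\<^esub>"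
      by (rule bexI[of _ "\<lambda>n. \<ominus> f n"]) (use f in \<open>auto simp: fun_eq_iff pser_add pser_zero pser_carrier l_neg\<close>)
  qed (auto simp: pser_carrier pser_add pser_zero fun_eq_iff a_assoc intro: a_comm)
  show ?thesis
    by (rule cringI[OF group comm_monoidI])
      (auto simp: m_closed m_assoc l_one l_distr intro: m_comm, simp_all add: pser_carrier pser_one)
qed

sublocale P: cring P
  by (rule pser_cring)

lemma pser_algebra: "algebra A P"
proof (rule algebraI[OF is_cring pser_cring])
  fix a f g assume a: "a \<in> carrier A" and f: "f \<in> carrier P" and g: "g \<in> carrier P"
  show "(a \<odot>\<^bsub>P\<^esub> f) \<otimes>\<^bsub>P\<^esub> g = a \<odot>\<^bsub>P\<^esub> (f \<otimes>\<^bsub>P\<^esub> g)"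
  proof
    fix n
    have "((a \<odot>\<^bsub>P\<^esub> f) \<otimes>\<^bsub>P\<^esub> g) n = (\<Oplus>i\<in>{..n}. a \<otimes> (f i \<otimes> g (n - i)))"
      unfolding pser_mult pser_smult by (rule finsum_cong') (use a f g in \<open>auto simp: m_assoc\<close>)
    also have "\<dots> = a \<otimes> (\<Oplus>i\<in>{..n}. f i \<otimes> g (n - i))"
      by (rule finsum_rdistr[symmetric]) (use a f g in auto)
    finally show "((a \<odot>\<^bsub>P\<^esub> f) \<otimes>\<^bsub>P\<^esub> g) n = (a \<odot>\<^bsub>P\<^esub> (f \<otimes>\<^bsub>P\<^esub> g)) n"
      by (simp add: pser_mult pser_smult)
  qed
qed (auto simp: pser_carrier pser_simps fun_eq_iff l_distr r_distr m_assoc)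

sublocale P: algebra A P
  by (rule pser_algebra)

lemma pser_uminus: "f \<in> carrier P \<Longrightarrow> (\<ominus>\<^bsub>P\<^esub> f) n = \<ominus> f n"
proof -
  assume f: "f \<in> carrier P"
  then have "(\<ominus>\<^bsub>P\<^esub> f \<oplus>\<^bsub>P\<^esub> f) n = \<zero>" by (simp add: P.l_neg pser_zero)
  with f show ?thesis using P.a_inv_closed[OF f] by (simp add: pser_add minus_equality)
qed

lemma pser_minus: "f \<in> carrier P \<Longrightarrow> g \<in> carrier P \<Longrightarrow> (f \<ominus>\<^bsub>P\<^esub> g) n = f n \<ominus> g n"
  by (simp add: a_minus_def pser_add pser_uminus)

lemma pser_finsum:
  "finite S \<Longrightarrow> (\<And>i. i \<in> S \<Longrightarrow> f i \<in> carrier P) \<Longrightarrow> (\<Oplus>\<^bsub>P\<^esub>i\<in>S. f i) n = (\<Oplus>i\<in>S. f i n)"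
proof (induction S rule: finite_induct)
  case (insert s S)
  then have "(\<Oplus>\<^bsub>P\<^esub>i\<in>insert s S. f i) = f s \<oplus>\<^bsub>P\<^esub> (\<Oplus>\<^bsub>P\<^esub>i\<in>S. f i)"
    by (intro P.finsum_insert) auto
  with insert show ?case by (simp add: pser_add)
qed (simp add: pser_zero)

lemma submodule_subset: "submodule H A P \<Longrightarrow> f \<in> H \<Longrightarrow> f \<in> carrier P"
  using P.submoduleE(1)[of H] by blast

lemma submodule_zero: "submodule H A P \<Longrightarrow> \<zero>\<^bsub>P\<^esub> \<in> H"
  using subgroup.one_closed[OF submodule.axioms(1), of H A P] by simp

lemmas submodule_add = P.submoduleE(5)
lemmas submodule_smult = P.submoduleE(4)

lemma submodule_minus: "submodule H A P \<Longrightarrow> f \<in> H \<Longrightarrow> g \<in> H \<Longrightarrow> f \<ominus>\<^bsub>P\<^esub> g \<in> H"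
  unfolding a_minus_def by (intro submodule_add P.submoduleE(3))

lemma pser_submoduleI:
  assumes "\<And>f. f \<in> H \<Longrightarrow> f \<in> carrier P" "\<zero>\<^bsub>P\<^esub> \<in> H" "\<And>f g. f \<in> H \<Longrightarrow> g \<in> H \<Longrightarrow> f \<oplus>\<^bsub>P\<^esub> g \<in> H"
    "\<And>a f. a \<in> carrier A \<Longrightarrow> f \<in> H \<Longrightarrow> a \<odot>\<^bsub>P\<^esub> f \<in> H"
  shows "submodule H A P"
proof (rule P.submoduleI)
  show "\<ominus>\<^bsub>P\<^esub> f \<in> H" if f: "f \<in> H" for f
  proof -
    have "(\<ominus> \<one>) \<odot>\<^bsub>P\<^esub> f = \<ominus>\<^bsub>P\<^esub> f"
      using assms(1)[OF f] by (simp add: P.smult_l_minus)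
    with assms(4)[OF _ f, of "\<ominus> \<one>"] show ?thesis by simp
  qed
qed (use assms in auto)

lemma submodule_add_left_iff:
  assumes "submodule H A P" "f \<in> carrier P" "g \<in> H"
  shows "f \<oplus>\<^bsub>P\<^esub> g \<in> H \<longleftrightarrow> f \<in> H"
proof
  assume "f \<oplus>\<^bsub>P\<^esub> g \<in> H"
  then have "(f \<oplus>\<^bsub>P\<^esub> g) \<ominus>\<^bsub>P\<^esub> g \<in> H" by (intro submodule_minus assms)
  moreover have "(f \<oplus>\<^bsub>P\<^esub> g) \<ominus>\<^bsub>P\<^esub> g = f"
    using assms submodule_subset[OF assms(1)] by (simp add: a_minus_def P.a_assoc P.r_neg)
  ultimately show "f \<in> H" by simp
qed (use assms submodule_add in blast)

lemma submodule_hull: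
  assumes "S \<subseteq> carrier P"
  shows "submodule ((\<lambda>H. submodule H A P) hull S) A P"
proof (rule pser_submoduleI)
  show "f \<in> carrier P" if "f \<in> (\<lambda>H. submodule H A P) hull S" for f
    using hull_minimal[OF assms, of "\<lambda>H. submodule H A P"] P.carrier_is_submodule that by blast
qed (auto simp: hull_def submodule_zero submodule_add submodule_smult)

section \<open>Powers of z in A[[z]]\<close>

lemma zpow_iff: "f \<in> zpow N A \<longleftrightarrow> f \<in> carrier P \<and> (\<forall>n<N. f n = \<zero>)"
  by (auto simp: zpow_def)

lemma zpow_carrier: "f \<in> zpow N A \<Longrightarrow> f \<in> carrier P"
  by (simp add: zpow_iff)

lemma zpow_submodule: "submodule (zpow N A) A P"
  by (rule pser_submoduleI) (auto simp: zpow_iff pser_simps pser_carrier)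

lemma zpow_0 [simp]: "zpow 0 A = carrier P"
  by (auto simp: zpow_iff)

lemma zpow_Suc_iff: "f \<in> zpow (Suc N) A \<longleftrightarrow> f \<in> zpow N A \<and> f N = \<zero>"
  by (auto simp: zpow_iff less_Suc_eq)

lemma zpow_mult_add:
  assumes "f \<in> zpow a A" "g \<in> zpow b A"
  shows "f \<otimes>\<^bsub>P\<^esub> g \<in> zpow (a + b) A"
  unfolding zpow_iff
proof (intro conjI allI impI)
  show "f \<otimes>\<^bsub>P\<^esub> g \<in> carrier P" using assms by (auto simp: zpow_iff)
  fix n assume n: "n < a + b"
  have "f i \<otimes> g (n - i) = \<zero>" if "i \<le> n" for i
  proof (cases "i < a")
    case False
    then have "n - i < b" using n that by simp
    with assms show ?thesis by (auto simp: zpow_iff)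
  qed (use assms in \<open>auto simp: zpow_iff\<close>)
  then have "(\<Oplus>i\<in>{..n}. f i \<otimes> g (n - i)) = (\<Oplus>i\<in>{..n}. \<zero>)"
    by (intro finsum_cong') auto
  then show "(f \<otimes>\<^bsub>P\<^esub> g) n = \<zero>" by (simp add: pser_mult)
qed

lemma zpow_mult_right: "f \<in> zpow a A \<Longrightarrow> g \<in> carrier P \<Longrightarrow> f \<otimes>\<^bsub>P\<^esub> g \<in> zpow a A"
  using zpow_mult_add[of f a g 0] by simp

lemma zpow_mult_left: "f \<in> zpow a A \<Longrightarrow> g \<in> carrier P \<Longrightarrow> g \<otimes>\<^bsub>P\<^esub> f \<in> zpow a A"
  using zpow_mult_right[of f a g] by (simp add: P.m_comm zpow_iff)

lemma pser_mult_leading: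
  assumes "f \<in> zpow a A" "g \<in> carrier P"
  shows "(f \<otimes>\<^bsub>P\<^esub> g) a = f a \<otimes> g 0"
proof -
  have "(f \<otimes>\<^bsub>P\<^esub> g) a = (\<Oplus>i\<in>{..a}. if a = i then f i \<otimes> g (a - i) else \<zero>)"
    unfolding pser_mult by (rule finsum_cong') (use assms in \<open>auto simp: zpow_iff\<close>)
  also have "\<dots> = f a \<otimes> g 0"
    using finsum_singleton[of a "{..a}" "\<lambda>i. f i \<otimes> g (a - i)"] assms by (auto simp: zpow_iff)
  finally show ?thesis .
qed

section \<open>Series with constant term 1\<close>

lemma U1_iff: "f \<in> U1 A \<longleftrightarrow> f \<in> carrier P \<and> f 0 = \<one>"
  by (simp add: U1_def)

lemma U1_carrier: "f \<in> U1 A \<Longrightarrow> f \<in> carrier P"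
  by (simp add: U1_iff)

lemma pser_mult_0: "f \<in> carrier P \<Longrightarrow> g \<in> carrier P \<Longrightarrow> (f \<otimes>\<^bsub>P\<^esub> g) 0 = f 0 \<otimes> g 0"
  by (simp add: pser_mult)

lemma U1_mult: "f \<in> U1 A \<Longrightarrow> g \<in> U1 A \<Longrightarrow> f \<otimes>\<^bsub>P\<^esub> g \<in> U1 A"
  by (simp add: U1_iff pser_mult_0)

lemma U1_one: "\<one>\<^bsub>P\<^esub> \<in> U1 A"
  by (simp add: U1_iff pser_one)

lemma one_minus_U1: "f \<in> U1 A \<Longrightarrow> \<one>\<^bsub>P\<^esub> \<ominus>\<^bsub>P\<^esub> f \<in> zpow 1 A"
  by (simp add: zpow_iff U1_iff pser_minus pser_one r_neg a_minus_def[of A])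

lemma pser_eqI: "(\<And>N. f \<ominus>\<^bsub>P\<^esub> g \<in> zpow N A) \<Longrightarrow> f \<in> carrier P \<Longrightarrow> g \<in> carrier P \<Longrightarrow> f = g"
proof
  fix n assume *: "\<And>N. f \<ominus>\<^bsub>P\<^esub> g \<in> zpow N A" "f \<in> carrier P" "g \<in> carrier P"
  from *(1)[of "Suc n"] have "f n \<ominus> g n = \<zero>"
    using *(2,3) by (simp add: zpow_iff pser_minus)
  with * show "f n = g n" by simp
qed

text \<open>\<open>G k\<close> is the partial sum 1 + v + ... + v^k of the geometric series for v =
  1 - f. As v has no constant term, the coefficient at n is final from \<open>G n\<close> on, so the
  inverse is read off the diagonal.\<close>

lemma U1_ex_inverse:
  assumes f: "f \<in> U1 A"
  shows "\<exists>g\<in>U1 A. f \<otimes>\<^bsub>P\<^esub> g = \<one>\<^bsub>P\<^esub>"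
proof -
  let ?v = "\<one>\<^bsub>P\<^esub> \<ominus>\<^bsub>P\<^esub> f"
  define G where "G = rec_nat \<one>\<^bsub>P\<^esub> (\<lambda>_ g. \<one>\<^bsub>P\<^esub> \<oplus>\<^bsub>P\<^esub> ?v \<otimes>\<^bsub>P\<^esub> g)"
  have G: "G 0 = \<one>\<^bsub>P\<^esub>" "G (Suc k) = \<one>\<^bsub>P\<^esub> \<oplus>\<^bsub>P\<^esub> ?v \<otimes>\<^bsub>P\<^esub> G k" for k
    by (simp_all add: G_def)
  have fc: "f \<in> carrier P" using f by (rule U1_carrier)
  have Gc: "G k \<in> carrier P" for k
    by (induction k) (use fc in \<open>simp_all add: G\<close>)
  have v: "?v \<in> zpow 1 A" using f by (rule one_minus_U1)
  have fG: "f \<otimes>\<^bsub>P\<^esub> G k \<ominus>\<^bsub>P\<^esub> \<one>\<^bsub>P\<^esub> \<in> zpow (Suc k) A" for k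
  proof (induction k)
    case 0
    have "f \<otimes>\<^bsub>P\<^esub> G 0 \<ominus>\<^bsub>P\<^esub> \<one>\<^bsub>P\<^esub> = \<ominus>\<^bsub>P\<^esub> ?v"
      using fc by (simp add: G a_minus_def P.minus_add P.a_comm)
    with v show ?case using P.submoduleE(3)[OF zpow_submodule] by simp
  next
    case (Suc k)
    have "f \<otimes>\<^bsub>P\<^esub> G (Suc k) \<ominus>\<^bsub>P\<^esub> \<one>\<^bsub>P\<^esub> = ?v \<otimes>\<^bsub>P\<^esub> (f \<otimes>\<^bsub>P\<^esub> G k \<ominus>\<^bsub>P\<^esub> \<one>\<^bsub>P\<^esub>)"
      unfolding G using fc Gc[of k] by algebra
    with zpow_mult_add[OF v Suc] show ?case by simp
  qed
  have step: "G (Suc k) \<ominus>\<^bsub>P\<^esub> G k \<in> zpow (Suc k) A" for k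
  proof (induction k)
    case 0
    have "G (Suc 0) \<ominus>\<^bsub>P\<^esub> G 0 = ?v" unfolding G using fc by algebra
    with v show ?case by simp
  next
    case (Suc k)
    have "G (Suc (Suc k)) \<ominus>\<^bsub>P\<^esub> G (Suc k) = ?v \<otimes>\<^bsub>P\<^esub> (G (Suc k) \<ominus>\<^bsub>P\<^esub> G k)"
      unfolding G(2)[of "Suc k"] unfolding G(2)[of k] using fc Gc[of k] by algebra
    with zpow_mult_add[OF v Suc] show ?case by simp
  qed
  have stable: "G k n = G n n" if "n \<le> k" for n k
    using that
  proof (induction k rule: dec_induct)
    case (step k)
    have "G (Suc k) n \<ominus> G k n = \<zero>"
      using \<open>\<And>k. G (Suc k) \<ominus>\<^bsub>P\<^esub> G k \<in> zpow (Suc k) A\<close>[of k] Gc[of k] Gc[of "Suc k"] step.hyps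
      by (auto simp: zpow_iff pser_minus)
    then have "G (Suc k) n = G k n" using Gc by simp
    with step.IH show ?case by simp
  qed simp
  define g where "g n = G n n" for n
  have gc: "g \<in> carrier P" using Gc by (simp add: g_def pser_carrier)
  have "f \<otimes>\<^bsub>P\<^esub> g = \<one>\<^bsub>P\<^esub>"
  proof
    fix n
    have "(f \<otimes>\<^bsub>P\<^esub> g) n = (f \<otimes>\<^bsub>P\<^esub> G n) n"
      unfolding pser_mult
    proof (rule finsum_cong'[OF refl])
      show "f i \<otimes> g (n - i) = f i \<otimes> G n (n - i)" if "i \<in> {..n}" for i
        unfolding g_def by (subst stable[of "n - i" n]) simp_all
    qed (use fc Gc in auto)
    moreover have "(f \<otimes>\<^bsub>P\<^esub> G n) n \<ominus> \<one>\<^bsub>P\<^esub> n = \<zero>"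
      using fG[of n] fc Gc[of n] by (auto simp: zpow_iff pser_minus)
    ultimately show "(f \<otimes>\<^bsub>P\<^esub> g) n = \<one>\<^bsub>P\<^esub> n" using fc Gc[of n] by simp
  qed
  moreover have "g \<in> U1 A" using gc by (simp add: U1_iff g_def G pser_one)
  ultimately show ?thesis by blast
qed

lemma U1_Units: "f \<in> U1 A \<Longrightarrow> f \<in> Units P"
proof -
  assume f: "f \<in> U1 A"
  then obtain g where "g \<in> U1 A" "f \<otimes>\<^bsub>P\<^esub> g = \<one>\<^bsub>P\<^esub>" using U1_ex_inverse by blast
  then show ?thesis
    using f unfolding Units_def mem_Collect_eq
    by (intro conjI bexI[of _ g]) (simp_all add: U1_carrier P.m_comm[of g f])
qed

lemma U1_inv: "f \<in> U1 A \<Longrightarrow> inv\<^bsub>P\<^esub> f \<in> U1 A"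
proof -
  assume f: "f \<in> U1 A"
  then obtain g where g: "g \<in> U1 A" "f \<otimes>\<^bsub>P\<^esub> g = \<one>\<^bsub>P\<^esub>" using U1_ex_inverse by blast
  then have "inv\<^bsub>P\<^esub> f = g" using f U1_carrier by (intro P.comm_inv_char) auto
  with g show ?thesis by simp
qed

end

section \<open>Extension of scalars\<close>

context complex_algebra
begin

definition emb :: "complex fps \<Rightarrow> nat \<Rightarrow> 'u" where
  "emb f = (\<lambda>n. em (fps_nth f n))"

lemma emb_nth: "emb f n = em (fps_nth f n)"
  by (simp add: emb_def)

lemma emb_closed [simp, intro]: "emb f \<in> carrier P"
  by (simp add: pser_carrier emb_nth)

lemma emb_add: "emb (f + g) = emb f \<oplus>\<^bsub>P\<^esub> emb g"
  by (simp add: fun_eq_iff emb_nth em_add pser_add)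

lemma emb_0: "emb 0 = \<zero>\<^bsub>P\<^esub>"
  by (simp add: fun_eq_iff emb_nth pser_zero)

lemma emb_1: "emb 1 = \<one>\<^bsub>P\<^esub>"
  by (simp add: fun_eq_iff emb_nth pser_one)

lemma emb_const_mult: "emb (fps_const a * f) = em a \<odot>\<^bsub>P\<^esub> emb f"
  by (simp add: fun_eq_iff emb_nth em_mult pser_smult)

lemma emb_mult: "emb (f * g) = emb f \<otimes>\<^bsub>P\<^esub> emb g"
proof
  fix n
  have "emb (f * g) n = (\<Oplus>i\<in>{..n}. em (fps_nth f i * fps_nth g (n - i)))"
    by (simp add: emb_nth fps_mult_nth em_sum atLeast0AtMost)
  also have "\<dots> = (emb f \<otimes>\<^bsub>P\<^esub> emb g) n"
    unfolding pser_mult by (rule finsum_cong') (auto simp: emb_nth em_mult)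
  finally show "emb (f * g) n = (emb f \<otimes>\<^bsub>P\<^esub> emb g) n" .
qed

lemma emb_minus: "emb (f - g) = emb f \<ominus>\<^bsub>P\<^esub> emb g"
proof -
  have "emb f = emb (f - g) \<oplus>\<^bsub>P\<^esub> emb g" by (simp flip: emb_add)
  moreover have "(emb (f - g) \<oplus>\<^bsub>P\<^esub> emb g) \<ominus>\<^bsub>P\<^esub> emb g = emb (f - g)"
    using emb_closed[of "f - g"] emb_closed[of g] by algebra
  ultimately show ?thesis by simp
qed

lemma emb_sum: "finite S \<Longrightarrow> emb (sum f S) = (\<Oplus>\<^bsub>P\<^esub>i\<in>S. emb (f i))"
  by (induction S rule: finite_induct) (simp_all add: emb_add emb_0)

lemma emb_zideal: "f \<in> zideal n \<Longrightarrow> emb f \<in> zpow n A"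
  by (simp add: zpow_iff zideal_def emb_nth)

lemma extend_scalars_eq: "extend_scalars N A M = (\<lambda>H. submodule H A P) hull (emb ` M \<union> zpow N A)"
proof -
  have "(\<lambda>f n. fps_nth f n \<odot> \<one>) ` M = emb ` M"
    by (intro image_cong refl) (simp add: fun_eq_iff emb_nth em_def)
  then show ?thesis by (simp only: extend_scalars_def)
qed

lemma ext_submodule: "submodule (extend_scalars N A M) A P"
  unfolding extend_scalars_eq by (rule submodule_hull) (auto simp: zpow_iff)

lemma ext_carrier: "f \<in> extend_scalars N A M \<Longrightarrow> f \<in> carrier P"
  by (rule submodule_subset[OF ext_submodule])

lemma emb_in_ext: "f \<in> M \<Longrightarrow> emb f \<in> extend_scalars N A M"
  unfolding extend_scalars_eq by (rule hull_inc) simp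

lemma zpow_in_ext: "f \<in> zpow N A \<Longrightarrow> f \<in> extend_scalars N A M"
  unfolding extend_scalars_eq by (rule hull_inc) simp

lemma ext_minimal:
  assumes "f \<in> extend_scalars N A M" "submodule H A P" "\<And>f. f \<in> M \<Longrightarrow> emb f \<in> H" "\<And>f. f \<in> zpow N A \<Longrightarrow> f \<in> H"
  shows "f \<in> H"
proof -
  have "extend_scalars N A M \<subseteq> H"
    unfolding extend_scalars_eq by (rule hull_minimal) (use assms in auto)
  with assms(1) show ?thesis by blast
qed

section \<open>Linear maps on A[[z]] and membership in extensions\<close>

definition linear_map :: "((nat \<Rightarrow> 'u) \<Rightarrow> nat \<Rightarrow> 'u) \<Rightarrow> bool" where
  "linear_map T \<longleftrightarrow> (\<forall>f\<in>carrier P. T f \<in> carrier P) \<and>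
     (\<forall>f\<in>carrier P. \<forall>g\<in>carrier P. T (f \<oplus>\<^bsub>P\<^esub> g) = T f \<oplus>\<^bsub>P\<^esub> T g) \<and>
     (\<forall>a\<in>carrier A. \<forall>f\<in>carrier P. T (a \<odot>\<^bsub>P\<^esub> f) = a \<odot>\<^bsub>P\<^esub> T f)"

lemma linear_mapD:
  assumes "linear_map T"
  shows "f \<in> carrier P \<Longrightarrow> T f \<in> carrier P"
    "f \<in> carrier P \<Longrightarrow> g \<in> carrier P \<Longrightarrow> T (f \<oplus>\<^bsub>P\<^esub> g) = T f \<oplus>\<^bsub>P\<^esub> T g"
    "a \<in> carrier A \<Longrightarrow> f \<in> carrier P \<Longrightarrow> T (a \<odot>\<^bsub>P\<^esub> f) = a \<odot>\<^bsub>P\<^esub> T f"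
  using assms by (auto simp: linear_map_def)

lemma linear_map_zero: "linear_map T \<Longrightarrow> T \<zero>\<^bsub>P\<^esub> = \<zero>\<^bsub>P\<^esub>"
  using linear_mapD(3)[of T \<zero> "\<zero>\<^bsub>P\<^esub>"] linear_mapD(1)[of T "\<zero>\<^bsub>P\<^esub>"] by simp

lemma linear_map_minus:
  assumes T: "linear_map T" and f: "f \<in> carrier P" and g: "g \<in> carrier P"
  shows "T (f \<ominus>\<^bsub>P\<^esub> g) = T f \<ominus>\<^bsub>P\<^esub> T g"
proof -
  have "(f \<ominus>\<^bsub>P\<^esub> g) \<oplus>\<^bsub>P\<^esub> g = f" using f g by algebra
  then have "T f = T (f \<ominus>\<^bsub>P\<^esub> g) \<oplus>\<^bsub>P\<^esub> T g"
    using linear_mapD(2)[OF T, of "f \<ominus>\<^bsub>P\<^esub> g" g] f g by simp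
  moreover have "(T (f \<ominus>\<^bsub>P\<^esub> g) \<oplus>\<^bsub>P\<^esub> T g) \<ominus>\<^bsub>P\<^esub> T g = T (f \<ominus>\<^bsub>P\<^esub> g)"
    using linear_mapD(1)[OF T, of "f \<ominus>\<^bsub>P\<^esub> g"] linear_mapD(1)[OF T g] f g by algebra
  ultimately show ?thesis by simp
qed

lemma linear_map_finsum:
  assumes T: "linear_map T"
  shows "finite S \<Longrightarrow> (\<And>i. i \<in> S \<Longrightarrow> f i \<in> carrier P) \<Longrightarrow> T (\<Oplus>\<^bsub>P\<^esub>i\<in>S. f i) = (\<Oplus>\<^bsub>P\<^esub>i\<in>S. T (f i))"
proof (induction S rule: finite_induct)
  case (insert s S)
  then have "(\<Oplus>\<^bsub>P\<^esub>i\<in>insert s S. f i) = f s \<oplus>\<^bsub>P\<^esub> (\<Oplus>\<^bsub>P\<^esub>i\<in>S. f i)"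
    "(\<Oplus>\<^bsub>P\<^esub>i\<in>insert s S. T (f i)) = T (f s) \<oplus>\<^bsub>P\<^esub> (\<Oplus>\<^bsub>P\<^esub>i\<in>S. T (f i))"
    using linear_mapD(1)[OF T] by (intro P.finsum_insert; auto)+
  with insert show ?case
    using linear_mapD(2)[OF T, of "f s" "\<Oplus>\<^bsub>P\<^esub>i\<in>S. f i"] by (simp add: P.finsum_closed Pi_def)
qed (simp add: linear_map_zero[OF T])

lemma linear_map_mult: "g \<in> carrier P \<Longrightarrow> linear_map (\<lambda>f. g \<otimes>\<^bsub>P\<^esub> f)"
  unfolding linear_map_def
  by (auto simp: P.r_distr P.m_comm[of g] P.smult_assoc2)

lemma linear_map_comp: "linear_map S \<Longrightarrow> linear_map T \<Longrightarrow> linear_map (\<lambda>f. S (T f))"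
  by (simp add: linear_map_def)

lemma linear_map_id: "linear_map (\<lambda>f. f)"
  by (simp add: linear_map_def)

lemma linear_map_diff:
  assumes S: "linear_map S" and T: "linear_map T"
  shows "linear_map (\<lambda>f. S f \<ominus>\<^bsub>P\<^esub> T f)"
  unfolding linear_map_def
proof (intro conjI ballI)
  fix f assume f: "f \<in> carrier P"
  note fST = linear_mapD(1)[OF S f] linear_mapD(1)[OF T f]
  show "S f \<ominus>\<^bsub>P\<^esub> T f \<in> carrier P" using fST by simp
  show "S (f \<oplus>\<^bsub>P\<^esub> g) \<ominus>\<^bsub>P\<^esub> T (f \<oplus>\<^bsub>P\<^esub> g) = S f \<ominus>\<^bsub>P\<^esub> T f \<oplus>\<^bsub>P\<^esub> (S g \<ominus>\<^bsub>P\<^esub> T g)" if g: "g \<in> carrier P" for g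
    unfolding linear_mapD(2)[OF S f g] linear_mapD(2)[OF T f g]
    using fST linear_mapD(1)[OF S g] linear_mapD(1)[OF T g] by algebra
next
  fix a f assume a: "a \<in> carrier A" and f: "f \<in> carrier P"
  note fST = linear_mapD(1)[OF S f] linear_mapD(1)[OF T f]
  show "S (a \<odot>\<^bsub>P\<^esub> f) \<ominus>\<^bsub>P\<^esub> T (a \<odot>\<^bsub>P\<^esub> f) = a \<odot>\<^bsub>P\<^esub> (S f \<ominus>\<^bsub>P\<^esub> T f)"
    unfolding linear_mapD(3)[OF S a f] linear_mapD(3)[OF T a f] a_minus_def
    using fST a by (simp add: P.smult_r_distr P.smult_r_minus)
qed

lemma submodule_preimage:
  assumes T: "linear_map T" and H: "submodule H A P"
  shows "submodule {f \<in> carrier P. T f \<in> H} A P"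
  by (rule pser_submoduleI)
    (auto simp: linear_mapD[OF T] linear_map_zero[OF T] submodule_zero[OF H] intro: submodule_add[OF H] submodule_smult[OF H])

text \<open>The induction principle by which facts over C reach A: a membership that is linear in f
  is checked on M itself and on z^N A[[z]].\<close>

lemma linear_map_ext:
  assumes T: "linear_map T" and H: "submodule H A P" and f: "f \<in> extend_scalars N A M"
    and M: "\<And>f. f \<in> M \<Longrightarrow> T (emb f) \<in> H" and z: "\<And>f. f \<in> zpow N A \<Longrightarrow> T f \<in> H"
  shows "T f \<in> H"
proof -
  have "f \<in> {f \<in> carrier P. T f \<in> H}"
    by (rule ext_minimal[OF f submodule_preimage[OF T H]]) (use M z in \<open>auto simp: zpow_iff\<close>)
  then show ?thesis by simp
qed

text \<open>The product is bilinear, so the induction principle is applied in f for constant r, and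
  then in r.\<close>

lemma ext_mult:
  assumes RM: "\<And>r f. r \<in> R \<Longrightarrow> f \<in> M \<Longrightarrow> r * f \<in> M"
    and r: "r \<in> extend_scalars N A R" and f: "f \<in> extend_scalars N A M"
  shows "r \<otimes>\<^bsub>P\<^esub> f \<in> extend_scalars N A M"
proof -
  let ?M = "extend_scalars N A M"
  have emb: "emb r \<otimes>\<^bsub>P\<^esub> f \<in> ?M" if r: "r \<in> R" for r
    by (rule linear_map_ext[OF linear_map_mult[OF emb_closed] ext_submodule f])
      (auto simp flip: emb_mult intro: emb_in_ext RM[OF r] zpow_in_ext zpow_mult_left)
  have "f \<otimes>\<^bsub>P\<^esub> r \<in> ?M"
    by (rule linear_map_ext[OF linear_map_mult[OF ext_carrier[OF f]] ext_submodule r])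
      (auto simp: P.m_comm[OF ext_carrier[OF f] emb_closed] ext_carrier[OF f] intro: emb zpow_in_ext zpow_mult_left[OF _ ext_carrier[OF f]])
  then show ?thesis using ext_carrier[OF f] ext_carrier[OF r] by (simp add: P.m_comm)
qed

text \<open>Over A one cannot argue with the order of f, because its leading coefficient may be a
  zero divisor. Instead the functional that annihilates M is extended to A, where it annihilates the
  extension of M. It vanishes at gaps other than t, and f vanishes at the orders of M below t, so
  the relation reduces to f t = 0.\<close>

lemma ext_nth_gap:
  assumes M: "fps_subspace M" and c: "zideal c \<subseteq> M" and f: "f \<in> extend_scalars c A M"
    and t: "t \<notin> val_semigroup M" and below: "\<And>k. k < t \<Longrightarrow> k \<in> val_semigroup M \<Longrightarrow> f k = \<zero>"
  shows "f t = \<zero>"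
proof -
  from annihilating_functional[OF M t] obtain l :: "nat \<Rightarrow> complex" where l: "l t = 1"
    "\<And>k. k \<notin> val_semigroup M \<Longrightarrow> k \<noteq> t \<Longrightarrow> l k = 0"
    "\<And>f. f \<in> M \<Longrightarrow> (\<Sum>k\<le>t. l k * fps_nth f k) = 0" by blast
  have tc: "t < c" using conductor_le_in_val_semigroup[OF c, of t] t by (cases "t < c") auto
  let ?H = "{f \<in> carrier P. (\<Oplus>k\<in>{..t}. em (l k) \<otimes> f k) = \<zero>}"
  have "f \<in> ?H"
  proof (rule ext_minimal[OF f])
    show "submodule ?H A P"
    proof (rule pser_submoduleI)
      fix f g assume fg: "f \<in> ?H" "g \<in> ?H"
      then have "(\<Oplus>k\<in>{..t}. em (l k) \<otimes> (f k \<oplus> g k)) = (\<Oplus>k\<in>{..t}. em (l k) \<otimes> f k \<oplus> em (l k) \<otimes> g k)"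
        by (intro finsum_cong') (auto simp: r_distr)
      also have "\<dots> = (\<Oplus>k\<in>{..t}. em (l k) \<otimes> f k) \<oplus> (\<Oplus>k\<in>{..t}. em (l k) \<otimes> g k)"
        using fg by (intro finsum_addf) auto
      finally show "f \<oplus>\<^bsub>P\<^esub> g \<in> ?H" using fg by (simp add: pser_add)
    next
      fix a f assume a: "a \<in> carrier A" and f: "f \<in> ?H"
      then have "(\<Oplus>k\<in>{..t}. em (l k) \<otimes> (a \<otimes> f k)) = (\<Oplus>k\<in>{..t}. a \<otimes> (em (l k) \<otimes> f k))"
        by (intro finsum_cong') (auto simp: m_lcomm)
      also have "\<dots> = a \<otimes> (\<Oplus>k\<in>{..t}. em (l k) \<otimes> f k)"
        using a f by (intro finsum_rdistr[symmetric]) auto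
      finally show "a \<odot>\<^bsub>P\<^esub> f \<in> ?H" using a f by (simp add: pser_smult)
    qed (auto simp: pser_zero)
    show "emb f \<in> ?H" if "f \<in> M" for f
    proof -
      have "(\<Oplus>k\<in>{..t}. em (l k) \<otimes> emb f k) = em (\<Sum>k\<le>t. l k * fps_nth f k)"
        by (subst em_sum) (auto simp: emb_nth em_mult intro!: finsum_cong')
      with l(3)[OF that] show ?thesis by simp
    qed
    show "f \<in> ?H" if "f \<in> zpow c A" for f
    proof -
      have "(\<Oplus>k\<in>{..t}. em (l k) \<otimes> f k) = (\<Oplus>k\<in>{..t}. \<zero>)"
        using that tc by (intro finsum_cong') (auto simp: zpow_iff)
      with that show ?thesis by (simp add: zpow_iff)
    qed
  qed
  then have "(\<Oplus>k\<in>{..t}. em (l k) \<otimes> f k) = \<zero>" by simp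
  moreover have "(\<Oplus>k\<in>{..t}. em (l k) \<otimes> f k) = (\<Oplus>k\<in>{..t}. if t = k then f k else \<zero>)"
  proof (rule finsum_cong'[OF refl])
    show "em (l k) \<otimes> f k = (if t = k then f k else \<zero>)" if "k \<in> {..t}" for k
    proof (cases "k = t")
      case True
      then show ?thesis using l(1) ext_carrier[OF f] by simp
    next
      case False
      with that have "k < t" by simp
      then have "l k = 0 \<or> f k = \<zero>" using l(2)[of k] below[of k] by auto
      with False ext_carrier[OF f] show ?thesis by auto
    qed
  qed (use ext_carrier[OF f] in auto)
  moreover have "\<dots> = f t"
    using finsum_singleton[of t "{..t}" f] ext_carrier[OF f] by auto
  ultimately show ?thesis by simp
qed

lemma ext_eq_zeroI:
  assumes "fps_subspace M" "zideal c \<subseteq> M" "f \<in> extend_scalars c A M"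
    and "\<And>k. k \<in> val_semigroup M \<Longrightarrow> f k = \<zero>"
  shows "f = \<zero>\<^bsub>P\<^esub>"
proof
  fix t
  show "f t = \<zero>\<^bsub>P\<^esub> t"
    using ext_nth_gap[OF assms(1-3), of t] assms(4) by (cases "t \<in> val_semigroup M") (auto simp: pser_zero)
qed

lemma ext_eqI:
  assumes M: "fps_subspace M" "zideal c \<subseteq> M" and f: "f \<in> extend_scalars c A M" and g: "g \<in> extend_scalars c A M"
    and eq: "\<And>k. k \<in> val_semigroup M \<Longrightarrow> f k = g k"
  shows "f = g"
proof -
  have fg: "f \<in> carrier P" "g \<in> carrier P" using f g by (auto dest: ext_carrier)
  have "f \<ominus>\<^bsub>P\<^esub> g = \<zero>\<^bsub>P\<^esub>"
  proof (rule ext_eq_zeroI[OF M])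
    show "(f \<ominus>\<^bsub>P\<^esub> g) k = \<zero>" if "k \<in> val_semigroup M" for k
      using fg eq[OF that] by (simp add: pser_minus r_neg a_minus_def[of A])
  qed (intro submodule_minus[OF ext_submodule] f g)
  then show ?thesis using fg by simp
qed

text \<open>Together with \<open>ext_eqI\<close> this makes the coefficients at the orders of M free
  coordinates on the extension. The pivots are elements of M over C with leading coefficient 1,
  hence usable over A; all coefficients from c on are then corrected at once by an element of z^c
  A[[z]].\<close>

lemma ext_ex_coordinates:
  assumes M: "fps_subspace M" and p: "\<And>k. p k \<in> carrier A"
  shows "\<exists>f\<in>extend_scalars c A M. \<forall>k\<in>val_semigroup M. f k = p k"
proof -
  let ?M = "extend_scalars c A M"
  have "\<exists>f\<in>?M. \<forall>k\<in>val_semigroup M. k < n \<longrightarrow> f k = p k" for n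
  proof (induction n)
    case 0
    show ?case using submodule_zero[OF ext_submodule] by blast
  next
    case (Suc n)
    then obtain f where f: "f \<in> ?M" "\<forall>k\<in>val_semigroup M. k < n \<longrightarrow> f k = p k" by blast
    have fc: "f \<in> carrier P" using f by (auto dest: ext_carrier)
    show ?case
    proof (cases "n \<in> val_semigroup M")
      case True
      then obtain g where g: "g \<in> M" "g \<in> zideal n" "fps_nth g n = 1"
        using val_semigroup_iff[OF M] by blast
      let ?f = "f \<oplus>\<^bsub>P\<^esub> (p n \<ominus> f n) \<odot>\<^bsub>P\<^esub> emb g"
      have "?f \<in> ?M"
        using f g p fc by (intro submodule_add[OF ext_submodule] submodule_smult[OF ext_submodule] emb_in_ext) auto
      moreover have "?f k = p k" if k: "k \<in> val_semigroup M" "k < Suc n" for k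
      proof (cases "k = n")
        case True
        have "f n \<oplus> (p n \<ominus> f n) = p n" using p[of n] pser_closed[OF fc, of n] by algebra
        then show ?thesis using True g p fc by (simp add: pser_add pser_smult emb_nth)
      next
        case False
        with k g have "fps_nth g k = 0" "k < n" by (auto simp: zideal_def)
        with f k show ?thesis using p fc by (simp add: pser_add pser_smult emb_nth)
      qed
      ultimately show ?thesis by blast
    next
      case False
      with f show ?thesis by (intro bexI[of _ f]) (auto simp: less_Suc_eq)
    qed
  qed
  from this[of c] obtain f where f: "f \<in> ?M" "\<forall>k\<in>val_semigroup M. k < c \<longrightarrow> f k = p k" by blast
  have fc: "f \<in> carrier P" using f by (auto dest: ext_carrier)
  let ?w = "\<lambda>k. if k < c then \<zero> else p k \<ominus> f k"
  have w: "?w \<in> zpow c A" using p fc by (auto simp: zpow_iff pser_carrier)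
  show ?thesis
  proof (intro bexI ballI)
    show "f \<oplus>\<^bsub>P\<^esub> ?w \<in> ?M" using f(1) zpow_in_ext[OF w] by (rule submodule_add[OF ext_submodule])
    fix k assume "k \<in> val_semigroup M"
    moreover have "f k \<oplus> (p k \<ominus> f k) = p k" using p[of k] pser_closed[OF fc, of k] by algebra
    ultimately show "(f \<oplus>\<^bsub>P\<^esub> ?w) k = p k" using f fc p[of k] by (simp add: pser_add)
  qed
qed

text \<open>Lets the induction principle reduce statements about all of A[[z]] to C[[z]].\<close>

lemma ext_UNIV: "extend_scalars c A UNIV = carrier P"
proof (intro equalityI subsetI)
  fix f assume f: "f \<in> carrier P"
  have sub: "fps_subspace UNIV" by (simp add: fps_subspace_def)
  have vs: "k \<in> val_semigroup UNIV" for k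
    using conductor_le_in_val_semigroup[of 0 UNIV k] by simp
  obtain g where "g \<in> extend_scalars c A UNIV" "\<forall>k\<in>val_semigroup UNIV. g k = f k"
    using ext_ex_coordinates[OF sub, of f c] f by blast
  moreover from this vs have "g = f" by blast
  ultimately show "f \<in> extend_scalars c A UNIV" by simp
qed (rule ext_carrier)

text \<open>A complement is given by the series supported on the gaps of M.\<close>

lemma ext_projective:
  assumes M: "fps_subspace M" and c: "zideal c \<subseteq> M"
  shows "projective_quotient A (extend_scalars c A M)"
  unfolding projective_quotient_def
proof (intro exI conjI)
  let ?M = "extend_scalars c A M" and ?L = "{f \<in> carrier P. \<forall>k\<in>val_semigroup M. f k = \<zero>}"
  show L: "submodule ?L A P" by (rule pser_submoduleI) (auto simp: pser_simps)
  show "?M \<inter> ?L = {\<zero>\<^bsub>P\<^esub>}"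
    using ext_eq_zeroI[OF M c] submodule_zero[OF ext_submodule] submodule_zero[OF L] by blast
  show "?M <+>\<^bsub>P\<^esub> ?L = carrier P"
  proof (intro equalityI subsetI)
    fix f assume f: "f \<in> carrier P"
    then obtain m where m: "m \<in> ?M" "\<forall>k\<in>val_semigroup M. m k = f k"
      using ext_ex_coordinates[OF M, of f c] by blast
    have mc: "m \<in> carrier P" using m by (auto dest: ext_carrier)
    have "f \<ominus>\<^bsub>P\<^esub> m \<in> ?L"
      using f mc m(2) by (auto simp: pser_minus r_neg a_minus_def[of A])
    moreover have "f = m \<oplus>\<^bsub>P\<^esub> (f \<ominus>\<^bsub>P\<^esub> m)" using f mc by algebra
    ultimately show "f \<in> ?M <+>\<^bsub>P\<^esub> ?L" using m unfolding set_add_def' by blast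
  qed (auto simp: set_add_def' dest: ext_carrier)
qed

text \<open>The monomials at the gaps remain a basis of the quotient;
  \<open>ext_ex_coordinates\<close> and \<open>ext_eqI\<close> take the place of division with
  remainder and of the comparison of orders.\<close>

lemma ext_free:
  assumes M: "fps_subspace M" and c: "zideal c \<subseteq> M"
  shows "free_quotient A (extend_scalars c A M) (card (- val_semigroup M))"
proof -
  let ?M = "extend_scalars c A M" and ?d = "card (- val_semigroup M)"
  obtain t where t: "bij_betw t {..<?d} (- val_semigroup M)"
    using ex_bij_betw_nat_finite[OF finite_gaps[OF c]] by (auto simp: atLeast0LessThan)
  have t_gap: "t i \<notin> val_semigroup M" if "i < ?d" for i
    using bij_betwE[OF t] that by auto
  have t_eq: "t i = t j \<longleftrightarrow> i = j" if "i < ?d" "j < ?d" for i j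
    using bij_betw_imp_inj_on[OF t] that by (auto simp: inj_on_def)
  define e where "e i k = (if k = t i then \<one> else \<zero>)" for i k
  have e: "e i \<in> carrier P" for i by (simp add: pser_carrier e_def)
  define comb where "comb a = (\<Oplus>\<^bsub>P\<^esub>i\<in>{..<?d}. a i \<odot>\<^bsub>P\<^esub> e i)" for a :: "nat \<Rightarrow> 'u"
  have comb_closed: "comb a \<in> carrier P" if "a \<in> {..<?d} \<rightarrow> carrier A" for a
    unfolding comb_def using that e by (intro P.finsum_closed) auto
  have comb_nth: "comb a k = (\<Oplus>i\<in>{..<?d}. a i \<otimes> e i k)" if "a \<in> {..<?d} \<rightarrow> carrier A" for a k
    unfolding comb_def using that e by (subst pser_finsum) (auto simp: pser_smult)
  have comb_t: "comb a (t j) = a j" if a: "a \<in> {..<?d} \<rightarrow> carrier A" and j: "j < ?d" for a j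
  proof -
    have "comb a (t j) = (\<Oplus>i\<in>{..<?d}. if j = i then a i else \<zero>)"
      unfolding comb_nth[OF a] by (rule finsum_cong') (use a j t_eq in \<open>auto simp: e_def Pi_iff\<close>)
    also have "\<dots> = a j" using finsum_singleton[of j "{..<?d}" a] a j by auto
    finally show ?thesis .
  qed
  have comb_vs: "comb a k = \<zero>" if a: "a \<in> {..<?d} \<rightarrow> carrier A" and k: "k \<in> val_semigroup M" for a k
  proof -
    have "comb a k = (\<Oplus>i\<in>{..<?d}. \<zero>)"
      unfolding comb_nth[OF a] by (rule finsum_cong') (use a k t_gap in \<open>auto simp: e_def Pi_iff\<close>)
    then show ?thesis by simp
  qed
  have "\<exists>!a. a \<in> {..<?d} \<rightarrow>\<^sub>E carrier A \<and> f \<ominus>\<^bsub>P\<^esub> comb a \<in> ?M" if f: "f \<in> carrier P" for f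
  proof (rule ex_ex1I)
    obtain m where m: "m \<in> ?M" "\<forall>k\<in>val_semigroup M. m k = f k"
      using ext_ex_coordinates[OF M, of f c] f by blast
    have mc: "m \<in> carrier P" using m by (auto dest: ext_carrier)
    define a where "a = restrict (\<lambda>i. (f \<ominus>\<^bsub>P\<^esub> m) (t i)) {..<?d}"
    have aE: "a \<in> {..<?d} \<rightarrow>\<^sub>E carrier A" using f mc by (auto simp: a_def)
    then have a: "a \<in> {..<?d} \<rightarrow> carrier A" by (simp add: PiE_def)
    have "comb a = f \<ominus>\<^bsub>P\<^esub> m"
    proof
      fix k
      show "comb a k = (f \<ominus>\<^bsub>P\<^esub> m) k"
      proof (cases "k \<in> val_semigroup M")
        case True
        then show ?thesis using comb_vs[OF a True] m f mc by (simp add: pser_minus r_neg a_minus_def[of A])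
      next
        case False
        then obtain j where "j < ?d" "k = t j"
          using t by (auto simp: bij_betw_def image_iff set_eq_iff)
        then show ?thesis using comb_t[OF a, of j] by (simp add: a_def)
      qed
    qed
    moreover have "f \<ominus>\<^bsub>P\<^esub> (f \<ominus>\<^bsub>P\<^esub> m) = m" using f mc by algebra
    ultimately show "\<exists>a. a \<in> {..<?d} \<rightarrow>\<^sub>E carrier A \<and> f \<ominus>\<^bsub>P\<^esub> comb a \<in> ?M" using aE m by auto
  next
    fix a b
    assume ab: "a \<in> {..<?d} \<rightarrow>\<^sub>E carrier A \<and> f \<ominus>\<^bsub>P\<^esub> comb a \<in> ?M" "b \<in> {..<?d} \<rightarrow>\<^sub>E carrier A \<and> f \<ominus>\<^bsub>P\<^esub> comb b \<in> ?M"
    then have a: "a \<in> {..<?d} \<rightarrow> carrier A" and b: "b \<in> {..<?d} \<rightarrow> carrier A" by (auto simp: PiE_def)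
    have "f \<ominus>\<^bsub>P\<^esub> comb a = f \<ominus>\<^bsub>P\<^esub> comb b"
      using ab f comb_closed[OF a] comb_closed[OF b] comb_vs[OF a] comb_vs[OF b]
      by (intro ext_eqI[OF M c]) (auto simp: pser_minus)
    moreover have "comb a = f \<ominus>\<^bsub>P\<^esub> (f \<ominus>\<^bsub>P\<^esub> comb a)" "comb b = f \<ominus>\<^bsub>P\<^esub> (f \<ominus>\<^bsub>P\<^esub> comb b)"
      using f comb_closed[OF a] comb_closed[OF b] by algebra+
    ultimately have eq: "comb a = comb b" by simp
    show "a = b"
      by (rule PiE_ext[of a "{..<?d}" "\<lambda>_. carrier A"]) (use ab comb_t[OF a] comb_t[OF b] eq in auto)
  qed
  then show ?thesis
    unfolding free_quotient_def comb_def using e by (intro bexI[of _ e]) auto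
qed

end

section \<open>Cosets of the unit group\<close>

context complex_algebra
begin

lemma pser_minus_split:
  "f \<in> carrier P \<Longrightarrow> g \<in> carrier P \<Longrightarrow> k \<in> carrier P \<Longrightarrow>
    g \<ominus>\<^bsub>P\<^esub> k = (f \<ominus>\<^bsub>P\<^esub> k) \<oplus>\<^bsub>P\<^esub> (g \<ominus>\<^bsub>P\<^esub> f)"
  by algebra

text \<open>\<open>iff\<close> and \<open>surj\<close> say that T induces an isomorphism of A[[z]]/M
  onto A[[z]]/M', so T carries over a complement of M and a basis of the quotient. T itself may have
  a kernel: in the application it kills z^c A[[z]].\<close>

lemma quotient_transfer:
  assumes T: "linear_map T" and M: "submodule M A P" and M': "submodule M' A P"
    and iff: "\<And>f. f \<in> carrier P \<Longrightarrow> T f \<in> M' \<longleftrightarrow> f \<in> M"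
    and surj: "\<And>g. g \<in> carrier P \<Longrightarrow> \<exists>f\<in>carrier P. g \<ominus>\<^bsub>P\<^esub> T f \<in> M'"
  shows projective_transfer: "projective_quotient A M \<Longrightarrow> projective_quotient A M'"
    and free_transfer: "free_quotient A M d \<Longrightarrow> free_quotient A M' d"
proof -
  note Tc = linear_mapD(1)[OF T]
  assume "projective_quotient A M"
  then obtain L where L: "submodule L A P" "M \<inter> L = {\<zero>\<^bsub>P\<^esub>}" "M <+>\<^bsub>P\<^esub> L = carrier P"
    by (auto simp: projective_quotient_def)
  note Lc = submodule_subset[OF L(1)]
  show "projective_quotient A M'"
    unfolding projective_quotient_def
  proof (intro exI conjI)
    show TL: "submodule (T ` L) A P"
    proof (rule pser_submoduleI)
      show "\<zero>\<^bsub>P\<^esub> \<in> T ` L"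
        using linear_map_zero[OF T] submodule_zero[OF L(1)] by (metis image_eqI)
      fix f g assume "f \<in> T ` L" "g \<in> T ` L"
      then obtain k l where "f = T k" "k \<in> L" "g = T l" "l \<in> L" by blast
      with Lc have "f \<oplus>\<^bsub>P\<^esub> g = T (k \<oplus>\<^bsub>P\<^esub> l)" "k \<oplus>\<^bsub>P\<^esub> l \<in> L"
        using linear_mapD(2)[OF T] submodule_add[OF L(1)] by auto
      then show "f \<oplus>\<^bsub>P\<^esub> g \<in> T ` L" by blast
    next
      fix a f assume "a \<in> carrier A" "f \<in> T ` L"
      then obtain k where "a \<in> carrier A" "f = T k" "k \<in> L" by blast
      with Lc have "a \<odot>\<^bsub>P\<^esub> f = T (a \<odot>\<^bsub>P\<^esub> k)" "a \<odot>\<^bsub>P\<^esub> k \<in> L"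
        using linear_mapD(3)[OF T] submodule_smult[OF L(1)] by auto
      then show "a \<odot>\<^bsub>P\<^esub> f \<in> T ` L" by blast
    qed (use Lc Tc in auto)
    show "M' \<inter> T ` L = {\<zero>\<^bsub>P\<^esub>}"
    proof
      show "M' \<inter> T ` L \<subseteq> {\<zero>\<^bsub>P\<^esub>}"
      proof
        fix f assume "f \<in> M' \<inter> T ` L"
        then obtain l where l: "f = T l" "l \<in> L" "T l \<in> M'" by blast
        with iff Lc have "l \<in> M \<inter> L" by blast
        with L(2) have "l = \<zero>\<^bsub>P\<^esub>" by blast
        with l linear_map_zero[OF T] show "f \<in> {\<zero>\<^bsub>P\<^esub>}" by simp
      qed
    qed (use submodule_zero[OF M'] submodule_zero[OF TL] in blast)
    show "M' <+>\<^bsub>P\<^esub> T ` L = carrier P"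
    proof (intro equalityI subsetI)
      fix g assume g: "g \<in> carrier P"
      then obtain f where f: "f \<in> carrier P" "g \<ominus>\<^bsub>P\<^esub> T f \<in> M'" using surj by blast
      then have "f \<in> M <+>\<^bsub>P\<^esub> L" using L(3) by simp
      then obtain m l where ml: "m \<in> M" "l \<in> L" "f = m \<oplus>\<^bsub>P\<^esub> l" by (auto simp: set_add_def')
      have c: "m \<in> carrier P" "l \<in> carrier P" using ml Lc submodule_subset[OF M] by auto
      have "T m \<in> M'" using iff[OF c(1)] ml by simp
      with f(2) have "(g \<ominus>\<^bsub>P\<^esub> T f) \<oplus>\<^bsub>P\<^esub> T m \<in> M'" by (rule submodule_add[OF M'])
      moreover have "g = ((g \<ominus>\<^bsub>P\<^esub> T f) \<oplus>\<^bsub>P\<^esub> T m) \<oplus>\<^bsub>P\<^esub> T l"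
        unfolding ml(3) linear_mapD(2)[OF T c] using g Tc[OF c(1)] Tc[OF c(2)] by algebra
      ultimately show "g \<in> M' <+>\<^bsub>P\<^esub> T ` L" using ml(2) unfolding set_add_def' by blast
    next
      fix g assume "g \<in> M' <+>\<^bsub>P\<^esub> T ` L"
      then show "g \<in> carrier P"
        using submodule_subset[OF M'] submodule_subset[OF TL] by (auto simp: set_add_def')
    qed
  qed
next
  note Tc = linear_mapD(1)[OF T]
  assume "free_quotient A M d"
  then obtain e where e: "e \<in> {..<d} \<rightarrow> carrier P" and
    ex1: "\<forall>f\<in>carrier P. \<exists>!a. a \<in> {..<d} \<rightarrow>\<^sub>E carrier A \<and> f \<ominus>\<^bsub>P\<^esub> (\<Oplus>\<^bsub>P\<^esub>i\<in>{..<d}. a i \<odot>\<^bsub>P\<^esub> e i) \<in> M"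
    unfolding free_quotient_def by (rule bexE)
  \<comment> \<open>For g congruent to T f, a coefficient vector a represents g modulo M' if and
    only if it represents f modulo M. Existence and uniqueness are thus transported
    together.\<close>
  have key: "(g \<ominus>\<^bsub>P\<^esub> (\<Oplus>\<^bsub>P\<^esub>i\<in>{..<d}. a i \<odot>\<^bsub>P\<^esub> T (e i)) \<in> M') = (f \<ominus>\<^bsub>P\<^esub> (\<Oplus>\<^bsub>P\<^esub>i\<in>{..<d}. a i \<odot>\<^bsub>P\<^esub> e i) \<in> M)"
    if f: "f \<in> carrier P" and g: "g \<in> carrier P" and fg: "g \<ominus>\<^bsub>P\<^esub> T f \<in> M'" and a: "a \<in> {..<d} \<rightarrow>\<^sub>E carrier A" for f g a
  proof -
    let ?s = "\<Oplus>\<^bsub>P\<^esub>i\<in>{..<d}. a i \<odot>\<^bsub>P\<^esub> e i"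
    have ae: "a i \<odot>\<^bsub>P\<^esub> e i \<in> carrier P" if "i \<in> {..<d}" for i
      using a e that by (intro P.smult_closed) auto
    have s: "?s \<in> carrier P" using ae by (intro P.finsum_closed) auto
    have "T ?s = (\<Oplus>\<^bsub>P\<^esub>i\<in>{..<d}. T (a i \<odot>\<^bsub>P\<^esub> e i))"
      by (rule linear_map_finsum[OF T finite_lessThan ae])
    also have "\<dots> = (\<Oplus>\<^bsub>P\<^esub>i\<in>{..<d}. a i \<odot>\<^bsub>P\<^esub> T (e i))"
    proof (rule P.finsum_cong'[OF refl])
      show "T (a i \<odot>\<^bsub>P\<^esub> e i) = a i \<odot>\<^bsub>P\<^esub> T (e i)" if "i \<in> {..<d}" for i
        using linear_mapD(3)[OF T] a e that by (auto simp: Pi_iff PiE_iff)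
      show "(\<lambda>i. a i \<odot>\<^bsub>P\<^esub> T (e i)) \<in> {..<d} \<rightarrow> carrier P"
        using a e Tc by (intro funcsetI P.smult_closed) (auto simp: Pi_iff PiE_iff)
    qed
    finally have Ts: "T ?s = (\<Oplus>\<^bsub>P\<^esub>i\<in>{..<d}. a i \<odot>\<^bsub>P\<^esub> T (e i))" .
    have "g \<ominus>\<^bsub>P\<^esub> T ?s = T (f \<ominus>\<^bsub>P\<^esub> ?s) \<oplus>\<^bsub>P\<^esub> (g \<ominus>\<^bsub>P\<^esub> T f)"
      unfolding linear_map_minus[OF T f s] by (rule pser_minus_split[OF Tc[OF f] g Tc[OF s]])
    then have "g \<ominus>\<^bsub>P\<^esub> T ?s \<in> M' \<longleftrightarrow> T (f \<ominus>\<^bsub>P\<^esub> ?s) \<in> M'"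
      using submodule_add_left_iff[OF M' Tc fg, of "f \<ominus>\<^bsub>P\<^esub> ?s"] f s by simp
    also have "\<dots> \<longleftrightarrow> f \<ominus>\<^bsub>P\<^esub> ?s \<in> M"
      by (rule iff) (use f s in simp)
    finally show ?thesis unfolding Ts .
  qed
  show "free_quotient A M' d"
    unfolding free_quotient_def
  proof (intro bexI ballI)
    show "(\<lambda>i. T (e i)) \<in> {..<d} \<rightarrow> carrier P" using e Tc by auto
    fix g assume g: "g \<in> carrier P"
    then obtain f where f: "f \<in> carrier P" "g \<ominus>\<^bsub>P\<^esub> T f \<in> M'" using surj by blast
    show "\<exists>!a. a \<in> {..<d} \<rightarrow>\<^sub>E carrier A \<and> g \<ominus>\<^bsub>P\<^esub> (\<Oplus>\<^bsub>P\<^esub>i\<in>{..<d}. a i \<odot>\<^bsub>P\<^esub> T (e i)) \<in> M'"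
      using bspec[OF ex1 f(1)] by (simp only: key[OF f(1) g f(2)] cong: conj_cong)
  qed
qed

text \<open>The exponent 0 is an order of R as well, but there the coefficient is 1.\<close>

definition normal_form :: "complex fps set \<Rightarrow> (nat \<Rightarrow> 'u) \<Rightarrow> bool" where
  "normal_form R f \<longleftrightarrow> f \<in> U1 A \<and> (\<forall>s\<in>val_semigroup R. 0 < s \<longrightarrow> f s = \<zero>)"

lemma l_coset_iff: "g \<in> f <#\<^bsub>P\<^esub> H \<longleftrightarrow> (\<exists>u\<in>H. g = f \<otimes>\<^bsub>P\<^esub> u)"
  by (auto simp: l_coset_def)

end

locale scalar_extension = complex_algebra +
  fixes R :: "complex fps set" and c :: nat
  assumes subalgebra: "C_subalgebra R" and conductor: "zideal c \<subseteq> R"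
begin

abbreviation RA :: "(nat \<Rightarrow> 'a) set" where
  "RA \<equiv> extend_scalars c A R"

abbreviation UR :: "(nat \<Rightarrow> 'a) set" where
  "UR \<equiv> U1 A \<inter> RA"

lemmas subspace = C_subalgebra_subspace[OF subalgebra]

lemma RA_one: "\<one>\<^bsub>P\<^esub> \<in> RA"
  using emb_in_ext[OF C_subalgebra_one[OF subalgebra]] by (simp add: emb_1)

lemma RA_mult: "r \<in> RA \<Longrightarrow> s \<in> RA \<Longrightarrow> r \<otimes>\<^bsub>P\<^esub> s \<in> RA"
  by (rule ext_mult[OF C_subalgebra_mult[OF subalgebra]])

lemma UR_one: "\<one>\<^bsub>P\<^esub> \<in> UR"
  using RA_one U1_one by simp

lemma UR_mult: "u \<in> UR \<Longrightarrow> v \<in> UR \<Longrightarrow> u \<otimes>\<^bsub>P\<^esub> v \<in> UR"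
  using RA_mult U1_mult by simp

text \<open>Newton-type iteration: if m approximates the inverse w of u to order k, then m + (1 - u m)
  does so to order k + 1.\<close>

lemma UR_inv:
  assumes u: "u \<in> UR"
  shows "inv\<^bsub>P\<^esub> u \<in> UR"
proof -
  let ?w = "inv\<^bsub>P\<^esub> u"
  have w: "?w \<in> U1 A" using u by (simp add: U1_inv)
  have wc: "?w \<in> carrier P" and uc: "u \<in> carrier P" using w u by (auto intro: U1_carrier)
  have uw: "u \<otimes>\<^bsub>P\<^esub> ?w = \<one>\<^bsub>P\<^esub>" using u by (intro P.Units_r_inv U1_Units) simp
  have "\<exists>m\<in>RA. ?w \<ominus>\<^bsub>P\<^esub> m \<in> zpow k A" for k
  proof (induction k)
    case 0
    show ?case using wc submodule_zero[OF ext_submodule] by (intro bexI[of _ "\<zero>\<^bsub>P\<^esub>"]) auto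
  next
    case (Suc k)
    then obtain m where m: "m \<in> RA" "?w \<ominus>\<^bsub>P\<^esub> m \<in> zpow k A" by blast
    have mc: "m \<in> carrier P" using m(1) by (rule ext_carrier)
    let ?m = "m \<oplus>\<^bsub>P\<^esub> (\<one>\<^bsub>P\<^esub> \<ominus>\<^bsub>P\<^esub> u \<otimes>\<^bsub>P\<^esub> m)"
    have "?m \<in> RA"
      using m u by (intro submodule_add[OF ext_submodule] submodule_minus[OF ext_submodule] RA_one RA_mult) auto
    moreover have "?w \<ominus>\<^bsub>P\<^esub> (m \<oplus>\<^bsub>P\<^esub> (u \<otimes>\<^bsub>P\<^esub> ?w \<ominus>\<^bsub>P\<^esub> u \<otimes>\<^bsub>P\<^esub> m)) = (\<one>\<^bsub>P\<^esub> \<ominus>\<^bsub>P\<^esub> u) \<otimes>\<^bsub>P\<^esub> (?w \<ominus>\<^bsub>P\<^esub> m)"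
      using wc mc uc by algebra
    then have "?w \<ominus>\<^bsub>P\<^esub> ?m = (\<one>\<^bsub>P\<^esub> \<ominus>\<^bsub>P\<^esub> u) \<otimes>\<^bsub>P\<^esub> (?w \<ominus>\<^bsub>P\<^esub> m)"
      unfolding uw .
    moreover have "\<dots> \<in> zpow (1 + k) A"
      using u by (intro zpow_mult_add one_minus_U1 m) simp
    ultimately show ?case by (intro bexI[of _ ?m]) simp_all
  qed
  then obtain m where m: "m \<in> RA" "?w \<ominus>\<^bsub>P\<^esub> m \<in> zpow c A" by blast
  have "m \<oplus>\<^bsub>P\<^esub> (?w \<ominus>\<^bsub>P\<^esub> m) \<in> RA"
    by (rule submodule_add[OF ext_submodule m(1) zpow_in_ext[OF m(2)]])
  moreover have "m \<oplus>\<^bsub>P\<^esub> (?w \<ominus>\<^bsub>P\<^esub> m) = ?w" using ext_carrier[OF m(1)] wc by algebra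
  ultimately show ?thesis using w by simp
qed

lemma coset_eq:
  assumes f: "f \<in> U1 A" and g: "g \<in> f <#\<^bsub>P\<^esub> UR"
  shows "g <#\<^bsub>P\<^esub> UR = f <#\<^bsub>P\<^esub> UR"
proof -
  obtain u where u: "u \<in> UR" "g = f \<otimes>\<^bsub>P\<^esub> u" using g by (auto simp: l_coset_iff)
  have c: "f \<in> carrier P" "u \<in> carrier P" "inv\<^bsub>P\<^esub> u \<in> carrier P"
    using f u UR_inv[OF u(1)] by (auto intro: U1_carrier)
  have uu: "u \<otimes>\<^bsub>P\<^esub> inv\<^bsub>P\<^esub> u = \<one>\<^bsub>P\<^esub>" using u by (intro P.Units_r_inv U1_Units) simp
  show ?thesis
  proof (intro equalityI subsetI)
    fix k assume "k \<in> g <#\<^bsub>P\<^esub> UR"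
    then obtain v where v: "v \<in> UR" "k = f \<otimes>\<^bsub>P\<^esub> u \<otimes>\<^bsub>P\<^esub> v" using u by (auto simp: l_coset_iff)
    then have "k = f \<otimes>\<^bsub>P\<^esub> (u \<otimes>\<^bsub>P\<^esub> v)" using c by (simp add: P.m_assoc U1_carrier)
    with UR_mult[OF u(1) v(1)] show "k \<in> f <#\<^bsub>P\<^esub> UR" by (auto simp: l_coset_iff)
  next
    fix k assume "k \<in> f <#\<^bsub>P\<^esub> UR"
    then obtain v where v: "v \<in> UR" "k = f \<otimes>\<^bsub>P\<^esub> v" by (auto simp: l_coset_iff)
    have vc: "v \<in> carrier P" using v by (auto intro: U1_carrier)
    have "k = f \<otimes>\<^bsub>P\<^esub> (u \<otimes>\<^bsub>P\<^esub> inv\<^bsub>P\<^esub> u) \<otimes>\<^bsub>P\<^esub> v" unfolding uu v(2) using c vc by simp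
    also have "\<dots> = g \<otimes>\<^bsub>P\<^esub> (inv\<^bsub>P\<^esub> u \<otimes>\<^bsub>P\<^esub> v)" unfolding u(2) using c vc by (simp add: P.m_assoc)
    finally show "k \<in> g <#\<^bsub>P\<^esub> UR" using UR_mult[OF UR_inv[OF u(1)] v(1)] by (auto simp: l_coset_iff)
  qed
qed

text \<open>Below c the coefficients at orders of R are cleared one at a time by units 1 - w with w
  in the extension of R. The tail from c on is then removed in one step: if q is the truncation of
  p, then q/p = 1 + (q - p)/p differs from 1 by an element of z^c A[[z]], hence is a unit of the
  extension of R.\<close>

lemma coset_ex_normal_form:
  assumes f: "f \<in> U1 A"
  shows "\<exists>g\<in>f <#\<^bsub>P\<^esub> UR. normal_form R g"
proof -
  have fc: "f \<in> carrier P" using f by (rule U1_carrier)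
  have "\<exists>u\<in>UR. \<forall>s\<in>val_semigroup R. 0 < s \<longrightarrow> s < n \<longrightarrow> (f \<otimes>\<^bsub>P\<^esub> u) s = \<zero>" for n
  proof (induction n)
    case 0
    show ?case using UR_one by (intro bexI[of _ "\<one>\<^bsub>P\<^esub>"]) auto
  next
    case (Suc n)
    then obtain u where u: "u \<in> UR" "\<forall>s\<in>val_semigroup R. 0 < s \<longrightarrow> s < n \<longrightarrow> (f \<otimes>\<^bsub>P\<^esub> u) s = \<zero>" by blast
    show ?case
    proof (cases "n \<in> val_semigroup R \<and> 0 < n")
      case False
      with u show ?thesis by (intro bexI[of _ u]) (auto simp: less_Suc_eq)
    next
      case True
      then obtain g where g: "g \<in> R" "g \<in> zideal n" "fps_nth g n = 1"
        using val_semigroup_iff[OF subspace] by blast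
      have uc: "u \<in> carrier P" using u by (auto intro: U1_carrier)
      let ?p = "f \<otimes>\<^bsub>P\<^esub> u"
      let ?w = "?p n \<odot>\<^bsub>P\<^esub> emb g"
      have pc: "?p \<in> carrier P" using fc uc by simp
      have w: "?w \<in> zpow n A" "?w \<in> RA"
        using emb_zideal[OF g(2)] emb_in_ext[OF g(1)] pc
        by (auto intro: submodule_smult[OF zpow_submodule] submodule_smult[OF ext_submodule])
      have wc: "?w \<in> carrier P" by (rule zpow_carrier[OF w(1)])
      have w0: "?w 0 = \<zero>" using w True by (simp add: zpow_iff)
      \<comment> \<open>Multiplying by 1 - w subtracts \<open>?w\<close> times \<open>?p\<close>.
        Since \<open>?p\<close> has constant term 1, this product has the coefficient of
        \<open>?w\<close> at n and none below n.\<close>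
      let ?v = "\<one>\<^bsub>P\<^esub> \<ominus>\<^bsub>P\<^esub> ?w"
      have v: "?v \<in> UR"
        using w0 wc w(2) RA_one by (auto simp: U1_iff pser_minus pser_one a_minus_def[of A] intro: submodule_minus[OF ext_submodule])
      have "f \<otimes>\<^bsub>P\<^esub> (u \<otimes>\<^bsub>P\<^esub> ?v) = ?p \<ominus>\<^bsub>P\<^esub> ?w \<otimes>\<^bsub>P\<^esub> ?p" using fc uc wc by algebra
      then have coeff: "(f \<otimes>\<^bsub>P\<^esub> (u \<otimes>\<^bsub>P\<^esub> ?v)) s = ?p s \<ominus> (?w \<otimes>\<^bsub>P\<^esub> ?p) s" for s
        using pc wc by (simp only: pser_minus P.m_closed)
      have p0: "?p 0 = \<one>" using U1_mult[of f u] f u by (simp add: U1_iff)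
      have "(?w \<otimes>\<^bsub>P\<^esub> ?p) n = ?p n"
        using pser_mult_leading[OF w(1) pc] p0 g pc by (simp add: pser_smult emb_nth)
      then have "(f \<otimes>\<^bsub>P\<^esub> (u \<otimes>\<^bsub>P\<^esub> ?v)) n = \<zero>"
        unfolding coeff using pc by (simp add: r_neg a_minus_def[of A])
      moreover have "(f \<otimes>\<^bsub>P\<^esub> (u \<otimes>\<^bsub>P\<^esub> ?v)) s = ?p s" if "s < n" for s
        unfolding coeff using zpow_mult_right[OF w(1) pc] that pc by (simp add: zpow_iff a_minus_def[of A])
      ultimately show ?thesis
        using UR_mult[OF u(1) v] u(2) by (intro bexI[of _ "u \<otimes>\<^bsub>P\<^esub> ?v"]) (auto simp: less_Suc_eq)
    qed
  qed
  from this[of c] obtain u where u: "u \<in> UR" "\<forall>s\<in>val_semigroup R. 0 < s \<longrightarrow> s < c \<longrightarrow> (f \<otimes>\<^bsub>P\<^esub> u) s = \<zero>" by blast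
  let ?p = "f \<otimes>\<^bsub>P\<^esub> u"
  have p: "?p \<in> U1 A" using U1_mult f u by simp
  have pc: "?p \<in> carrier P" and uc: "u \<in> carrier P" using p u by (auto intro: U1_carrier)
  \<comment> \<open>The disjunct k = 0 keeps the constant term 1 when c = 0.\<close>
  define q where "q k = (if k = 0 \<or> k < c then ?p k else \<zero>)" for k
  have qc: "q \<in> carrier P" using pc by (auto simp: pser_carrier q_def)
  have q: "q \<in> U1 A" using p qc by (simp add: U1_iff q_def)
  let ?v = "inv\<^bsub>P\<^esub> ?p \<otimes>\<^bsub>P\<^esub> q"
  have ip: "inv\<^bsub>P\<^esub> ?p \<in> carrier P" using U1_inv[OF p] by (rule U1_carrier)
  have ipp: "inv\<^bsub>P\<^esub> ?p \<otimes>\<^bsub>P\<^esub> ?p = \<one>\<^bsub>P\<^esub>" by (intro P.Units_l_inv U1_Units p)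
  have "q \<ominus>\<^bsub>P\<^esub> ?p \<in> zpow c A"
    using qc pc by (auto simp: zpow_iff pser_minus q_def r_neg a_minus_def[of A])
  then have "inv\<^bsub>P\<^esub> ?p \<otimes>\<^bsub>P\<^esub> (q \<ominus>\<^bsub>P\<^esub> ?p) \<in> RA"
    using ip by (intro zpow_in_ext zpow_mult_left)
  then have "\<one>\<^bsub>P\<^esub> \<oplus>\<^bsub>P\<^esub> inv\<^bsub>P\<^esub> ?p \<otimes>\<^bsub>P\<^esub> (q \<ominus>\<^bsub>P\<^esub> ?p) \<in> RA"
    by (intro submodule_add[OF ext_submodule] RA_one)
  moreover have "\<one>\<^bsub>P\<^esub> \<oplus>\<^bsub>P\<^esub> inv\<^bsub>P\<^esub> ?p \<otimes>\<^bsub>P\<^esub> (q \<ominus>\<^bsub>P\<^esub> ?p) = ?v"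
    unfolding ipp[symmetric] using ip pc qc by algebra
  ultimately have v: "?v \<in> UR" using U1_mult[OF U1_inv[OF p] q] by simp
  have "?p \<otimes>\<^bsub>P\<^esub> ?v = (inv\<^bsub>P\<^esub> ?p \<otimes>\<^bsub>P\<^esub> ?p) \<otimes>\<^bsub>P\<^esub> q" using ip pc qc by algebra
  also have "\<dots> = q" unfolding ipp using qc by simp
  finally have "q = f \<otimes>\<^bsub>P\<^esub> (u \<otimes>\<^bsub>P\<^esub> ?v)" using fc uc ip qc by (simp add: P.m_assoc)
  then have "q \<in> f <#\<^bsub>P\<^esub> UR" using UR_mult[OF u(1) v] by (auto simp: l_coset_iff)
  moreover have "normal_form R q" using q u(2) by (auto simp: normal_form_def q_def)
  ultimately show ?thesis by blast
qed

text \<open>The quotient u of the two representatives is shown to be 1 coefficient by coefficient.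
  At a positive order n of R the lowest term of (u - 1) f = g - f vanishes by normality; at a gap
  the coefficient of u - 1 vanishes because u - 1 lies in the extension of R and has no lower
  terms.\<close>

lemma normal_form_unique:
  assumes f: "normal_form R f" and g: "normal_form R g" "g \<in> f <#\<^bsub>P\<^esub> UR"
  shows "g = f"
proof -
  obtain u where u: "u \<in> UR" "g = f \<otimes>\<^bsub>P\<^esub> u" using g by (auto simp: l_coset_iff)
  have c: "f \<in> carrier P" "g \<in> carrier P" "u \<in> carrier P"
    using f g u by (auto simp: normal_form_def intro: U1_carrier)
  let ?w = "u \<ominus>\<^bsub>P\<^esub> \<one>\<^bsub>P\<^esub>"
  have wc: "?w \<in> carrier P" using c by simp
  have w: "?w \<in> RA" using u by (intro submodule_minus[OF ext_submodule] RA_one) simp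
  have f0: "f 0 = \<one>" "u 0 = \<one>" using f u by (auto simp: normal_form_def U1_iff)
  have gf: "g \<ominus>\<^bsub>P\<^esub> f = ?w \<otimes>\<^bsub>P\<^esub> f" unfolding u(2) using c by algebra
  have "?w \<in> zpow n A" for n
  proof (induction n)
    case (Suc n)
    have "?w n = \<zero>"
    proof (cases "n = 0")
      case True
      then show ?thesis using f0 c by (simp add: pser_minus pser_one r_neg a_minus_def[of A])
    next
      case n: False
      show ?thesis
      proof (cases "n \<in> val_semigroup R")
        case False
        then show ?thesis
          using ext_nth_gap[OF subspace conductor w] Suc by (simp add: zpow_iff)
      next
        case True
        have "(g \<ominus>\<^bsub>P\<^esub> f) n = \<zero>"
          using f g(1) n True c by (simp add: normal_form_def pser_minus a_minus_def[of A])
        with pser_mult_leading[OF Suc c(1)] show ?thesis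
          unfolding gf f0 using pser_closed[OF wc, of n] by simp
      qed
    qed
    with Suc show ?case by (simp add: zpow_Suc_iff)
  qed (use wc in simp)
  then have "u = \<one>\<^bsub>P\<^esub>" using c by (intro pser_eqI) simp_all
  with u c show ?thesis by simp
qed

definition coset_normal_form :: "(nat \<Rightarrow> 'a) set \<Rightarrow> nat \<Rightarrow> 'a" where
  "coset_normal_form \<Phi> = (THE f. f \<in> \<Phi> \<and> normal_form R f)"

lemma coset_normal_form_eq:
  assumes "normal_form R f"
  shows "coset_normal_form (f <#\<^bsub>P\<^esub> UR) = f"
  unfolding coset_normal_form_def
proof (rule the_equality)
  have "f \<in> f <#\<^bsub>P\<^esub> UR"
    using assms UR_one by (auto simp: l_coset_iff normal_form_def U1_carrier intro!: bexI[of _ "\<one>\<^bsub>P\<^esub>"])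
  with assms show "f \<in> f <#\<^bsub>P\<^esub> UR \<and> normal_form R f" by simp
qed (use normal_form_unique[OF assms] in blast)

end

section \<open>Transferring submodules\<close>

context complex_algebra
begin

text \<open>The same constant data t as in \<open>lin\<close>, extended linearly to coefficients in
  A.\<close>

definition linA :: "nat \<Rightarrow> (nat \<Rightarrow> complex fps) \<Rightarrow> (nat \<Rightarrow> 'u) \<Rightarrow> nat \<Rightarrow> 'u" where
  "linA c t f = (\<Oplus>\<^bsub>P\<^esub>k\<in>{..<c}. f k \<odot>\<^bsub>P\<^esub> emb (t k))"

lemma linA_linear: "linear_map (linA c t)"
  unfolding linear_map_def
proof (intro conjI ballI)
  fix f assume f: "f \<in> carrier P"
  show "linA c t f \<in> carrier P" unfolding linA_def using f by (intro P.finsum_closed) auto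
  show "linA c t (f \<oplus>\<^bsub>P\<^esub> g) = linA c t f \<oplus>\<^bsub>P\<^esub> linA c t g" if g: "g \<in> carrier P" for g
  proof -
    have "linA c t (f \<oplus>\<^bsub>P\<^esub> g) = (\<Oplus>\<^bsub>P\<^esub>k\<in>{..<c}. f k \<odot>\<^bsub>P\<^esub> emb (t k) \<oplus>\<^bsub>P\<^esub> g k \<odot>\<^bsub>P\<^esub> emb (t k))"
      unfolding linA_def using f g by (intro P.finsum_cong') (auto simp: pser_add P.smult_l_distr)
    also have "\<dots> = linA c t f \<oplus>\<^bsub>P\<^esub> linA c t g"
      unfolding linA_def using f g by (intro P.finsum_addf) auto
    finally show ?thesis .
  qed
next
  fix a f assume a: "a \<in> carrier A" and f: "f \<in> carrier P"
  have "linA c t (a \<odot>\<^bsub>P\<^esub> f) = (\<Oplus>\<^bsub>P\<^esub>k\<in>{..<c}. a \<odot>\<^bsub>P\<^esub> (f k \<odot>\<^bsub>P\<^esub> emb (t k)))"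
    unfolding linA_def using a f by (intro P.finsum_cong') (auto simp: pser_smult P.smult_assoc1)
  also have "\<dots> = a \<odot>\<^bsub>P\<^esub> linA c t f"
    unfolding linA_def using a f by (intro P.finsum_smult_ldistr[symmetric]) auto
  finally show "linA c t (a \<odot>\<^bsub>P\<^esub> f) = a \<odot>\<^bsub>P\<^esub> linA c t f" .
qed

lemmas linA_closed [simp, intro] = linear_mapD(1)[OF linA_linear]

lemma linA_emb: "linA c t (emb f) = emb (lin c t f)"
  unfolding linA_def lin_def by (simp add: emb_sum emb_const_mult emb_nth)

lemma linA_zpow: "f \<in> zpow c A \<Longrightarrow> linA c t f = \<zero>\<^bsub>P\<^esub>"
proof -
  assume f: "f \<in> zpow c A"
  have "linA c t f = (\<Oplus>\<^bsub>P\<^esub>k\<in>{..<c}. \<zero>\<^bsub>P\<^esub>)"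
    unfolding linA_def using f by (intro P.finsum_cong') (auto simp: zpow_iff)
  then show ?thesis by simp
qed

end

locale submodule_transfer = complex_algebra +
  fixes R R' :: "complex fps set" and c :: nat and t s :: "nat \<Rightarrow> complex fps"
  assumes subalg: "C_subalgebra R" "C_subalgebra R'"
    and cond: "zideal c \<subseteq> R" "zideal c \<subseteq> R'"
    and transfer: "semilinear_transfer c R R' t s" "semilinear_transfer c R' R s t"
begin

sublocale R: scalar_extension A R c
  by unfold_locales (fact subalg cond)+

sublocale R': scalar_extension A R' c
  by unfold_locales (fact subalg cond)+

text \<open>The hypotheses are symmetric in the two rings, so each result below is also available in
  the direction of \<open>bwd\<close>.\<close>

lemma flip: "submodule_transfer A R' R c s t"
  by unfold_locales (fact subalg cond transfer)+

abbreviation "fwd \<equiv> linA c t"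
abbreviation "bwd \<equiv> linA c s"

lemma fwd_RA:
  assumes f: "f \<in> R.RA"
  shows "fwd f \<in> R'.RA"
proof (rule linear_map_ext[OF linA_linear ext_submodule f])
  show "fwd (emb f) \<in> R'.RA" if "f \<in> R" for f
    using transfer(1) that by (simp add: linA_emb semilinear_transfer_def emb_in_ext)
  show "fwd f \<in> R'.RA" if "f \<in> zpow c A" for f
    using submodule_zero[OF ext_submodule] by (simp add: linA_zpow[OF that])
qed

text \<open>Both terms are linear in f and the claim holds on C[[z]] by assumption on t and s;
  A[[z]] is the extension of \<open>UNIV\<close>.\<close>

lemma fwd_bwd: "f \<in> carrier P \<Longrightarrow> fwd (bwd f) \<ominus>\<^bsub>P\<^esub> f \<in> R'.RA"
proof (rule linear_map_ext[where T = "\<lambda>f. fwd (bwd f) \<ominus>\<^bsub>P\<^esub> f" and N = c and M = UNIV])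
  show "linear_map (\<lambda>f. fwd (bwd f) \<ominus>\<^bsub>P\<^esub> f)"
    by (rule linear_map_diff[OF linear_map_comp[OF linA_linear linA_linear] linear_map_id])
  show "fwd (bwd (emb f)) \<ominus>\<^bsub>P\<^esub> emb f \<in> R'.RA" for f
    using transfer(1) by (simp add: linA_emb semilinear_transfer_def emb_in_ext flip: emb_minus)
  show "fwd (bwd f) \<ominus>\<^bsub>P\<^esub> f \<in> R'.RA" if f: "f \<in> zpow c A" for f
    using submodule_minus[OF ext_submodule submodule_zero[OF ext_submodule] zpow_in_ext[OF f]]
    by (simp add: linA_zpow[OF f] linear_map_zero[OF linA_linear])
qed (simp_all add: ext_submodule ext_UNIV)

lemma fwd_semilinear:
  assumes r': "r' \<in> R'"
  shows "\<exists>r\<in>R. \<forall>f\<in>carrier P. fwd (emb r \<otimes>\<^bsub>P\<^esub> f) \<ominus>\<^bsub>P\<^esub> emb r' \<otimes>\<^bsub>P\<^esub> fwd f \<in> R'.RA"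
proof -
  from transfer(1) r' obtain r where r: "r \<in> R" "\<And>f. lin c t (r * f) - r' * lin c t f \<in> R'"
    unfolding semilinear_transfer_def by blast
  have "fwd (emb r \<otimes>\<^bsub>P\<^esub> f) \<ominus>\<^bsub>P\<^esub> emb r' \<otimes>\<^bsub>P\<^esub> fwd f \<in> R'.RA" if f: "f \<in> carrier P" for f
  proof (rule linear_map_ext[where T = "\<lambda>f. fwd (emb r \<otimes>\<^bsub>P\<^esub> f) \<ominus>\<^bsub>P\<^esub> emb r' \<otimes>\<^bsub>P\<^esub> fwd f" and N = c and M = UNIV])
    show "linear_map (\<lambda>f. fwd (emb r \<otimes>\<^bsub>P\<^esub> f) \<ominus>\<^bsub>P\<^esub> emb r' \<otimes>\<^bsub>P\<^esub> fwd f)"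
      by (rule linear_map_diff[OF linear_map_comp[OF linA_linear linear_map_mult[OF emb_closed]]
            linear_map_comp[OF linear_map_mult[OF emb_closed] linA_linear]])
    show "fwd (emb r \<otimes>\<^bsub>P\<^esub> emb f) \<ominus>\<^bsub>P\<^esub> emb r' \<otimes>\<^bsub>P\<^esub> fwd (emb f) \<in> R'.RA" for f
      using r(2)[of f] by (simp add: linA_emb emb_in_ext flip: emb_minus emb_mult)
    show "fwd (emb r \<otimes>\<^bsub>P\<^esub> f) \<ominus>\<^bsub>P\<^esub> emb r' \<otimes>\<^bsub>P\<^esub> fwd f \<in> R'.RA" if f: "f \<in> zpow c A" for f
      using submodule_zero[OF ext_submodule]
      by (simp add: linA_zpow[OF f] linA_zpow[OF zpow_mult_left[OF f emb_closed]] a_minus_def)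
  qed (use f in \<open>simp_all add: ext_submodule ext_UNIV\<close>)
  with r(1) show ?thesis by blast
qed

section \<open>The transfer conjugated by a unit\<close>

definition twist :: "(nat \<Rightarrow> 'a) \<Rightarrow> (nat \<Rightarrow> 'a) \<Rightarrow> nat \<Rightarrow> 'a" where
  "twist \<phi> f = \<phi> \<otimes>\<^bsub>P\<^esub> fwd (inv\<^bsub>P\<^esub> \<phi> \<otimes>\<^bsub>P\<^esub> f)"

text \<open>With N = M divided by \<phi>, this is \<phi> (fwd(N) + R'.RA). The summand is there
  because \<open>fwd\<close> is meaningful only modulo R'.RA; it also puts \<phi> itself into the
  result.\<close>

definition transfer_module :: "(nat \<Rightarrow> 'a) \<Rightarrow> (nat \<Rightarrow> 'a) set \<Rightarrow> (nat \<Rightarrow> 'a) set" where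
  "transfer_module \<phi> M = {twist \<phi> f \<oplus>\<^bsub>P\<^esub> \<phi> \<otimes>\<^bsub>P\<^esub> r | f r. f \<in> M \<and> r \<in> R'.RA}"

lemma twist_linear:
  assumes "\<phi> \<in> U1 A"
  shows "linear_map (twist \<phi>)"
proof -
  have "linear_map (\<lambda>f. \<phi> \<otimes>\<^bsub>P\<^esub> fwd (inv\<^bsub>P\<^esub> \<phi> \<otimes>\<^bsub>P\<^esub> f))"
    by (rule linear_map_comp[OF linear_map_mult[OF U1_carrier[OF assms]]
          linear_map_comp[OF linA_linear linear_map_mult[OF U1_carrier[OF U1_inv[OF assms]]]]])
  then show ?thesis by (simp add: twist_def[abs_def])
qed

lemma transfer_moduleE:
  assumes "f \<in> transfer_module \<phi> M"
  obtains g r where "g \<in> M" "r \<in> R'.RA" "f = twist \<phi> g \<oplus>\<^bsub>P\<^esub> \<phi> \<otimes>\<^bsub>P\<^esub> r"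
  using assms unfolding transfer_module_def by blast

lemma transfer_moduleI: "g \<in> M \<Longrightarrow> r \<in> R'.RA \<Longrightarrow> twist \<phi> g \<oplus>\<^bsub>P\<^esub> \<phi> \<otimes>\<^bsub>P\<^esub> r \<in> transfer_module \<phi> M"
  unfolding transfer_module_def by blast

lemma transfer_module_submodule:
  assumes \<phi>: "\<phi> \<in> U1 A" and M: "submodule M A P"
  shows "submodule (transfer_module \<phi> M) A P"
proof (rule pser_submoduleI)
  note T = twist_linear[OF \<phi>] and \<phi>c = U1_carrier[OF \<phi>] and Mc = submodule_subset[OF M]
  show "f \<in> carrier P" if "f \<in> transfer_module \<phi> M" for f
    using that linear_mapD(1)[OF T] \<phi>c Mc ext_carrier by (elim transfer_moduleE) simp
  show "\<zero>\<^bsub>P\<^esub> \<in> transfer_module \<phi> M"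
    using transfer_moduleI[OF submodule_zero[OF M] submodule_zero[OF ext_submodule], of \<phi>] \<phi>c
    by (simp add: linear_map_zero[OF T])
  fix f g assume "f \<in> transfer_module \<phi> M" "g \<in> transfer_module \<phi> M"
  then obtain m r n q where f: "m \<in> M" "r \<in> R'.RA" "f = twist \<phi> m \<oplus>\<^bsub>P\<^esub> \<phi> \<otimes>\<^bsub>P\<^esub> r"
    and g: "n \<in> M" "q \<in> R'.RA" "g = twist \<phi> n \<oplus>\<^bsub>P\<^esub> \<phi> \<otimes>\<^bsub>P\<^esub> q" by (elim transfer_moduleE) blast
  have "f \<oplus>\<^bsub>P\<^esub> g = twist \<phi> (m \<oplus>\<^bsub>P\<^esub> n) \<oplus>\<^bsub>P\<^esub> \<phi> \<otimes>\<^bsub>P\<^esub> (r \<oplus>\<^bsub>P\<^esub> q)"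
    unfolding f g linear_mapD(2)[OF T Mc[OF f(1)] Mc[OF g(1)]]
    using linear_mapD(1)[OF T Mc[OF f(1)]] linear_mapD(1)[OF T Mc[OF g(1)]] \<phi>c ext_carrier[OF f(2)] ext_carrier[OF g(2)]
    by algebra
  with transfer_moduleI[OF submodule_add[OF M f(1) g(1)] submodule_add[OF ext_submodule f(2) g(2)]]
  show "f \<oplus>\<^bsub>P\<^esub> g \<in> transfer_module \<phi> M" by simp
next
  note T = twist_linear[OF \<phi>] and \<phi>c = U1_carrier[OF \<phi>] and Mc = submodule_subset[OF M]
  fix a f assume a: "a \<in> carrier A" and "f \<in> transfer_module \<phi> M"
  then obtain m r where f: "m \<in> M" "r \<in> R'.RA" "f = twist \<phi> m \<oplus>\<^bsub>P\<^esub> \<phi> \<otimes>\<^bsub>P\<^esub> r" by (elim transfer_moduleE) blast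
  have "a \<odot>\<^bsub>P\<^esub> f = twist \<phi> (a \<odot>\<^bsub>P\<^esub> m) \<oplus>\<^bsub>P\<^esub> \<phi> \<otimes>\<^bsub>P\<^esub> (a \<odot>\<^bsub>P\<^esub> r)"
    unfolding f linear_mapD(3)[OF T a Mc[OF f(1)]] linear_mapD(3)[OF linear_map_mult[OF \<phi>c] a ext_carrier[OF f(2)]]
    using linear_mapD(1)[OF T Mc[OF f(1)]] \<phi>c ext_carrier[OF f(2)] a by (simp add: P.smult_r_distr)
  with transfer_moduleI[OF submodule_smult[OF M a f(1)] submodule_smult[OF ext_submodule a f(2)]]
  show "a \<odot>\<^bsub>P\<^esub> f \<in> transfer_module \<phi> M" by simp
qed

lemma mult_RA_in_transfer_module:
  assumes \<phi>: "\<phi> \<in> U1 A" and M: "submodule M A P" and r: "r \<in> R'.RA"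
  shows "\<phi> \<otimes>\<^bsub>P\<^esub> r \<in> transfer_module \<phi> M"
  using transfer_moduleI[OF submodule_zero[OF M] r, of \<phi>] U1_carrier[OF \<phi>] ext_carrier[OF r]
  by (simp add: linear_map_zero[OF twist_linear[OF \<phi>]])

lemma twist_in_transfer_module:
  assumes \<phi>: "\<phi> \<in> U1 A" and M: "submodule M A P" and f: "f \<in> M"
  shows "twist \<phi> f \<in> transfer_module \<phi> M"
  using transfer_moduleI[OF f submodule_zero[OF ext_submodule], of \<phi>] U1_carrier[OF \<phi>]
    linear_mapD(1)[OF twist_linear[OF \<phi>] submodule_subset[OF M f]] by simp

lemma unit_cancel:
  assumes \<phi>: "\<phi> \<in> U1 A" and f: "f \<in> carrier P"
  shows "\<phi> \<otimes>\<^bsub>P\<^esub> (inv\<^bsub>P\<^esub> \<phi> \<otimes>\<^bsub>P\<^esub> f) = f" "inv\<^bsub>P\<^esub> \<phi> \<otimes>\<^bsub>P\<^esub> (\<phi> \<otimes>\<^bsub>P\<^esub> f) = f"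
proof -
  note u = P.Units_r_inv[OF U1_Units[OF \<phi>]] P.Units_l_inv[OF U1_Units[OF \<phi>]]
  note c = U1_carrier[OF \<phi>] U1_carrier[OF U1_inv[OF \<phi>]]
  show "\<phi> \<otimes>\<^bsub>P\<^esub> (inv\<^bsub>P\<^esub> \<phi> \<otimes>\<^bsub>P\<^esub> f) = f" "inv\<^bsub>P\<^esub> \<phi> \<otimes>\<^bsub>P\<^esub> (\<phi> \<otimes>\<^bsub>P\<^esub> f) = f"
    using c f u by (simp_all flip: P.m_assoc)
qed

text \<open>After cancellation of \<phi> this is \<open>fwd_bwd\<close> for the opposite
  direction.\<close>

lemma untwist_twist:
  assumes \<phi>: "\<phi> \<in> U1 A" and f: "f \<in> carrier P"
  shows "\<exists>r\<in>R.RA. submodule_transfer.twist A c s \<phi> (twist \<phi> f) = f \<oplus>\<^bsub>P\<^esub> \<phi> \<otimes>\<^bsub>P\<^esub> r"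
proof -
  interpret bk: submodule_transfer A R' R c s t by (rule flip)
  note c = U1_carrier[OF \<phi>] U1_carrier[OF U1_inv[OF \<phi>]]
  let ?n = "inv\<^bsub>P\<^esub> \<phi> \<otimes>\<^bsub>P\<^esub> f"
  have n: "?n \<in> carrier P" using c f by simp
  let ?r = "bwd (fwd ?n) \<ominus>\<^bsub>P\<^esub> ?n"
  have "bk.twist \<phi> (twist \<phi> f) = \<phi> \<otimes>\<^bsub>P\<^esub> bwd (fwd ?n)"
    unfolding bk.twist_def twist_def using n by (simp add: unit_cancel[OF \<phi>])
  also have "\<dots> = \<phi> \<otimes>\<^bsub>P\<^esub> ?n \<oplus>\<^bsub>P\<^esub> \<phi> \<otimes>\<^bsub>P\<^esub> ?r"
    using c(1) n linA_closed[OF linA_closed[OF n], of c s c t] by algebra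
  also have "\<phi> \<otimes>\<^bsub>P\<^esub> ?n = f" by (rule unit_cancel[OF \<phi> f])
  finally show ?thesis using bk.fwd_bwd[OF n] by blast
qed

text \<open>The opposite twist returns f up to an element of \<phi> R.RA, and \<open>\<phi>M\<close>
  places such elements in M.\<close>

lemma twist_in_transfer_module_iff:
  assumes \<phi>: "\<phi> \<in> U1 A" and M: "submodule M A P" and \<phi>M: "\<And>r. r \<in> R.RA \<Longrightarrow> \<phi> \<otimes>\<^bsub>P\<^esub> r \<in> M"
    and f: "f \<in> carrier P"
  shows "twist \<phi> f \<in> transfer_module \<phi> M \<longleftrightarrow> f \<in> M"
proof
  interpret bk: submodule_transfer A R' R c s t by (rule flip)
  assume "twist \<phi> f \<in> transfer_module \<phi> M"
  then obtain g r where gr: "g \<in> M" "r \<in> R'.RA" "twist \<phi> f = twist \<phi> g \<oplus>\<^bsub>P\<^esub> \<phi> \<otimes>\<^bsub>P\<^esub> r" by (rule transfer_moduleE)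
  have g: "g \<in> carrier P" using gr submodule_subset[OF M] by blast
  have r: "r \<in> carrier P" using gr by (rule_tac ext_carrier)
  note \<phi>c = U1_carrier[OF \<phi>]
  obtain r1 where r1: "r1 \<in> R.RA" "bk.twist \<phi> (twist \<phi> f) = f \<oplus>\<^bsub>P\<^esub> \<phi> \<otimes>\<^bsub>P\<^esub> r1" using untwist_twist[OF \<phi> f] by blast
  obtain r2 where r2: "r2 \<in> R.RA" "bk.twist \<phi> (twist \<phi> g) = g \<oplus>\<^bsub>P\<^esub> \<phi> \<otimes>\<^bsub>P\<^esub> r2" using untwist_twist[OF \<phi> g] by blast
  have "bk.twist \<phi> (\<phi> \<otimes>\<^bsub>P\<^esub> r) = \<phi> \<otimes>\<^bsub>P\<^esub> bwd r" by (simp add: bk.twist_def unit_cancel[OF \<phi> r])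
  moreover have "bk.twist \<phi> (twist \<phi> f) = bk.twist \<phi> (twist \<phi> g) \<oplus>\<^bsub>P\<^esub> bk.twist \<phi> (\<phi> \<otimes>\<^bsub>P\<^esub> r)"
    unfolding gr(3) using linear_mapD(1)[OF twist_linear[OF \<phi>] g] \<phi>c r
    by (intro linear_mapD(2)[OF bk.twist_linear[OF \<phi>]]) simp_all
  ultimately have "f \<oplus>\<^bsub>P\<^esub> \<phi> \<otimes>\<^bsub>P\<^esub> r1 = g \<oplus>\<^bsub>P\<^esub> \<phi> \<otimes>\<^bsub>P\<^esub> r2 \<oplus>\<^bsub>P\<^esub> \<phi> \<otimes>\<^bsub>P\<^esub> bwd r" using r1 r2 by simp
  moreover have "g \<oplus>\<^bsub>P\<^esub> \<phi> \<otimes>\<^bsub>P\<^esub> r2 \<oplus>\<^bsub>P\<^esub> \<phi> \<otimes>\<^bsub>P\<^esub> bwd r \<in> M"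
    by (intro submodule_add[OF M] \<phi>M bk.fwd_RA gr r2)
  ultimately show "f \<in> M"
    using submodule_add_left_iff[OF M f \<phi>M[OF r1(1)]] by simp
qed (rule twist_in_transfer_module[OF \<phi> M])

text \<open>The opposite twist of g is a preimage up to \<phi> R'.RA, which the transferred module
  contains.\<close>

lemma twist_surj:
  assumes \<phi>: "\<phi> \<in> U1 A" and M: "submodule M A P" and g: "g \<in> carrier P"
  shows "\<exists>f\<in>carrier P. g \<ominus>\<^bsub>P\<^esub> twist \<phi> f \<in> transfer_module \<phi> M"
proof -
  interpret bk: submodule_transfer A R' R c s t by (rule flip)
  obtain r where r: "r \<in> R'.RA" "twist \<phi> (bk.twist \<phi> g) = g \<oplus>\<^bsub>P\<^esub> \<phi> \<otimes>\<^bsub>P\<^esub> r" using bk.untwist_twist[OF \<phi> g] by blast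
  have "g \<ominus>\<^bsub>P\<^esub> twist \<phi> (bk.twist \<phi> g) = \<phi> \<otimes>\<^bsub>P\<^esub> (\<ominus>\<^bsub>P\<^esub> r)"
    unfolding r(2) using g U1_carrier[OF \<phi>] ext_carrier[OF r(1)] by algebra
  with mult_RA_in_transfer_module[OF \<phi> M P.submoduleE(3)[OF ext_submodule r(1)]]
  have "g \<ominus>\<^bsub>P\<^esub> twist \<phi> (bk.twist \<phi> g) \<in> transfer_module \<phi> M" by simp
  with linear_mapD(1)[OF bk.twist_linear[OF \<phi>] g] show ?thesis by blast
qed

text \<open>The round trip changes elements of M only by \<phi> R.RA, which M contains.\<close>

lemma transfer_module_inverse:
  assumes \<phi>: "\<phi> \<in> U1 A" and M: "submodule M A P" and \<phi>M: "\<And>r. r \<in> R.RA \<Longrightarrow> \<phi> \<otimes>\<^bsub>P\<^esub> r \<in> M"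
  shows "submodule_transfer.transfer_module A R c s \<phi> (transfer_module \<phi> M) = M"
proof -
  interpret bk: submodule_transfer A R' R c s t by (rule flip)
  note Mc = submodule_subset[OF M] and \<phi>c = U1_carrier[OF \<phi>]
  show ?thesis
  proof (intro equalityI subsetI)
    fix f assume "f \<in> bk.transfer_module \<phi> (transfer_module \<phi> M)"
    then obtain g q where g: "g \<in> transfer_module \<phi> M" "q \<in> R.RA" "f = bk.twist \<phi> g \<oplus>\<^bsub>P\<^esub> \<phi> \<otimes>\<^bsub>P\<^esub> q"
      by (rule bk.transfer_moduleE)
    from g(1) obtain m r where m: "m \<in> M" "r \<in> R'.RA" "g = twist \<phi> m \<oplus>\<^bsub>P\<^esub> \<phi> \<otimes>\<^bsub>P\<^esub> r" by (rule transfer_moduleE)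
    have mc: "m \<in> carrier P" "r \<in> carrier P" using m Mc ext_carrier by auto
    obtain r1 where r1: "r1 \<in> R.RA" "bk.twist \<phi> (twist \<phi> m) = m \<oplus>\<^bsub>P\<^esub> \<phi> \<otimes>\<^bsub>P\<^esub> r1" using untwist_twist[OF \<phi> mc(1)] by blast
    have "bk.twist \<phi> g = bk.twist \<phi> (twist \<phi> m) \<oplus>\<^bsub>P\<^esub> bk.twist \<phi> (\<phi> \<otimes>\<^bsub>P\<^esub> r)"
      unfolding m(3) using linear_mapD(1)[OF twist_linear[OF \<phi>] mc(1)] \<phi>c mc
      by (intro linear_mapD(2)[OF bk.twist_linear[OF \<phi>]]) simp_all
    also have "bk.twist \<phi> (\<phi> \<otimes>\<^bsub>P\<^esub> r) = \<phi> \<otimes>\<^bsub>P\<^esub> bwd r" by (simp add: bk.twist_def unit_cancel[OF \<phi> mc(2)])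
    finally have "f = m \<oplus>\<^bsub>P\<^esub> \<phi> \<otimes>\<^bsub>P\<^esub> r1 \<oplus>\<^bsub>P\<^esub> \<phi> \<otimes>\<^bsub>P\<^esub> bwd r \<oplus>\<^bsub>P\<^esub> \<phi> \<otimes>\<^bsub>P\<^esub> q" using g r1 by simp
    also have "\<dots> \<in> M" by (intro submodule_add[OF M] \<phi>M bk.fwd_RA m r1 g)
    finally show "f \<in> M" .
  next
    fix m assume m: "m \<in> M"
    obtain r where r: "r \<in> R.RA" "bk.twist \<phi> (twist \<phi> m) = m \<oplus>\<^bsub>P\<^esub> \<phi> \<otimes>\<^bsub>P\<^esub> r" using untwist_twist[OF \<phi> Mc[OF m]] by blast
    have "m = bk.twist \<phi> (twist \<phi> m) \<oplus>\<^bsub>P\<^esub> \<phi> \<otimes>\<^bsub>P\<^esub> (\<ominus>\<^bsub>P\<^esub> r)"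
      unfolding r(2) using Mc[OF m] \<phi>c ext_carrier[OF r(1)] by algebra
    also have "\<dots> \<in> bk.transfer_module \<phi> (transfer_module \<phi> M)"
      by (intro bk.transfer_moduleI twist_in_transfer_module[OF \<phi> M m] P.submoduleE(3)[OF ext_submodule r(1)])
    finally show "m \<in> bk.transfer_module \<phi> (transfer_module \<phi> M)" .
  qed
qed

text \<open>For r in R' there is r0 in R with fwd(r0 n) = r fwd(n) modulo R'.RA. So multiplication
  by r sends \<phi> fwd(n) to \<phi> fwd(r0 n) up to \<phi> R'.RA, and \<phi> r0 n stays in M if
  \<phi> n is in M. Such a partner r0 is provided over C; scalars in R'.RA are then reached by
  linearity.\<close>

lemma transfer_module_stable:
  assumes \<phi>: "\<phi> \<in> U1 A" and M: "submodule M A P" and RM: "\<And>r f. r \<in> R.RA \<Longrightarrow> f \<in> M \<Longrightarrow> r \<otimes>\<^bsub>P\<^esub> f \<in> M"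
    and r': "r' \<in> R'.RA" and f: "f \<in> transfer_module \<phi> M"
  shows "r' \<otimes>\<^bsub>P\<^esub> f \<in> transfer_module \<phi> M"
proof -
  let ?D = "transfer_module \<phi> M"
  note D = transfer_module_submodule[OF \<phi> M]
  note \<phi>c = U1_carrier[OF \<phi>] and ic = U1_carrier[OF U1_inv[OF \<phi>]]
  have fc: "f \<in> carrier P" using f by (rule submodule_subset[OF D])
  from f obtain m q where m: "m \<in> M" "q \<in> R'.RA" "f = twist \<phi> m \<oplus>\<^bsub>P\<^esub> \<phi> \<otimes>\<^bsub>P\<^esub> q" by (rule transfer_moduleE)
  have mc: "m \<in> carrier P" using m submodule_subset[OF M] by blast
  let ?n = "inv\<^bsub>P\<^esub> \<phi> \<otimes>\<^bsub>P\<^esub> m"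
  have nc: "?n \<in> carrier P" using ic mc by simp
  have "f \<otimes>\<^bsub>P\<^esub> r' \<in> ?D"
  proof (rule linear_map_ext[OF linear_map_mult[OF fc] D r'])
    fix w assume w: "w \<in> zpow c A"
    have wc: "w \<in> carrier P" using w by (rule zpow_carrier)
    have "f \<otimes>\<^bsub>P\<^esub> w = \<phi> \<otimes>\<^bsub>P\<^esub> (inv\<^bsub>P\<^esub> \<phi> \<otimes>\<^bsub>P\<^esub> (f \<otimes>\<^bsub>P\<^esub> w))" using fc wc by (simp add: unit_cancel[OF \<phi>])
    also have "\<dots> \<in> ?D"
      by (intro mult_RA_in_transfer_module[OF \<phi> M] zpow_in_ext zpow_mult_left w ic fc)
    finally show "f \<otimes>\<^bsub>P\<^esub> w \<in> ?D" .
  next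
    fix r assume "r \<in> R'"
    from fwd_semilinear[OF this] obtain r0 where r0: "r0 \<in> R"
      "\<And>f. f \<in> carrier P \<Longrightarrow> fwd (emb r0 \<otimes>\<^bsub>P\<^esub> f) \<ominus>\<^bsub>P\<^esub> emb r \<otimes>\<^bsub>P\<^esub> fwd f \<in> R'.RA" by blast
    let ?d = "fwd (emb r0 \<otimes>\<^bsub>P\<^esub> ?n) \<ominus>\<^bsub>P\<^esub> emb r \<otimes>\<^bsub>P\<^esub> fwd ?n"
    have "inv\<^bsub>P\<^esub> \<phi> \<otimes>\<^bsub>P\<^esub> (emb r0 \<otimes>\<^bsub>P\<^esub> m) = emb r0 \<otimes>\<^bsub>P\<^esub> ?n"
      using ic mc emb_closed[of r0] by algebra
    then have "twist \<phi> (emb r0 \<otimes>\<^bsub>P\<^esub> m) = \<phi> \<otimes>\<^bsub>P\<^esub> fwd (emb r0 \<otimes>\<^bsub>P\<^esub> ?n)" by (simp add: twist_def)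
    moreover have "f \<otimes>\<^bsub>P\<^esub> emb r = \<phi> \<otimes>\<^bsub>P\<^esub> fwd (emb r0 \<otimes>\<^bsub>P\<^esub> ?n) \<oplus>\<^bsub>P\<^esub> \<phi> \<otimes>\<^bsub>P\<^esub> (emb r \<otimes>\<^bsub>P\<^esub> q \<ominus>\<^bsub>P\<^esub> ?d)"
      unfolding m(3) twist_def
      using \<phi>c linA_closed[OF nc, of c t] linA_closed[OF P.m_closed[OF emb_closed[of r0] nc], of c t] emb_closed[of r] ext_carrier[OF m(2)]
      by algebra
    moreover have "emb r0 \<otimes>\<^bsub>P\<^esub> m \<in> M" using RM m r0 emb_in_ext by blast
    moreover have "emb r \<otimes>\<^bsub>P\<^esub> q \<ominus>\<^bsub>P\<^esub> ?d \<in> R'.RA"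
      using \<open>r \<in> R'\<close> by (intro submodule_minus[OF ext_submodule] R'.RA_mult emb_in_ext m r0 nc)
    ultimately show "f \<otimes>\<^bsub>P\<^esub> emb r \<in> ?D" using transfer_moduleI by metis
  qed
  then show ?thesis using fc ext_carrier[OF r'] by (simp add: P.m_comm)
qed

lemma transfer_module_projective:
  assumes "\<phi> \<in> U1 A" "submodule M A P" "\<And>r. r \<in> R.RA \<Longrightarrow> \<phi> \<otimes>\<^bsub>P\<^esub> r \<in> M" "projective_quotient A M"
  shows "projective_quotient A (transfer_module \<phi> M)"
  by (rule projective_transfer[OF twist_linear[OF assms(1)] assms(2) transfer_module_submodule[OF assms(1,2)]
        twist_in_transfer_module_iff[OF assms(1-3)] twist_surj[OF assms(1,2)] assms(4)])

lemma transfer_module_free: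
  assumes "\<phi> \<in> U1 A" "submodule M A P" "\<And>r. r \<in> R.RA \<Longrightarrow> \<phi> \<otimes>\<^bsub>P\<^esub> r \<in> M" "free_quotient A M d"
  shows "free_quotient A (transfer_module \<phi> M) d"
  by (rule free_transfer[OF twist_linear[OF assms(1)] assms(2) transfer_module_submodule[OF assms(1,2)]
        twist_in_transfer_module_iff[OF assms(1-3)] twist_surj[OF assms(1,2)] assms(4)])

end

section \<open>Base change\<close>

locale complex_algebra_hom = A: complex_algebra A + B: complex_algebra B
  for A B :: "'u calg" and h :: "'u \<Rightarrow> 'u" +
  assumes h: "h \<in> calg_hom A B"
begin

sublocale ring_hom_cring A B h
  by unfold_locales (use h in \<open>simp add: calg_hom_def\<close>)

lemma h_em: "h (A.em a) = B.em a"
  using h by (simp add: calg_hom_def A.em_def B.em_def)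

lemma push_closed [simp, intro]: "f \<in> carrier A.P \<Longrightarrow> h \<circ> f \<in> carrier B.P"
  by (simp add: A.pser_carrier B.pser_carrier)

lemma push_add:
  "f \<in> carrier A.P \<Longrightarrow> g \<in> carrier A.P \<Longrightarrow> h \<circ> (f \<oplus>\<^bsub>A.P\<^esub> g) = (h \<circ> f) \<oplus>\<^bsub>B.P\<^esub> (h \<circ> g)"
  by (simp add: fun_eq_iff A.pser_add B.pser_add)

lemma push_mult:
  assumes "f \<in> carrier A.P" "g \<in> carrier A.P"
  shows "h \<circ> (f \<otimes>\<^bsub>A.P\<^esub> g) = (h \<circ> f) \<otimes>\<^bsub>B.P\<^esub> (h \<circ> g)"
proof
  fix n
  have "h (\<Oplus>\<^bsub>A\<^esub>i\<in>{..n}. f i \<otimes>\<^bsub>A\<^esub> g (n - i)) = (\<Oplus>\<^bsub>B\<^esub>i\<in>{..n}. (h \<circ> (\<lambda>i. f i \<otimes>\<^bsub>A\<^esub> g (n - i))) i)"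
    by (rule hom_finsum) (use assms in auto)
  also have "\<dots> = (\<Oplus>\<^bsub>B\<^esub>i\<in>{..n}. h (f i) \<otimes>\<^bsub>B\<^esub> h (g (n - i)))"
    by (rule B.finsum_cong') (use assms in auto)
  finally show "(h \<circ> (f \<otimes>\<^bsub>A.P\<^esub> g)) n = ((h \<circ> f) \<otimes>\<^bsub>B.P\<^esub> (h \<circ> g)) n"
    by (simp add: A.pser_mult B.pser_mult)
qed

lemma push_one: "h \<circ> \<one>\<^bsub>A.P\<^esub> = \<one>\<^bsub>B.P\<^esub>"
  by (simp add: fun_eq_iff A.pser_one B.pser_one)

lemma push_zero: "h \<circ> \<zero>\<^bsub>A.P\<^esub> = \<zero>\<^bsub>B.P\<^esub>"
  by (simp add: fun_eq_iff A.pser_zero B.pser_zero)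

lemma push_smult:
  "a \<in> carrier A \<Longrightarrow> f \<in> carrier A.P \<Longrightarrow> h \<circ> (a \<odot>\<^bsub>A.P\<^esub> f) = h a \<odot>\<^bsub>B.P\<^esub> (h \<circ> f)"
  by (simp add: fun_eq_iff A.pser_smult B.pser_smult)

lemma push_emb: "h \<circ> A.emb f = B.emb f"
  by (simp add: fun_eq_iff A.emb_nth B.emb_nth h_em)

lemma push_zpow: "f \<in> zpow N A \<Longrightarrow> h \<circ> f \<in> zpow N B"
  by (simp add: A.zpow_iff B.zpow_iff A.pser_carrier B.pser_carrier)

lemma push_U1: "f \<in> U1 A \<Longrightarrow> h \<circ> f \<in> U1 B"
  by (simp add: A.U1_iff B.U1_iff A.pser_carrier B.pser_carrier)

lemma push_inv:
  assumes f: "f \<in> U1 A"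
  shows "h \<circ> inv\<^bsub>A.P\<^esub> f = inv\<^bsub>B.P\<^esub> (h \<circ> f)"
proof (rule B.P.comm_inv_char[symmetric])
  have "(h \<circ> f) \<otimes>\<^bsub>B.P\<^esub> (h \<circ> inv\<^bsub>A.P\<^esub> f) = h \<circ> (f \<otimes>\<^bsub>A.P\<^esub> inv\<^bsub>A.P\<^esub> f)"
    by (rule push_mult[symmetric]) (use A.U1_carrier[OF f] A.U1_carrier[OF A.U1_inv[OF f]] in auto)
  then show "(h \<circ> f) \<otimes>\<^bsub>B.P\<^esub> (h \<circ> inv\<^bsub>A.P\<^esub> f) = \<one>\<^bsub>B.P\<^esub>"
    by (simp add: A.P.Units_r_inv[OF A.U1_Units[OF f]] push_one)
qed (use A.U1_carrier[OF f] A.U1_carrier[OF A.U1_inv[OF f]] in auto)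

lemma push_finsum:
  "finite S \<Longrightarrow> (\<And>i. i \<in> S \<Longrightarrow> f i \<in> carrier A.P) \<Longrightarrow>
    h \<circ> (\<Oplus>\<^bsub>A.P\<^esub>i\<in>S. f i) = (\<Oplus>\<^bsub>B.P\<^esub>i\<in>S. h \<circ> f i)"
proof (induction S rule: finite_induct)
  case (insert s S)
  have A: "(\<Oplus>\<^bsub>A.P\<^esub>i\<in>insert s S. f i) = f s \<oplus>\<^bsub>A.P\<^esub> (\<Oplus>\<^bsub>A.P\<^esub>i\<in>S. f i)"
    using insert by (intro A.P.finsum_insert) auto
  have B: "(\<Oplus>\<^bsub>B.P\<^esub>i\<in>insert s S. h \<circ> f i) = (h \<circ> f s) \<oplus>\<^bsub>B.P\<^esub> (\<Oplus>\<^bsub>B.P\<^esub>i\<in>S. h \<circ> f i)"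
    using insert by (intro B.P.finsum_insert) auto
  have "(\<Oplus>\<^bsub>A.P\<^esub>i\<in>S. f i) \<in> carrier A.P" using insert by (intro A.P.finsum_closed) auto
  then have "h \<circ> (f s \<oplus>\<^bsub>A.P\<^esub> (\<Oplus>\<^bsub>A.P\<^esub>i\<in>S. f i)) = (h \<circ> f s) \<oplus>\<^bsub>B.P\<^esub> (h \<circ> (\<Oplus>\<^bsub>A.P\<^esub>i\<in>S. f i))"
    using insert by (intro push_add) auto
  also have "h \<circ> (\<Oplus>\<^bsub>A.P\<^esub>i\<in>S. f i) = (\<Oplus>\<^bsub>B.P\<^esub>i\<in>S. h \<circ> f i)"
    using insert by blast
  finally show ?case unfolding A B .
qed (simp add: push_zero)

lemma push_linA:
  assumes "f \<in> carrier A.P"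
  shows "h \<circ> A.linA c t f = B.linA c t (h \<circ> f)"
  unfolding A.linA_def B.linA_def using assms
  by (subst push_finsum) (auto simp: push_smult push_emb intro!: B.P.finsum_cong')

lemma push_preimage:
  assumes H: "submodule H B B.P"
  shows "submodule {f \<in> carrier A.P. h \<circ> f \<in> H} A A.P"
  by (rule A.pser_submoduleI)
    (auto simp: push_add push_zero push_smult B.submodule_zero[OF H] intro: B.submodule_add[OF H] B.submodule_smult[OF H])

lemma base_change_eq: "base_change N B h M = (\<lambda>H. submodule H B B.P) hull ((\<lambda>f. h \<circ> f) ` M \<union> zpow N B)"
  by (simp add: base_change_def)

lemma base_change_submodule: "submodule M A A.P \<Longrightarrow> submodule (base_change N B h M) B B.P"
  unfolding base_change_eq
  by (rule B.submodule_hull) (auto simp: B.zpow_iff dest: A.submodule_subset)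

lemma push_in_base_change: "f \<in> M \<Longrightarrow> h \<circ> f \<in> base_change N B h M"
  unfolding base_change_eq by (rule hull_inc) simp

lemma zpow_in_base_change: "f \<in> zpow N B \<Longrightarrow> f \<in> base_change N B h M"
  unfolding base_change_eq by (rule hull_inc) simp

lemma base_change_minimal:
  assumes "f \<in> base_change N B h M" "submodule H B B.P" "\<And>f. f \<in> M \<Longrightarrow> h \<circ> f \<in> H" "\<And>f. f \<in> zpow N B \<Longrightarrow> f \<in> H"
  shows "f \<in> H"
proof -
  have "base_change N B h M \<subseteq> H"
    unfolding base_change_eq by (rule hull_minimal) (use assms in auto)
  with assms(1) show ?thesis by blast
qed

lemma push_ext:
  assumes f: "f \<in> extend_scalars N A M"
  shows "h \<circ> f \<in> extend_scalars N B M"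
proof -
  have "f \<in> {f \<in> carrier A.P. h \<circ> f \<in> extend_scalars N B M}"
  proof (rule A.ext_minimal[OF f push_preimage[OF B.ext_submodule]])
    show "A.emb f \<in> {f \<in> carrier A.P. h \<circ> f \<in> extend_scalars N B M}" if "f \<in> M" for f
      using B.emb_in_ext[OF that] by (simp add: push_emb)
    show "f \<in> {f \<in> carrier A.P. h \<circ> f \<in> extend_scalars N B M}" if "f \<in> zpow N A" for f
      using B.zpow_in_ext[OF push_zpow[OF that]] A.zpow_carrier[OF that] by simp
  qed
  then show ?thesis by simp
qed

lemma base_change_ext: "base_change N B h (extend_scalars N A M) = extend_scalars N B M"
proof (intro equalityI subsetI)
  fix f assume "f \<in> base_change N B h (extend_scalars N A M)"
  then show "f \<in> extend_scalars N B M"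
    by (rule base_change_minimal[OF _ B.ext_submodule push_ext B.zpow_in_ext])
next
  fix f assume "f \<in> extend_scalars N B M"
  then show "f \<in> base_change N B h (extend_scalars N A M)"
    by (rule B.ext_minimal[OF _ base_change_submodule[OF A.ext_submodule] _ zpow_in_base_change])
      (use push_in_base_change[OF A.emb_in_ext] push_emb in metis)
qed

lemma push_normal_form: "A.normal_form R f \<Longrightarrow> B.normal_form R (h \<circ> f)"
  by (simp add: A.normal_form_def B.normal_form_def push_U1)

lemma base_change_unit_multiple:
  assumes M: "submodule M A A.P" and \<phi>: "\<phi> \<in> U1 A"
    and \<phi>M: "\<And>r. r \<in> extend_scalars c A R \<Longrightarrow> \<phi> \<otimes>\<^bsub>A.P\<^esub> r \<in> M" and r: "r \<in> extend_scalars c B R"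
  shows "(h \<circ> \<phi>) \<otimes>\<^bsub>B.P\<^esub> r \<in> base_change c B h M"
proof (rule B.linear_map_ext[OF B.linear_map_mult[OF B.U1_carrier[OF push_U1[OF \<phi>]]] base_change_submodule[OF M] r])
  show "(h \<circ> \<phi>) \<otimes>\<^bsub>B.P\<^esub> B.emb f \<in> base_change c B h M" if "f \<in> R" for f
    using push_in_base_change[OF \<phi>M[OF A.emb_in_ext[OF that]]]
    by (simp add: push_mult A.U1_carrier[OF \<phi>] push_emb)
  show "(h \<circ> \<phi>) \<otimes>\<^bsub>B.P\<^esub> w \<in> base_change c B h M" if "w \<in> zpow c B" for w
    by (intro zpow_in_base_change B.zpow_mult_left that B.U1_carrier push_U1 \<phi>)
qed

text \<open>The image of a coset over A is only part of a coset over B, as units over B need not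
  come from A. The factor on the right, built into the transport of the cover, completes it.\<close>

lemma push_coset:
  assumes R: "C_subalgebra R" "zideal c \<subseteq> R" and \<phi>: "\<phi> \<in> U1 A"
  shows "((\<lambda>f. h \<circ> f) ` (\<phi> <#\<^bsub>A.P\<^esub> (U1 A \<inter> extend_scalars c A R))) <#>\<^bsub>B.P\<^esub> (U1 B \<inter> extend_scalars c B R)
    = (h \<circ> \<phi>) <#\<^bsub>B.P\<^esub> (U1 B \<inter> extend_scalars c B R)"
proof -
  interpret RA: scalar_extension A R c by unfold_locales (fact R)+
  interpret RB: scalar_extension B R c by unfold_locales (fact R)+
  note \<phi>c = A.U1_carrier[OF \<phi>]
  show ?thesis
  proof (intro equalityI subsetI)
    fix f assume "f \<in> ((\<lambda>f. h \<circ> f) ` (\<phi> <#\<^bsub>A.P\<^esub> RA.UR)) <#>\<^bsub>B.P\<^esub> RB.UR"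
    then obtain u v where uv: "u \<in> RA.UR" "v \<in> RB.UR" "f = (h \<circ> (\<phi> \<otimes>\<^bsub>A.P\<^esub> u)) \<otimes>\<^bsub>B.P\<^esub> v"
      by (auto simp: set_mult_def l_coset_def)
    have uc: "u \<in> carrier A.P" "v \<in> carrier B.P" using uv by (auto intro: A.U1_carrier B.U1_carrier)
    have "f = (h \<circ> \<phi>) \<otimes>\<^bsub>B.P\<^esub> ((h \<circ> u) \<otimes>\<^bsub>B.P\<^esub> v)"
      using uv(3) \<phi>c uc by (simp add: push_mult B.P.m_assoc)
    moreover have "h \<circ> u \<in> RB.UR" using uv(1) push_ext push_U1 by simp
    ultimately show "f \<in> (h \<circ> \<phi>) <#\<^bsub>B.P\<^esub> RB.UR"
      using RB.UR_mult[OF _ uv(2)] by (auto simp: B.l_coset_iff)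
  next
    fix f assume "f \<in> (h \<circ> \<phi>) <#\<^bsub>B.P\<^esub> RB.UR"
    then obtain v where v: "v \<in> RB.UR" "f = (h \<circ> \<phi>) \<otimes>\<^bsub>B.P\<^esub> v" by (auto simp: B.l_coset_iff)
    have "\<phi> \<in> \<phi> <#\<^bsub>A.P\<^esub> RA.UR"
      using RA.UR_one \<phi>c by (auto simp: A.l_coset_iff intro!: bexI[of _ "\<one>\<^bsub>A.P\<^esub>"])
    then show "f \<in> ((\<lambda>f. h \<circ> f) ` (\<phi> <#\<^bsub>A.P\<^esub> RA.UR)) <#>\<^bsub>B.P\<^esub> RB.UR"
      unfolding set_mult_def v(2) using v(1) by blast
  qed
qed

text \<open>t has constant entries, so h commutes with the twist. Both sides are then generated by
  the twists of images of elements of M and by the multiples of h \<circ> \<phi> by the extension of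
  R' to B.\<close>

lemma base_change_transfer_module:
  assumes TA: "submodule_transfer A R R' c t s" and TB: "submodule_transfer B R R' c t s"
    and \<phi>: "\<phi> \<in> U1 A" and M: "submodule M A A.P"
  shows "base_change c B h (submodule_transfer.transfer_module A R' c t \<phi> M) =
    submodule_transfer.transfer_module B R' c t (h \<circ> \<phi>) (base_change c B h M)"
proof -
  interpret TA: submodule_transfer A R R' c t s by (rule TA)
  interpret TB: submodule_transfer B R R' c t s by (rule TB)
  note \<phi>c = A.U1_carrier[OF \<phi>] and ic = A.U1_carrier[OF A.U1_inv[OF \<phi>]]
  note \<phi>B = push_U1[OF \<phi>]
  let ?M = "base_change c B h M" and ?D = "TA.transfer_module \<phi> M"
  note MB = base_change_submodule[OF M, of c]
  note D = TA.transfer_module_submodule[OF \<phi> M]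
  have push_twist: "h \<circ> TA.twist \<phi> f = TB.twist (h \<circ> \<phi>) (h \<circ> f)" if f: "f \<in> carrier A.P" for f
    unfolding TA.twist_def TB.twist_def
    using f \<phi>c ic by (simp add: push_mult push_linA push_inv[OF \<phi>])
  show ?thesis
  proof (intro equalityI subsetI)
    fix f assume "f \<in> base_change c B h ?D"
    then show "f \<in> TB.transfer_module (h \<circ> \<phi>) ?M"
    proof (rule base_change_minimal[OF _ TB.transfer_module_submodule[OF \<phi>B MB]])
      fix f assume "f \<in> ?D"
      then obtain m r where m: "m \<in> M" "r \<in> TA.R'.RA" "f = TA.twist \<phi> m \<oplus>\<^bsub>A.P\<^esub> \<phi> \<otimes>\<^bsub>A.P\<^esub> r"
        by (rule TA.transfer_moduleE)
      have mc: "m \<in> carrier A.P" "r \<in> carrier A.P" using m A.submodule_subset[OF M] A.ext_carrier by auto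
      have "h \<circ> f = TB.twist (h \<circ> \<phi>) (h \<circ> m) \<oplus>\<^bsub>B.P\<^esub> (h \<circ> \<phi>) \<otimes>\<^bsub>B.P\<^esub> (h \<circ> r)"
        unfolding m(3) using mc \<phi>c A.linear_mapD(1)[OF TA.twist_linear[OF \<phi>] mc(1)]
        by (simp add: push_add push_mult push_twist)
      also have "\<dots> \<in> TB.transfer_module (h \<circ> \<phi>) ?M"
        by (intro TB.transfer_moduleI push_in_base_change push_ext m)
      finally show "h \<circ> f \<in> TB.transfer_module (h \<circ> \<phi>) ?M" .
    next
      fix w assume w: "w \<in> zpow c B"
      have "w = (h \<circ> \<phi>) \<otimes>\<^bsub>B.P\<^esub> (inv\<^bsub>B.P\<^esub> (h \<circ> \<phi>) \<otimes>\<^bsub>B.P\<^esub> w)"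
        using B.zpow_carrier[OF w] by (simp add: TB.unit_cancel[OF \<phi>B])
      also have "\<dots> \<in> TB.transfer_module (h \<circ> \<phi>) ?M"
        by (intro TB.mult_RA_in_transfer_module[OF \<phi>B MB] B.zpow_in_ext B.zpow_mult_left w B.U1_carrier B.U1_inv \<phi>B)
      finally show "w \<in> TB.transfer_module (h \<circ> \<phi>) ?M" .
    qed
  next
    note DB = base_change_submodule[OF D, of c]
    fix f assume "f \<in> TB.transfer_module (h \<circ> \<phi>) ?M"
    then obtain m r where m: "m \<in> ?M" "r \<in> TB.R'.RA" "f = TB.twist (h \<circ> \<phi>) m \<oplus>\<^bsub>B.P\<^esub> (h \<circ> \<phi>) \<otimes>\<^bsub>B.P\<^esub> r"
      by (rule TB.transfer_moduleE)
    \<comment> \<open>An element m of the base change need not be the image of an element of M.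
      Membership of its twist is linear in m, so it is checked on generators: images of elements of
      M, and z^c B[[z]], which the twist kills.\<close>
    have "m \<in> {f \<in> carrier B.P. TB.twist (h \<circ> \<phi>) f \<in> base_change c B h ?D}"
    proof (rule base_change_minimal[OF m(1) B.submodule_preimage[OF TB.twist_linear[OF \<phi>B] DB]])
      fix f assume f: "f \<in> M"
      have fc: "f \<in> carrier A.P" using f by (rule A.submodule_subset[OF M])
      have "TB.twist (h \<circ> \<phi>) (h \<circ> f) \<in> base_change c B h ?D"
        unfolding push_twist[OF fc, symmetric]
        by (intro push_in_base_change TA.twist_in_transfer_module[OF \<phi> M f])
      with fc show "h \<circ> f \<in> {f \<in> carrier B.P. TB.twist (h \<circ> \<phi>) f \<in> base_change c B h ?D}" by simp
    next
      fix w assume w: "w \<in> zpow c B"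
      have "inv\<^bsub>B.P\<^esub> (h \<circ> \<phi>) \<otimes>\<^bsub>B.P\<^esub> w \<in> zpow c B"
        by (intro B.zpow_mult_left w B.U1_carrier B.U1_inv \<phi>B)
      then have "TB.twist (h \<circ> \<phi>) w = \<zero>\<^bsub>B.P\<^esub>"
        unfolding TB.twist_def using B.U1_carrier[OF \<phi>B] by (simp add: B.linA_zpow)
      then show "w \<in> {f \<in> carrier B.P. TB.twist (h \<circ> \<phi>) f \<in> base_change c B h ?D}"
        using B.zpow_carrier[OF w] B.submodule_zero[OF DB] by simp
    qed
    moreover have "(h \<circ> \<phi>) \<otimes>\<^bsub>B.P\<^esub> r \<in> base_change c B h ?D"
      by (rule base_change_unit_multiple[OF D \<phi> TA.mult_RA_in_transfer_module[OF \<phi> M] m(2)])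
    ultimately show "f \<in> base_change c B h ?D"
      unfolding m(3) using B.submodule_add[OF DB] by simp
  qed
qed

end

section \<open>The functors of points\<close>

lemma complex_algebraI: "calg A \<Longrightarrow> complex_algebra A"
  by (simp add: complex_algebra_def)

lemma complex_algebra_homI: "calg A \<Longrightarrow> calg B \<Longrightarrow> h \<in> calg_hom A B \<Longrightarrow> complex_algebra_hom A B h"
  by (simp add: complex_algebra_hom_def complex_algebra_hom_axioms_def complex_algebraI)

lemma normal_form_cong:
  "val_semigroup R = val_semigroup R' \<Longrightarrow>
    complex_algebra.normal_form A R f \<longleftrightarrow> complex_algebra.normal_form A R' f" if "calg A"
  by (simp add: complex_algebra.normal_form_def[OF complex_algebraI[OF that]])

lemma cover_transport:
  "transport (cover R J) A B h (M, \<Phi>) = (transport J A B h M, ((\<lambda>f. h \<circ> f) ` \<Phi>) <#>\<^bsub>pser B\<^esub> U1_ring R B)"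
  by (simp add: cover_def)

lemma cover_points:
  "p \<in> points (cover R J) A \<longleftrightarrow>
    (\<exists>M \<phi>. p = (M, \<phi> <#\<^bsub>pser A\<^esub> U1_ring R A) \<and> M \<in> points J A \<and> \<phi> \<in> U1 A \<and> \<phi> \<in> M)"
  by (auto simp: cover_def)

context scalar_extension
begin

lemma standard_points_iff:
  assumes "2 * delta R = c"
  shows "M \<in> standard_points R A \<longleftrightarrow>
    submodule M A P \<and> (\<forall>r\<in>RA. \<forall>f\<in>M. r \<otimes>\<^bsub>P\<^esub> f \<in> M) \<and> U1 A \<inter> M \<noteq> {}"
  by (simp add: standard_points_def assms)

lemma U1_ring_eq: "2 * delta R = c \<Longrightarrow> U1_ring R A = UR"
  by (simp add: U1_ring_def)

text \<open>The representative can be replaced within its class without leaving M, because M is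
  stable under the extension of R.\<close>

lemma cover_point_normal_form:
  assumes c: "2 * delta R = c" and p: "p \<in> points (cover R J) A" and J: "points J A \<subseteq> standard_points R A"
  obtains M \<phi> where "p = (M, \<phi> <#\<^bsub>P\<^esub> UR)" "M \<in> points J A" "normal_form R \<phi>" "\<phi> \<in> M"
    "submodule M A P" "\<And>r f. r \<in> RA \<Longrightarrow> f \<in> M \<Longrightarrow> r \<otimes>\<^bsub>P\<^esub> f \<in> M" "\<And>r. r \<in> RA \<Longrightarrow> \<phi> \<otimes>\<^bsub>P\<^esub> r \<in> M"
proof -
  obtain M \<psi> where M: "p = (M, \<psi> <#\<^bsub>P\<^esub> UR)" "M \<in> points J A" "\<psi> \<in> U1 A" "\<psi> \<in> M"
    using p unfolding cover_points U1_ring_eq[OF c] by blast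
  with J have st: "submodule M A P" "\<And>r f. r \<in> RA \<Longrightarrow> f \<in> M \<Longrightarrow> r \<otimes>\<^bsub>P\<^esub> f \<in> M"
    using standard_points_iff[OF c] by auto
  have mult: "f \<otimes>\<^bsub>P\<^esub> r \<in> M" if "f \<in> M" "r \<in> RA" for f r
    using st(2)[OF that(2,1)] ext_carrier[OF that(2)] submodule_subset[OF st(1) that(1)] by (simp add: P.m_comm)
  obtain \<phi> where \<phi>: "\<phi> \<in> \<psi> <#\<^bsub>P\<^esub> UR" "normal_form R \<phi>" using coset_ex_normal_form[OF M(3)] by blast
  then have "\<phi> \<in> M" using mult M(4) by (auto simp: l_coset_iff)
  with M st mult \<phi> coset_eq[OF M(3) \<phi>(1)] show thesis by (intro that[of M \<phi>]) auto
qed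

lemma cover_pointI:
  "2 * delta R = c \<Longrightarrow> M \<in> points J A \<Longrightarrow> \<phi> \<in> U1 A \<Longrightarrow> \<phi> \<in> M \<Longrightarrow> (M, \<phi> <#\<^bsub>P\<^esub> UR) \<in> points (cover R J) A"
  unfolding cover_points by (intro exI[of _ M] exI[of _ \<phi>]) (simp add: U1_ring_eq)

end

text \<open>The normal representative is kept unchanged as a series, and only its coset is formed
  with the other ring. Making this choice canonical is what lets the map commute with base
  change.\<close>

definition transfer_point ::
  "complex fps set \<Rightarrow> complex fps set \<Rightarrow> nat \<Rightarrow> (nat \<Rightarrow> complex fps) \<Rightarrow> 'u calg \<Rightarrow>
    (nat \<Rightarrow> 'u) set \<times> (nat \<Rightarrow> 'u) set \<Rightarrow> (nat \<Rightarrow> 'u) set \<times> (nat \<Rightarrow> 'u) set" where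
  "transfer_point R R' c t A p =
    (let \<phi> = scalar_extension.coset_normal_form A R (snd p)
     in (submodule_transfer.transfer_module A R' c t \<phi> (fst p), \<phi> <#\<^bsub>pser A\<^esub> U1_ring R' A))"

lemma (in scalar_extension) transfer_point_eq:
  "normal_form R \<phi> \<Longrightarrow> transfer_point R R' c t A (M, \<phi> <#\<^bsub>P\<^esub> UR) =
    (submodule_transfer.transfer_module A R' c t \<phi> M, \<phi> <#\<^bsub>P\<^esub> U1_ring R' A)"
  by (simp add: transfer_point_def coset_normal_form_eq)

text \<open>A condition Q on submodules that cuts out a subfunctor of \<open>Jac\<close> simultaneously for both rings.\<close>

locale cover_transfer =
  fixes R R' :: "complex fps set" and c :: nat and t s :: "nat \<Rightarrow> complex fps"
    and J J' :: "('u, (nat \<Rightarrow> 'u) set) functor_of_points"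
    and Q :: "'u calg \<Rightarrow> (nat \<Rightarrow> 'u) set \<Rightarrow> bool"
  assumes c: "2 * delta R = c" "2 * delta R' = c"
    and same_val: "val_semigroup R = val_semigroup R'"
    and transfer: "\<And>A :: 'u calg. calg A \<Longrightarrow> submodule_transfer A R R' c t s"
    and J: "\<And>A. points J A = {M \<in> standard_points R A. Q A M}" "transport J = (\<lambda>A B h. base_change c B h)"
    and J': "\<And>A. points J' A = {M \<in> standard_points R' A. Q A M}" "transport J' = (\<lambda>A B h. base_change c B h)"
    and Q: "\<And>A \<phi> M. calg A \<Longrightarrow> \<phi> \<in> U1 A \<Longrightarrow> submodule M A (pser A) \<Longrightarrow>
      (\<And>r. r \<in> extend_scalars c A R \<Longrightarrow> \<phi> \<otimes>\<^bsub>pser A\<^esub> r \<in> M) \<Longrightarrow> Q A M \<Longrightarrow>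
      Q A (submodule_transfer.transfer_module A R' c t \<phi> M)"
begin

text \<open>\<phi> = \<phi> 1 lies in the transferred module because 1 lies in R'. This gives both
  standardness and the class in the second component.\<close>

lemma transfer_point_closed:
  assumes A: "calg A" and p: "p \<in> points (cover R J) A"
  shows "transfer_point R R' c t A p \<in> points (cover R' J') A"
proof -
  interpret T: submodule_transfer A R R' c t s by (rule transfer[OF A])
  from p obtain M \<phi> where M: "p = (M, \<phi> <#\<^bsub>T.P\<^esub> T.R.UR)" "M \<in> points J A" "T.normal_form R \<phi>" "\<phi> \<in> M"
    "submodule M A T.P" "\<And>r f. r \<in> T.R.RA \<Longrightarrow> f \<in> M \<Longrightarrow> r \<otimes>\<^bsub>T.P\<^esub> f \<in> M" "\<And>r. r \<in> T.R.RA \<Longrightarrow> \<phi> \<otimes>\<^bsub>T.P\<^esub> r \<in> M"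
    by (rule T.R.cover_point_normal_form[OF c(1)]) (auto simp: J)
  let ?D = "T.transfer_module \<phi> M"
  have \<phi>: "\<phi> \<in> U1 A" using M(3) by (simp add: T.normal_form_def)
  have \<phi>D: "\<phi> \<in> ?D"
    using T.mult_RA_in_transfer_module[OF \<phi> M(5) T.R'.RA_one] T.U1_carrier[OF \<phi>] by simp
  have "?D \<in> standard_points R' A"
    unfolding T.R'.standard_points_iff[OF c(2)]
    using T.transfer_module_submodule[OF \<phi> M(5)] T.transfer_module_stable[OF \<phi> M(5,6)] \<phi> \<phi>D by blast
  moreover have "Q A ?D" using Q[OF A \<phi> M(5,7)] M(2) by (simp add: J)
  ultimately have "?D \<in> points J' A" by (simp add: J')
  then show ?thesis
    unfolding M(1) T.R.transfer_point_eq[OF M(3)] T.R'.U1_ring_eq[OF c(2)]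
    by (rule T.R'.cover_pointI[OF c(2) _ \<phi> \<phi>D])
qed

text \<open>The image of a normal form under h is again a normal form, so over B the transfer uses h
  \<circ> \<phi>.\<close>

lemma transfer_point_natural:
  assumes A: "calg A" and B: "calg B" and h: "h \<in> calg_hom A B" and p: "p \<in> points (cover R J) A"
  shows "transfer_point R R' c t B (transport (cover R J) A B h p) =
    transport (cover R' J') A B h (transfer_point R R' c t A p)"
proof -
  interpret TA: submodule_transfer A R R' c t s by (rule transfer[OF A])
  interpret TB: submodule_transfer B R R' c t s by (rule transfer[OF B])
  interpret H: complex_algebra_hom A B h by (rule complex_algebra_homI[OF A B h])
  from p obtain M \<phi> where M: "p = (M, \<phi> <#\<^bsub>TA.P\<^esub> TA.R.UR)" "TA.normal_form R \<phi>" "submodule M A TA.P"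
    by (rule TA.R.cover_point_normal_form[OF c(1)]) (auto simp: J)
  have \<phi>: "\<phi> \<in> U1 A" using M(2) by (simp add: TA.normal_form_def)
  note sub = TA.subalg TA.cond
  have "transfer_point R R' c t B (transport (cover R J) A B h p) =
      (TB.transfer_module (h \<circ> \<phi>) (base_change c B h M), (h \<circ> \<phi>) <#\<^bsub>TB.P\<^esub> TB.R'.UR)"
    unfolding M(1) cover_transport J TB.R.U1_ring_eq[OF c(1)] H.push_coset[OF sub(1,3) \<phi>]
      TB.R.transfer_point_eq[OF H.push_normal_form[OF M(2)]] TB.R'.U1_ring_eq[OF c(2)] ..
  also have "\<dots> = transport (cover R' J') A B h (transfer_point R R' c t A p)"
    unfolding M(1) TA.R.transfer_point_eq[OF M(2)] cover_transport J'
      TB.R'.U1_ring_eq[OF c(2)] TA.R'.U1_ring_eq[OF c(2)] H.push_coset[OF sub(2,4) \<phi>]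
      H.base_change_transfer_module[OF TA.submodule_transfer_axioms TB.submodule_transfer_axioms \<phi> M(3)] ..
  finally show ?thesis .
qed

text \<open>Equality of the semigroups enters here: \<phi> is also the normal form for R', so the
  way back divides by the same series.\<close>

lemma transfer_point_inverse:
  assumes A: "calg A" and p: "p \<in> points (cover R J) A"
  shows "transfer_point R' R c s A (transfer_point R R' c t A p) = p"
proof -
  interpret T: submodule_transfer A R R' c t s by (rule transfer[OF A])
  from p obtain M \<phi> where M: "p = (M, \<phi> <#\<^bsub>T.P\<^esub> T.R.UR)" "T.normal_form R \<phi>"
    "submodule M A T.P" "\<And>r. r \<in> T.R.RA \<Longrightarrow> \<phi> \<otimes>\<^bsub>T.P\<^esub> r \<in> M"
    by (rule T.R.cover_point_normal_form[OF c(1)]) (auto simp: J)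
  have \<phi>: "\<phi> \<in> U1 A" using M(2) by (simp add: T.normal_form_def)
  have nf': "T.normal_form R' \<phi>" using M(2) normal_form_cong[OF A same_val] by simp
  show ?thesis
    unfolding M(1) T.R.transfer_point_eq[OF M(2)] T.R'.U1_ring_eq[OF c(2)] T.R'.transfer_point_eq[OF nf']
      T.R.U1_ring_eq[OF c(1)] using T.transfer_module_inverse[OF \<phi> M(3,4)] by simp
qed

end

lemma cover_isomorphic:
  assumes "cover_transfer R R' c t s J J' Q" "cover_transfer R' R c s t J' J Q"
  shows "isomorphic_schemes (cover R J) (cover R' J')"
proof -
  interpret F: cover_transfer R R' c t s J J' Q by (rule assms(1))
  interpret G: cover_transfer R' R c s t J' J Q by (rule assms(2))
  show ?thesis
    unfolding isomorphic_schemes_def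
  proof (intro exI conjI allI impI)
    show "natural (cover R J) (cover R' J') (transfer_point R R' c t)"
      unfolding natural_def using F.transfer_point_closed F.transfer_point_natural by blast
    fix A :: "'a calg" assume A: "calg A"
    show "bij_betw (transfer_point R R' c t A) (points (cover R J) A) (points (cover R' J') A)"
      by (rule bij_betw_byWitness[where f' = "transfer_point R' R c s A"])
        (use F.transfer_point_inverse[OF A] G.transfer_point_inverse[OF A]
          F.transfer_point_closed[OF A] G.transfer_point_closed[OF A] in auto)
  qed
qed

lemma Jac_cover_transfer:
  assumes c: "2 * delta R = c" "2 * delta R' = c" and val: "val_semigroup R = val_semigroup R'"
    and transfer: "\<And>A :: 'u calg. calg A \<Longrightarrow> submodule_transfer A R R' c t s"
  shows "cover_transfer R R' c t s (Jac R :: ('u, (nat \<Rightarrow> 'u) set) functor_of_points) (Jac R') projective_quotient"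
proof (rule cover_transfer.intro[OF c val transfer])
  fix A :: "'u calg" and \<phi> M
  assume A: "calg A" and *: "\<phi> \<in> U1 A" "submodule M A (pser A)"
    "\<And>r. r \<in> extend_scalars c A R \<Longrightarrow> \<phi> \<otimes>\<^bsub>pser A\<^esub> r \<in> M" "projective_quotient A M"
  show "projective_quotient A (submodule_transfer.transfer_module A R' c t \<phi> M)"
    by (rule submodule_transfer.transfer_module_projective[OF transfer[OF A] *])
qed (simp_all add: Jac_def c)

text \<open>The rank condition is imposed after base change to fields. It is preserved because the
  transfer commutes with base change and, over each field, carries bases of quotients to bases of
  quotients.\<close>

lemma Jac_d_cover_transfer:
  assumes c: "2 * delta R = c" "2 * delta R' = c" and val: "val_semigroup R = val_semigroup R'"
    and transfer: "\<And>A :: 'u calg. calg A \<Longrightarrow> submodule_transfer A R R' c t s"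
  shows "cover_transfer R R' c t s (Jac_d R d :: ('u, (nat \<Rightarrow> 'u) set) functor_of_points) (Jac_d R' d)
    (\<lambda>A M. projective_quotient A M \<and> (\<forall>K h. calg K \<longrightarrow> field K \<longrightarrow> h \<in> calg_hom A K \<longrightarrow>
      free_quotient K (base_change c K h M) d))"
proof (rule cover_transfer.intro[OF c val transfer])
  fix A :: "'u calg" and \<phi> M
  assume A: "calg A" and *: "\<phi> \<in> U1 A" "submodule M A (pser A)"
      "\<And>r. r \<in> extend_scalars c A R \<Longrightarrow> \<phi> \<otimes>\<^bsub>pser A\<^esub> r \<in> M"
    and Q: "projective_quotient A M \<and> (\<forall>K h. calg K \<longrightarrow> field K \<longrightarrow> h \<in> calg_hom A K \<longrightarrow>
      free_quotient K (base_change c K h M) d)"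
  have "free_quotient K (base_change c K h (submodule_transfer.transfer_module A R' c t \<phi> M)) d"
    if K: "calg K" "field K" "h \<in> calg_hom A K" for K h
  proof -
    interpret H: complex_algebra_hom A K h by (rule complex_algebra_homI[OF A K(1,3)])
    have "free_quotient K (submodule_transfer.transfer_module K R' c t (h \<circ> \<phi>) (base_change c K h M)) d"
      using Q K
      by (intro submodule_transfer.transfer_module_free[OF transfer[OF K(1)]] H.push_U1 * H.base_change_submodule
          H.base_change_unit_multiple[OF *(2,1,3)]) simp_all
    then show ?thesis
      unfolding H.base_change_transfer_module[OF transfer[OF A] transfer[OF K(1)] *(1,2)] .
  qed
  then show "projective_quotient A (submodule_transfer.transfer_module A R' c t \<phi> M) \<and>
      (\<forall>K h. calg K \<longrightarrow> field K \<longrightarrow> h \<in> calg_hom A K \<longrightarrow>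
        free_quotient K (base_change c K h (submodule_transfer.transfer_module A R' c t \<phi> M)) d)"
    using submodule_transfer.transfer_module_projective[OF transfer[OF A] *] Q by simp
qed (auto simp: Jac_d_def quotient_rank_def c)

text \<open>A standard module contains a series with constant term 1, whose class is a point above
  it.\<close>

lemma cover_covers:
  assumes "\<And>A. points J A \<subseteq> standard_points R A"
  shows "covers (cover R J) J (\<lambda>A. fst)"
  unfolding covers_def natural_def
proof (intro conjI allI impI)
  fix A :: "'a calg"
  show "fst ` points (cover R J) A = points J A"
  proof (intro equalityI subsetI)
    fix M assume M: "M \<in> points J A"
    with assms have "U1 A \<inter> M \<noteq> {}" by (auto simp: standard_points_def)
    then obtain \<phi> where "\<phi> \<in> U1 A" "\<phi> \<in> M" by blast
    with M have "(M, \<phi> <#\<^bsub>pser A\<^esub> U1_ring R A) \<in> points (cover R J) A" by (auto simp: cover_points)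
    then show "M \<in> fst ` points (cover R J) A" by (rule image_eqI[rotated]) simp
  qed (auto simp: cover_points)
qed (auto simp: cover_points cover_transport)

section \<open>The fibres\<close>

text \<open>M contains a unit f of C[[z]] and hence R f. Multiplication by f maps z^c C[[z]] onto
  itself and preserves orders.\<close>

lemma standard_subspace:
  assumes R: "C_subalgebra R" and c: "zideal c \<subseteq> R" and M: "standard R M"
  shows "fps_subspace M" "zideal c \<subseteq> M" "val_semigroup R \<subseteq> val_semigroup M"
proof -
  have RM: "r * f \<in> M" if "r \<in> R" "f \<in> M" for r f using M that by (simp add: standard_def)
  show "fps_subspace M"
    using M RM C_subalgebra_const[OF R] by (simp add: standard_def fps_subspace_def)
  obtain f where f: "f \<in> M" "fps_nth f 0 = 1" using M by (auto simp: standard_def)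
  then have f0: "f \<noteq> 0" "subdegree f = 0" by auto
  show "zideal c \<subseteq> M"
  proof
    fix g assume "g \<in> zideal c"
    then have "g * inverse f \<in> R" using c zideal_mult_right by blast
    then have "g * inverse f * f \<in> M" using f(1) by (rule RM)
    moreover have "g * inverse f * f = g"
      using inverse_mult_eq_1[of f] f(2) by (simp add: mult.assoc)
    ultimately show "g \<in> M" by simp
  qed
  show "val_semigroup R \<subseteq> val_semigroup M"
  proof
    fix n assume "n \<in> val_semigroup R"
    then obtain r where r: "r \<in> R" "r \<noteq> 0" "n = subdegree r" by (auto simp: val_semigroup_def)
    then have "r * f \<in> M - {0}" "n = subdegree (r * f)" using RM f(1) f0 by auto
    then show "n \<in> val_semigroup M" unfolding val_semigroup_def by (rule image_eqI[rotated])
  qed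
qed

text \<open>The constant A-point given by M, over which the fibre is taken.\<close>

lemma ext_in_Jac_d:
  assumes A: "calg A" and R: "C_subalgebra R" "zideal c \<subseteq> R" "2 * delta R = c" and M: "M \<in> jac R d"
  shows "extend_scalars c A M \<in> points (Jac_d R d) A"
proof -
  interpret S: scalar_extension A R c
    by (intro scalar_extension.intro complex_algebraI[OF A] scalar_extension_axioms.intro R)
  have std: "standard R M" and codim: "has_codim M d" using M by (auto simp: jac_def)
  note sub = standard_subspace[OF R(1,2) std]
  have d: "d = card (- val_semigroup M)" using codim has_codim_iff[OF sub(1,2)] by simp
  obtain f where f: "f \<in> M" "fps_nth f 0 = 1" using std by (auto simp: standard_def)
  have RM: "r * f \<in> M" if "r \<in> R" "f \<in> M" for r f using std that by (simp add: standard_def)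
  have "S.emb f \<in> U1 A" using f by (simp add: S.U1_iff S.emb_nth)
  with S.emb_in_ext[OF f(1)] have "extend_scalars c A M \<in> standard_points R A"
    unfolding S.standard_points_iff[OF R(3)] using S.ext_submodule S.ext_mult[OF RM] by blast
  moreover have "free_quotient K (base_change c K h (extend_scalars c A M)) d"
    if K: "calg K" "h \<in> calg_hom A K" for K h
    unfolding d complex_algebra_hom.base_change_ext[OF complex_algebra_homI[OF A K]]
    by (rule complex_algebra.ext_free[OF complex_algebraI[OF K(1)] sub(1,2)])
  ultimately show ?thesis
    using S.ext_projective[OF sub(1,2)] by (simp add: Jac_d_def quotient_rank_def R(3))
qed

text \<open>An element of the base change of M is determined by its coefficients at the orders of M.  Those at
  orders of R are fixed by the normal form, the remaining ones are free.\<close>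

lemma fibre_isomorphic:
  assumes R: "C_subalgebra R" "zideal c \<subseteq> R" "2 * delta R = c" and M: "M \<in> jac R d"
  shows "isomorphic_schemes
    (Jac_tilde_fibre R d M :: ('u, (nat \<Rightarrow> 'u) set \<times> (nat \<Rightarrow> 'u) set) functor_of_points)
    (affine_space (delta R - d))"
proof -
  have std: "standard R M" and codim: "has_codim M d" using M by (auto simp: jac_def)
  note sub = standard_subspace[OF R(1,2) std]
  let ?F = "Jac_tilde_fibre R d M :: ('u, (nat \<Rightarrow> 'u) set \<times> (nat \<Rightarrow> 'u) set) functor_of_points"
  let ?S = "val_semigroup M - val_semigroup R" and ?n = "delta R - d"
  have d: "d = card (- val_semigroup M)" using codim has_codim_iff[OF sub(1,2)] by simp
  have \<delta>: "delta R = card (- val_semigroup R)" by (rule delta_eq_card_gaps[OF C_subalgebra_subspace[OF R(1)] R(2)])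
  have fin: "finite (- val_semigroup R)" by (rule finite_gaps[OF R(2)])
  \<comment> \<open>M has every order of R, so its d gaps are among the \<delta> gaps of R. Removing
    them leaves the \<delta> - d orders that index the free coordinates.\<close>
  have "?S = - val_semigroup R - - val_semigroup M" by auto
  then have card: "card ?S = ?n"
    unfolding d \<delta> using card_Diff_subset[of "- val_semigroup M" "- val_semigroup R"] sub(3) finite_gaps[OF sub(2)]
    by auto
  have "finite ?S" using fin by (rule rev_finite_subset) auto
  then obtain t where t: "bij_betw t {..<?n} ?S"
    using ex_bij_betw_nat_finite[of ?S] card by (auto simp: atLeast0LessThan)
  have vs_0: "0 \<in> val_semigroup R" by (rule val_semigroup_0[OF R(1)])
  define \<eta> where "\<eta> A p = restrict (\<lambda>i. scalar_extension.coset_normal_form A R (snd p) (t i)) {..<?n}"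
    for A :: "'u calg" and p :: "(nat \<Rightarrow> 'u) set \<times> (nat \<Rightarrow> 'u) set"
  have S: "scalar_extension A R c" if "calg A" for A :: "'u calg"
    by (intro scalar_extension.intro complex_algebraI[OF that] scalar_extension_axioms.intro R)
  have Jac_d_sub: "points (Jac_d R d) A \<subseteq> standard_points R A" for A :: "'u calg" by (auto simp: Jac_d_def)
  have point: "\<exists>\<phi>. p = (extend_scalars c A M, \<phi> <#\<^bsub>pser A\<^esub> (U1 A \<inter> extend_scalars c A R)) \<and>
      complex_algebra.normal_form A R \<phi> \<and> \<phi> \<in> extend_scalars c A M"
    if A: "calg A" and p: "p \<in> points ?F A" for A p
  proof -
    interpret S: scalar_extension A R c by (rule S[OF A])
    have p': "p \<in> points (cover R (Jac_d R d)) A" "fst p = extend_scalars c A M"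
      using p R(3) by (auto simp: Jac_tilde_fibre_def Jac_tilde_d_def)
    from p'(1) obtain N \<phi> where "p = (N, \<phi> <#\<^bsub>S.P\<^esub> S.UR)" "S.normal_form R \<phi>" "\<phi> \<in> N"
      by (rule S.cover_point_normal_form[OF R(3) _ Jac_d_sub]) auto
    with p'(2) show ?thesis by auto
  qed
  have \<eta>_eq: "\<eta> A (N, \<phi> <#\<^bsub>pser A\<^esub> (U1 A \<inter> extend_scalars c A R)) = restrict (\<lambda>i. \<phi> (t i)) {..<?n}"
    if A: "calg A" and "complex_algebra.normal_form A R \<phi>" for A :: "'u calg" and N \<phi>
    using scalar_extension.coset_normal_form_eq[OF S[OF A] that(2)] by (simp add: \<eta>_def)
  have "natural ?F (affine_space ?n) \<eta>"
    unfolding natural_def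
  proof (intro conjI allI impI funcsetI)
    fix A :: "'u calg" and p assume A: "calg A" and p: "p \<in> points ?F A"
    interpret S: scalar_extension A R c by (rule S[OF A])
    from point[OF A p] obtain \<phi> where \<phi>: "p = (extend_scalars c A M, \<phi> <#\<^bsub>S.P\<^esub> S.UR)" "S.normal_form R \<phi>" by blast
    then have "\<phi> \<in> carrier S.P" by (simp add: S.normal_form_def S.U1_carrier)
    then show "\<eta> A p \<in> points (affine_space ?n) A"
      unfolding \<phi>(1) \<eta>_eq[OF A \<phi>(2)] by (simp add: affine_space_def)
  next
    fix A B :: "'u calg" and h p assume A: "calg A" and B: "calg B" and h: "h \<in> calg_hom A B" and p: "p \<in> points ?F A"
    interpret SA: scalar_extension A R c by (rule S[OF A])
    interpret SB: scalar_extension B R c by (rule S[OF B])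
    interpret H: complex_algebra_hom A B h by (rule complex_algebra_homI[OF A B h])
    from point[OF A p] obtain \<phi> where \<phi>: "p = (extend_scalars c A M, \<phi> <#\<^bsub>SA.P\<^esub> SA.UR)" "SA.normal_form R \<phi>" by blast
    then have "\<phi> \<in> U1 A" by (simp add: SA.normal_form_def)
    note coset = H.push_coset[OF R(1,2) this]
    have "transport ?F A B h p = (transport (Jac_d R d) A B h (extend_scalars c A M), (h \<circ> \<phi>) <#\<^bsub>SB.P\<^esub> SB.UR)"
      unfolding \<phi>(1) using coset
      by (simp add: Jac_tilde_fibre_def Jac_tilde_d_def cover_transport SB.U1_ring_eq[OF R(3)])
    then show "\<eta> B (transport ?F A B h p) = transport (affine_space ?n) A B h (\<eta> A p)"
      unfolding \<phi>(1) \<eta>_eq[OF A \<phi>(2)] using \<eta>_eq[OF B H.push_normal_form[OF \<phi>(2)]]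
      by (auto simp: affine_space_def restrict_def)
  qed
  moreover have "bij_betw (\<eta> A) (points ?F A) (points (affine_space ?n) A)" if A: "calg A" for A :: "'u calg"
  proof (rule bij_betw_imageI)
    interpret S: scalar_extension A R c by (rule S[OF A])
    show "inj_on (\<eta> A) (points ?F A)"
    proof (rule inj_onI)
      fix p q assume p: "p \<in> points ?F A" and q: "q \<in> points ?F A" and eq: "\<eta> A p = \<eta> A q"
      from point[OF A p] obtain f where f: "p = (extend_scalars c A M, f <#\<^bsub>S.P\<^esub> S.UR)" "S.normal_form R f"
        "f \<in> extend_scalars c A M" by blast
      from point[OF A q] obtain g where g: "q = (extend_scalars c A M, g <#\<^bsub>S.P\<^esub> S.UR)" "S.normal_form R g"
        "g \<in> extend_scalars c A M" by blast
      have "f = g"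
      proof (rule S.ext_eqI[OF sub(1,2) f(3) g(3)])
        fix k assume k: "k \<in> val_semigroup M"
        show "f k = g k"
        proof (cases "k \<in> val_semigroup R")
          case True
          then show ?thesis using f(2) g(2) by (cases "k = 0") (auto simp: S.normal_form_def S.U1_iff)
        next
          case False
          with k have "k \<in> t ` {..<?n}" using t by (simp add: bij_betw_def)
          then obtain i where i: "i < ?n" "k = t i" by auto
          from fun_cong[OF eq, of i] i show ?thesis
            unfolding f(1) g(1) \<eta>_eq[OF A f(2)] \<eta>_eq[OF A g(2)] by simp
        qed
      qed
      with f g show "p = q" by simp
    qed
    show "\<eta> A ` points ?F A = points (affine_space ?n) A"
    proof (intro equalityI subsetI)
      fix a assume "a \<in> \<eta> A ` points ?F A"
      then obtain p where p: "p \<in> points ?F A" "a = \<eta> A p" by blast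
      from point[OF A p(1)] obtain \<phi> where \<phi>: "p = (extend_scalars c A M, \<phi> <#\<^bsub>S.P\<^esub> S.UR)" "S.normal_form R \<phi>" by blast
      then have "\<phi> \<in> carrier S.P" by (simp add: S.normal_form_def S.U1_carrier)
      then show "a \<in> points (affine_space ?n) A"
        unfolding p(2) \<phi>(1) \<eta>_eq[OF A \<phi>(2)] by (simp add: affine_space_def)
    next
      fix a assume "a \<in> points (affine_space ?n) A"
      then have a: "a \<in> {..<?n} \<rightarrow>\<^sub>E carrier A" by (simp add: affine_space_def)
      \<comment> \<open>Coefficients prescribed at the orders of M: 1 at 0, zero at the positive
        orders of R, which makes the series normal, and the entries of a at the remaining
        ones.\<close>
      define q where "q k = (if k = 0 then \<one>\<^bsub>A\<^esub> else if k \<in> ?S then a (the_inv_into {..<?n} t k) else \<zero>\<^bsub>A\<^esub>)" for k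
      have q: "q k \<in> carrier A" for k
        using a the_inv_into_into[OF bij_betw_imp_inj_on[OF t], of k] t
        by (auto simp: q_def bij_betw_def)
      obtain f where f: "f \<in> extend_scalars c A M" "\<forall>k\<in>val_semigroup M. f k = q k"
        using S.ext_ex_coordinates[OF sub(1), of q c] q by blast
      have nf: "S.normal_form R f"
        unfolding S.normal_form_def S.U1_iff using f sub(3) vs_0 S.ext_carrier[OF f(1)] by (auto simp: q_def)
      have "\<eta> A (extend_scalars c A M, f <#\<^bsub>S.P\<^esub> S.UR) = a"
        unfolding \<eta>_eq[OF A nf]
      proof (rule ext)
        fix i
        show "restrict (\<lambda>i. f (t i)) {..<?n} i = a i"
        proof (cases "i < ?n")
          case True
          then have ti: "t i \<in> ?S" using bij_betwE[OF t] by simp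
          then have "f (t i) = q (t i)" using f(2) by simp
          also have "\<dots> = a i"
            using ti vs_0 True the_inv_into_f_f[OF bij_betw_imp_inj_on[OF t], of i] by (auto simp: q_def)
          finally show ?thesis using True by simp
        next
          case False
          with a show ?thesis by (auto simp: PiE_def extensional_def)
        qed
      qed
      moreover have "(extend_scalars c A M, f <#\<^bsub>S.P\<^esub> S.UR) \<in> points (cover R (Jac_d R d)) A"
        using nf by (intro S.cover_pointI[OF R(3) ext_in_Jac_d[OF A R M]] f(1)) (simp add: S.normal_form_def)
      then have "(extend_scalars c A M, f <#\<^bsub>S.P\<^esub> S.UR) \<in> points ?F A"
        by (simp add: Jac_tilde_fibre_def Jac_tilde_d_def R(3))
      ultimately show "a \<in> \<eta> A ` points ?F A" by blast
    qed
  qed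
  ultimately show ?thesis unfolding isomorphic_schemes_def by blast
qed

text \<open>\<delta> is the number of gaps, so equal semigroups give equal \<delta> and a single c
  serves both rings.\<close>

lemma plane_branch_cover_isomorphic:
  assumes b: "plane_branch R x y" "plane_branch R' x' y'"
    and val: "val_semigroup R = val_semigroup R'"
    and \<psi>: "C_automorphism \<psi>" "\<psi> ` C_tilde R x y = C_tilde R' x' y'"
  shows "isomorphic_schemes
      (Jac_tilde R :: ('u, (nat \<Rightarrow> 'u) set \<times> (nat \<Rightarrow> 'u) set) functor_of_points) (Jac_tilde R')"
    and "isomorphic_schemes
      (Jac_tilde_d R d :: ('u, (nat \<Rightarrow> 'u) set \<times> (nat \<Rightarrow> 'u) set) functor_of_points) (Jac_tilde_d R' d)"
proof -
  define c where "c = 2 * delta R"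
  have c: "2 * delta R = c" "2 * delta R' = c"
    using plane_branch_symmetric(3)[OF b(1)] plane_branch_symmetric(3)[OF b(2)] val by (simp_all add: c_def)
  note alg = plane_branch_subalgebra(1)[OF b(1)] plane_branch_subalgebra(1)[OF b(2)]
  note cond = plane_branch_symmetric(1)[OF b(1), unfolded c] plane_branch_symmetric(1)[OF b(2), unfolded c]
  obtain t s where ts: "semilinear_transfer c R R' t s" "semilinear_transfer c R' R s t"
    using plane_branch_ex_transfer[OF b c(1)[symmetric] c(2)[symmetric] \<psi>] by blast
  have T: "submodule_transfer A R R' c t s" "submodule_transfer A R' R c s t" if "calg A" for A :: "'u calg"
    by (intro submodule_transfer.intro submodule_transfer_axioms.intro complex_algebraI[OF that] alg cond ts)+
  show "isomorphic_schemes (Jac_tilde R :: ('u, (nat \<Rightarrow> 'u) set \<times> (nat \<Rightarrow> 'u) set) functor_of_points) (Jac_tilde R')"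
    unfolding Jac_tilde_def
    by (rule cover_isomorphic[OF Jac_cover_transfer[OF c val T(1)] Jac_cover_transfer[OF c(2,1) val[symmetric] T(2)]])
  show "isomorphic_schemes (Jac_tilde_d R d :: ('u, (nat \<Rightarrow> 'u) set \<times> (nat \<Rightarrow> 'u) set) functor_of_points) (Jac_tilde_d R' d)"
    unfolding Jac_tilde_d_def
    by (rule cover_isomorphic[OF Jac_d_cover_transfer[OF c val T(1)] Jac_d_cover_transfer[OF c(2,1) val[symmetric] T(2)]])
qed

theorem proposition3p3:
  fixes I :: "'i set"
    and R :: "'i \<Rightarrow> complex fps set"
    and x y :: "'i \<Rightarrow> complex fps"
  assumes branch: "\<And>i. i \<in> I \<Longrightarrow> plane_branch (R i) (x i) (y i)"
    and same_semigroup: "\<And>i j. i \<in> I \<Longrightarrow> j \<in> I \<Longrightarrow> val_semigroup (R i) = val_semigroup (R j)"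
    and same_ideal: "\<And>i j. i \<in> I \<Longrightarrow> j \<in> I \<Longrightarrow>
          \<exists>\<psi>. C_automorphism \<psi> \<and> \<psi> ` C_tilde (R i) (x i) (y i) = C_tilde (R j) (x j) (y j)"
  shows
    "(\<forall>i\<in>I. \<forall>j\<in>I.
        isomorphic_schemes
          (Jac_tilde (R i) :: ('u, (nat \<Rightarrow> 'u) set \<times> (nat \<Rightarrow> 'u) set) functor_of_points)
          (Jac_tilde (R j) :: ('u, (nat \<Rightarrow> 'u) set \<times> (nat \<Rightarrow> 'u) set) functor_of_points) \<and>
        (\<forall>d. isomorphic_schemes
          (Jac_tilde_d (R i) d :: ('u, (nat \<Rightarrow> 'u) set \<times> (nat \<Rightarrow> 'u) set) functor_of_points)
          (Jac_tilde_d (R j) d :: ('u, (nat \<Rightarrow> 'u) set \<times> (nat \<Rightarrow> 'u) set) functor_of_points))) \<and>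
     (\<forall>i\<in>I. \<forall>d\<le>delta (R i).
        covers
          (Jac_tilde_d (R i) d :: ('u, (nat \<Rightarrow> 'u) set \<times> (nat \<Rightarrow> 'u) set) functor_of_points)
          (Jac_d (R i) d) (\<lambda>A. fst) \<and>
        (\<forall>M\<in>jac (R i) d.
          isomorphic_schemes
            (Jac_tilde_fibre (R i) d M :: ('u, (nat \<Rightarrow> 'u) set \<times> (nat \<Rightarrow> 'u) set) functor_of_points)
            (affine_space (delta (R i) - d) :: ('u, nat \<Rightarrow> 'u) functor_of_points)))"
proof (intro conjI ballI allI impI)
  fix i j assume ij: "i \<in> I" "j \<in> I"
  from same_ideal[OF ij] obtain \<psi> where \<psi>: "C_automorphism \<psi>"
    "\<psi> ` C_tilde (R i) (x i) (y i) = C_tilde (R j) (x j) (y j)" by blast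
  note iso = plane_branch_cover_isomorphic[OF branch[OF ij(1)] branch[OF ij(2)] same_semigroup[OF ij] \<psi>]
  show "isomorphic_schemes (Jac_tilde (R i) :: ('u, (nat \<Rightarrow> 'u) set \<times> (nat \<Rightarrow> 'u) set) functor_of_points) (Jac_tilde (R j))"
    by (rule iso(1))
  show "isomorphic_schemes (Jac_tilde_d (R i) d :: ('u, (nat \<Rightarrow> 'u) set \<times> (nat \<Rightarrow> 'u) set) functor_of_points) (Jac_tilde_d (R j) d)" for d
    by (rule iso(2))
next
  fix i d
  show "covers (Jac_tilde_d (R i) d :: ('u, (nat \<Rightarrow> 'u) set \<times> (nat \<Rightarrow> 'u) set) functor_of_points) (Jac_d (R i) d) (\<lambda>A. fst)"
    unfolding Jac_tilde_d_def by (rule cover_covers) (auto simp: Jac_d_def)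
next
  fix i d M assume "i \<in> I" "M \<in> jac (R i) d"
  then show "isomorphic_schemes (Jac_tilde_fibre (R i) d M :: ('u, (nat \<Rightarrow> 'u) set \<times> (nat \<Rightarrow> 'u) set) functor_of_points)
      (affine_space (delta (R i) - d))"
    using plane_branch_subalgebra(1)[OF branch] plane_branch_symmetric(1)[OF branch]
    by (intro fibre_isomorphic[of _ "2 * delta (R i)"]) auto
qed

end
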